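(* Let $R>0$ and let $n$ be a radial optical index such that $n(r)=1$ for $r>R$, $n\in\mathcal C^\infty([0,R])$ and $n(r)>1$ for all $r\le R$. Choose $p\in\{\pm1\}$. Assume $\breve\kappa<0$. Let $R_0\in(0,R)$ be such that $1+\frac{R_0n'(R_0)}{n(R_0)}=0$ and $\breve\mu_0:=2-\frac{R_0^2n''(R_0)}{n(R_0)}>0$. Then for each $j\in\mathbb N$ there exists a family of resonance quasi-pairs $\mathfrak F_{p;j}=(\mathfrak K_{p;j},\mathfrak U_{p;j})$ with $\mathfrak K_{p;j}=(\underline k_{p;j}(m))_{m\ge1}$ and $\mathfrak U_{p;j}=(\underline u_{p;j}(m))_{m\ge1}$, such that: (i) The regularity property with respect to $m$ (item (4) of the definition in the context) holds with $\beta=\frac12$: there exist coefficients $\mathrm K^{\ell}_{p;j}$ for any $\ell\in\mathbb N$, and constants $C_N$ so that $$\forall N\in\mathbb N,\qquad \Big|\frac{\underline k_{p;j}(m)}{m}-\sum_{\ell=0}^{N-1}\mathrm K^{\ell}_{p;j}\,m^{-\ell/2}\Big|\le C_N\,m^{-N/2}.$$ The coefficients $\mathrm K^0_{p;j}$ are all equal to $(R_0\,n(R_0))^{-1}$, the coefficients of degree $1$ are zero, and the coefficients of degree $2$ are all distinct with $j$, namely $\mathrm K^2_{p;j}=\frac1{R_0\,n(R_0)}\big(j+\frac12\big)\sqrt{\breve\mu_0}$. (ii) The functions $\underline u_{p;j}(m)$ have the form, in polar coordinates, $\underline u_{p;j}(m;x,y)=\underline w_{p;j}(m;r)\,e^{\mathrm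 i m\theta}$, with radial functions $\underline w_{p;j}(m)$ that are smooth in the scaled variable $\sigma=m^{1/2}\big(\frac r{R_0}-1\big)$. There exists a smooth function $\Phi_{p;j}\in\mathcal C^\infty([0,1],\mathcal S(\mathbb R))$, $(t,\sigma)\mapsto\Phi_{p;j}(t,\sigma)$, such that $$\underline w_{p;j}(m;r)=\mathfrak X(r)\,\Phi_{p;j}(m^{-1/2},\sigma),$$ where $\mathfrak X\in\mathcal C_0^\infty(\mathbb R_+)$, $\mathfrak X\equiv1$ in a neighborhood of $R_0$.
   Context: $\mathbb N$ is the set of non-negative integers. $\Omega$ is the open disk of radius $R$ centered at the origin of $\mathbb R^2$; $n=n(r)$, $r=|x|$. $n_0=\lim_{r\nearrow R}n(r)$, $n_1=\lim_{r\nearrow R}n'(r)$, $\breve\kappa=R\big(\frac1R+\frac{n_1}{n_0}\big)$. $\mathcal S(\mathbb R)$ is the Schwartz space. $\mathcal O(m^{-\infty})$ means $\mathcal O(m^{-N})$ for every $N$. $[f]_{\partial\Omega}$ is the jump of $f$ across $\partial\Omega$. A family of resonance quasi-pairs is formed by a sequence $(\underline k(m))_{m\ge1}$ of real numbers (quasi-resonances) and a sequence $(\underline u(m))_{m\ge1}$ of complex-valued functions (quasi-modes) such that: (1) $\|\underline u(m)\|_{L^2(\mathbb R^2)}=1$ and $\underline u(m)\in H^2_p(\mathbb R^2,\Omega):=\{u\in L^2(\mathbb R^2):\ u|_\Omega\in H^2(\Omega),\ u|_{\mathbb R^2\setminus\overline\Omega}\in H^2(\mathbb R^2\setminus\overline\Omega),\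 [u]_{\partial\Omega}=0,\ [n^{p-1}\partial_\nu u]_{\partial\Omega}=0\}$; (2) as $m\to+\infty$, $\|-\operatorname{div}(n^{p-1}\nabla\underline u(m))-\underline k(m)^2n^{p+1}\underline u(m)\|_{L^2(\mathbb R^2)}=\mathcal O(m^{-\infty})$; (3) (uniform localization) there is $\mathfrak X\in\mathcal C_0^\infty(\mathbb R^2)$, $0\le\mathfrak X\le1$, such that $\|\mathfrak X\underline u(m)\|_{L^2(\mathbb R^2)}\ge\frac12$ and (2) holds with $\mathfrak X\underline u(m)$ replacing $\underline u(m)$; (4) (regularity with respect to $m$) there exist $\beta>0$ and $\mathrm K\in\mathcal C^\infty([0,1])$ such that $\underline k(m)/m=\mathrm K(m^{-\beta})$ for all $m\ge1$.
   Formalization: In (ii) the radial functions are w(m;r) = m^{1/4} X(r) Φ(m^{-1/2},σ): without the factor m^{1/4} the L² norm of u(m) would be O(m^{-1/4}), contradicting the required normalization to 1. *)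

theory Defs
  imports "HOL-Analysis.Analysis" "HOL-Library.Landau_Symbols"
begin

section \<open>Smooth functions\<close>

text \<open>\<open>D [h\<^sub>k, \<dots>, h\<^sub>1] x\<close> is the iterated derivative of \<open>f\<close> at \<open>x\<close> in the directions
  \<open>h\<^sub>1, \<dots>, h\<^sub>k\<close>. Derivatives are relative to \<open>S\<close>, hence one-sided at the end points of a compact
  interval. The notion is only meant for open sets and nondegenerate intervals \<open>S\<close>, where such
  derivatives are unique.\<close>

definition smooth_on :: "'a::real_normed_vector set \<Rightarrow> ('a \<Rightarrow> 'b::real_normed_vector) \<Rightarrow> bool" where
  "smooth_on S f \<longleftrightarrow>
     (\<exists>D :: 'a list \<Rightarrow> 'a \<Rightarrow> 'b.
        (\<forall>x\<in>S. D [] x = f x) \<and>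
        (\<forall>hs. \<forall>x\<in>S. (D hs has_derivative (\<lambda>h. D (h # hs) x)) (at x within S)))"

definition test_function :: "'a::real_normed_vector set \<Rightarrow> ('a \<Rightarrow> 'b::real_normed_vector) \<Rightarrow> bool" where
  "test_function U \<phi> \<longleftrightarrow>
     smooth_on UNIV \<phi> \<and> (\<exists>K. compact K \<and> K \<subseteq> U \<and> (\<forall>x. x \<notin> K \<longrightarrow> \<phi> x = 0))"

section \<open>Smooth functions with values in the Schwartz space\<close>

definition iter_deriv :: "nat \<Rightarrow> (real \<Rightarrow> complex) \<Rightarrow> real \<Rightarrow> complex" where
  "iter_deriv b = (\<lambda>f x. vector_derivative f (at x)) ^^ b"

definition schwartz :: "(real \<Rightarrow> complex) \<Rightarrow> bool" where
  "schwartz f \<longleftrightarrow>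
     smooth_on UNIV f \<and> (\<forall>a b. bounded (range (\<lambda>x. x ^ a *\<^sub>R iter_deriv b f x)))"

definition schwartz_seminorm :: "nat \<Rightarrow> nat \<Rightarrow> (real \<Rightarrow> complex) \<Rightarrow> real" where
  "schwartz_seminorm a b f = (SUP x. norm (x ^ a *\<^sub>R iter_deriv b f x))"

text \<open>\<open>\<Psi> k\<close> is the \<open>k\<close>-th derivative of \<open>t \<mapsto> \<Phi> t\<close>: difference quotients converge in the Frechet
  topology of the Schwartz space.\<close>

definition smooth_schwartz_valued :: "real set \<Rightarrow> (real \<Rightarrow> real \<Rightarrow> complex) \<Rightarrow> bool" where
  "smooth_schwartz_valued I \<Phi> \<longleftrightarrow>
     (\<exists>\<Psi> :: nat \<Rightarrow> real \<Rightarrow> real \<Rightarrow> complex.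
        (\<forall>t\<in>I. \<Psi> 0 t = \<Phi> t) \<and>
        (\<forall>k. \<forall>t\<in>I. schwartz (\<Psi> k t) \<and>
           (\<forall>a b. ((\<lambda>s. schwartz_seminorm a b
                       (\<lambda>x. (\<Psi> k s x - \<Psi> k t x) /\<^sub>R (s - t) - \<Psi> (Suc k) t x)) \<longlongrightarrow> 0)
                  (at t within I))))"

section \<open>Square integrable functions and Sobolev spaces\<close>

definition L2_on :: "'a::euclidean_space set \<Rightarrow> ('a \<Rightarrow> complex) \<Rightarrow> bool" where
  "L2_on U f \<longleftrightarrow>
     set_borel_measurable lborel U f \<and> set_integrable lborel U (\<lambda>x. (norm (f x))\<^sup>2)"

definition L2_norm_on :: "'a::euclidean_space set \<Rightarrow> ('a \<Rightarrow> complex) \<Rightarrow> real" where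
  "L2_norm_on U f = sqrt (LINT x:U|lborel. (norm (f x))\<^sup>2)"

definition weak_partial ::
    "'a::euclidean_space set \<Rightarrow> 'a \<Rightarrow> ('a \<Rightarrow> complex) \<Rightarrow> ('a \<Rightarrow> complex) \<Rightarrow> bool" where
  "weak_partial U b u v \<longleftrightarrow>
     L2_on U u \<and> L2_on U v \<and>
     (\<forall>\<phi> :: 'a \<Rightarrow> real. test_function U \<phi> \<longrightarrow>
        (LINT x:U|lborel. frechet_derivative \<phi> (at x) b *\<^sub>R u x) =
        - (LINT x:U|lborel. \<phi> x *\<^sub>R v x))"

primrec sobolev :: "nat \<Rightarrow> 'a::euclidean_space set \<Rightarrow> ('a \<Rightarrow> complex) \<Rightarrow> bool" where
  "sobolev 0 U u \<longleftrightarrow> L2_on U u"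
| "sobolev (Suc k) U u \<longleftrightarrow>
     L2_on U u \<and> (\<forall>b\<in>Basis. \<exists>v. weak_partial U b u v \<and> sobolev k U v)"

text \<open>A vector field is given by its components \<open>F b\<close> along the basis vectors \<open>b\<close>;
  \<open>d\<close> is its distributional divergence on the whole space.\<close>

definition weak_div :: "('a::euclidean_space \<Rightarrow> 'a \<Rightarrow> complex) \<Rightarrow> ('a \<Rightarrow> complex) \<Rightarrow> bool" where
  "weak_div F d \<longleftrightarrow>
     (\<forall>b\<in>Basis. L2_on UNIV (F b)) \<and> L2_on UNIV d \<and>
     (\<forall>\<phi> :: 'a \<Rightarrow> real. test_function UNIV \<phi> \<longrightarrow>
        (LINT x|lborel. (\<Sum>b\<in>Basis. frechet_derivative \<phi> (at x) b *\<^sub>R F b x)) =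
        - (LINT x|lborel. \<phi> x *\<^sub>R d x))"

section \<open>Traces on a circle and transmission conditions\<close>

definition polar :: "real \<Rightarrow> real \<Rightarrow> real^2" where
  "polar r \<theta> = vector [r * cos \<theta>, r * sin \<theta>]"

text \<open>The trace on the circle of radius \<open>R\<close>, seen as a function \<open>g\<close> of the angle, of an \<open>H\<^sup>1\<close>
  function \<open>v\<close> on \<open>U\<close> (one of the two components of the complement of the circle): the continuous
  extension from smooth functions of the restriction map.\<close>

definition has_trace ::
    "real \<Rightarrow> (real^2) set \<Rightarrow> (real^2 \<Rightarrow> complex) \<Rightarrow> (real \<Rightarrow> complex) \<Rightarrow> bool" where
  "has_trace R U v g \<longleftrightarrow>
     L2_on {0..2*pi} g \<and>
     (\<exists>\<phi> :: nat \<Rightarrow> real^2 \<Rightarrow> complex.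
        (\<forall>i. test_function UNIV (\<phi> i)) \<and>
        (\<lambda>i. L2_norm_on U (\<lambda>x. \<phi> i x - v x)) \<longlonglongrightarrow> 0 \<and>
        (\<forall>b\<in>Basis. \<exists>w. weak_partial U b v w \<and>
           (\<lambda>i. L2_norm_on U (\<lambda>x. frechet_derivative (\<phi> i) (at x) b - w x)) \<longlonglongrightarrow> 0) \<and>
        (\<lambda>i. L2_norm_on {0..2*pi} (\<lambda>\<theta>. \<phi> i (polar R \<theta>) - g \<theta>)) \<longlonglongrightarrow> 0)"

text \<open>The normal \<open>polar 1 \<theta>\<close> points away from the origin for both choices of \<open>U\<close>.\<close>

definition has_normal_trace ::
    "real \<Rightarrow> (real^2) set \<Rightarrow> (real^2 \<Rightarrow> complex) \<Rightarrow> (real \<Rightarrow> complex) \<Rightarrow> bool" where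
  "has_normal_trace R U u h \<longleftrightarrow>
     (\<exists>w g. (\<forall>b\<in>Basis. weak_partial U b u (w b) \<and> has_trace R U (w b) (g b)) \<and>
            (\<forall>\<theta>. h \<theta> = (\<Sum>b\<in>Basis. (polar 1 \<theta> \<bullet> b) *\<^sub>R g b \<theta>)))"

definition H2p :: "real \<Rightarrow> (real \<Rightarrow> real) \<Rightarrow> int \<Rightarrow> (real^2 \<Rightarrow> complex) \<Rightarrow> bool" where
  "H2p R n p u \<longleftrightarrow>
     L2_on UNIV u \<and> sobolev 2 (ball 0 R) u \<and> sobolev 2 (- cball 0 R) u \<and>
     (\<exists>g. has_trace R (ball 0 R) u g \<and> has_trace R (- cball 0 R) u g) \<and>
     (\<exists>h\<^sub>i h\<^sub>e. has_normal_trace R (ball 0 R) u h\<^sub>i \<and> has_normal_trace R (- cball 0 R) u h\<^sub>e \<and>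
        (AE \<theta> in lborel. \<theta> \<in> {0..2*pi} \<longrightarrow>
           (Lim (at_left R) n powi (p - 1)) *\<^sub>R h\<^sub>i \<theta> =
           (Lim (at_right R) n powi (p - 1)) *\<^sub>R h\<^sub>e \<theta>))"

section \<open>Resonance quasi-pairs\<close>

text \<open>\<open>f = - div (n\<^bsup>p-1\<^esup> \<nabla>u) - k\<^sup>2 n\<^bsup>p+1\<^esup> u\<close> in the sense of distributions, with \<open>f\<close> in \<open>L\<^sup>2\<close>.\<close>

definition has_residual ::
    "(real \<Rightarrow> real) \<Rightarrow> int \<Rightarrow> real \<Rightarrow> (real^2 \<Rightarrow> complex) \<Rightarrow> (real^2 \<Rightarrow> complex) \<Rightarrow> bool" where
  "has_residual n p k u f \<longleftrightarrow>
     (\<exists>g d. (\<forall>b\<in>Basis. weak_partial UNIV b u (g b)) \<and>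
            weak_div (\<lambda>b x. (n (norm x) powi (p - 1)) *\<^sub>R g b x) d \<and>
            f = (\<lambda>x. - d x - (k\<^sup>2 * n (norm x) powi (p + 1)) *\<^sub>R u x))"

definition rapidly_decaying_residual ::
    "(real \<Rightarrow> real) \<Rightarrow> int \<Rightarrow> (nat \<Rightarrow> real) \<Rightarrow> (nat \<Rightarrow> real^2 \<Rightarrow> complex) \<Rightarrow> bool" where
  "rapidly_decaying_residual n p k u \<longleftrightarrow>
     (\<exists>f. (\<forall>m\<ge>1. has_residual n p (k m) (u m) (f m)) \<and>
          (\<forall>N::nat. (\<lambda>m. L2_norm_on UNIV (f m)) \<in> O(\<lambda>m. real m powr (- real N))))"

definition regular_expansion :: "real \<Rightarrow> (nat \<Rightarrow> real) \<Rightarrow> bool" where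
  "regular_expansion \<beta> k \<longleftrightarrow>
     (\<exists>\<K> :: real \<Rightarrow> real. smooth_on {0..1} \<K> \<and>
        (\<forall>m\<ge>1. k m / real m = \<K> (real m powr (- \<beta>))))"

text \<open>Sequences are indexed by all of \<open>nat\<close>; only the terms with \<open>m \<ge> 1\<close> are meaningful.\<close>

definition resonance_quasi_pairs ::
    "real \<Rightarrow> (real \<Rightarrow> real) \<Rightarrow> int \<Rightarrow> (nat \<Rightarrow> real) \<Rightarrow> (nat \<Rightarrow> real^2 \<Rightarrow> complex) \<Rightarrow> bool" where
  "resonance_quasi_pairs R n p k u \<longleftrightarrow>
     (\<forall>m\<ge>1. L2_norm_on UNIV (u m) = 1 \<and> H2p R n p (u m)) \<and>
     rapidly_decaying_residual n p k u \<and>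
     (\<exists>X :: real^2 \<Rightarrow> real. test_function UNIV X \<and> (\<forall>x. 0 \<le> X x \<and> X x \<le> 1) \<and>
        (\<forall>m\<ge>1. L2_norm_on UNIV (\<lambda>x. X x *\<^sub>R u m x) \<ge> 1/2) \<and>
        rapidly_decaying_residual n p k (\<lambda>m x. X x *\<^sub>R u m x)) \<and>
     (\<exists>\<beta>>0. regular_expansion \<beta> k)"

section \<open>Parameters of the optical index\<close>

definition kappa_breve :: "real \<Rightarrow> (real \<Rightarrow> real) \<Rightarrow> real" where
  "kappa_breve R n = R * (1 / R + Lim (at_left R) (deriv n) / Lim (at_left R) n)"

definition mu_breve :: "real \<Rightarrow> (real \<Rightarrow> real) \<Rightarrow> real" where
  "mu_breve r n = 2 - r\<^sup>2 * deriv (deriv n) r / n r"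

end

theory Submission
  imports Defs
begin

text \<open>
  In the scaled variables \<open>t = m\<^sup>-\<^sup>1\<^sup>/\<^sup>2\<close>, \<open>r = R\<^sub>0 (1 + t s)\<close>, the radial equation for \<open>e\<^sup>i\<^sup>m\<^sup>\<theta>\<close>-modes is, up to
  a factor \<open>t\<^sup>2\<close>, a smooth perturbation in \<open>t\<close> of the harmonic oscillator \<open>- \<partial>\<^sub>s\<^sup>2 + \<mu> s\<^sup>2\<close>, with
  \<open>\<mu> = mu_breve R\<^sub>0 n\<close>: the vanishing of \<open>1 + R\<^sub>0 n'(R\<^sub>0) / n(R\<^sub>0)\<close> kills the linear term of the effective
  potential at \<open>R\<^sub>0\<close>. After conjugation by the ground state, each order in \<open>t\<close> asks for a
  polynomial solution of an inhomogeneous Hermite equation, and the next coefficient of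
  \<open>(k R\<^sub>0 n(R\<^sub>0) / m)\<^sup>2\<close> is the one that makes it solvable. Borel summation in \<open>t\<close> turns the
  formal series into a smooth amplitude whose residual vanishes to infinite order at \<open>t = 0\<close>,
  that is \<open>O(m\<^sup>-\<^sup>N)\<close> for every \<open>N\<close>. The amplitude is cut off to an annulus inside the disk, where
  everything is smooth and the transmission conditions are void; dividing by its \<open>L\<^sup>2\<close> norm,
  itself smooth in \<open>t\<close> and positive on \<open>[0, 1]\<close>, normalizes it.
\<close>

section \<open>Calculus of smooth functions\<close>

text \<open>The spectral unknown is a function \<open>e\<close> with
  \<open>k^2 = (m / (R\<^sub>0 n(R\<^sub>0)))^2 (1 + t^2 e(t))\<close> and
  \<open>m = t^(-2)\<close>. In each order the newest coefficient of \<open>e\<close> only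
  multiplies the leading amplitude, and \<open>k\<close> itself appears only at the end, through a
  square root. Because the correction starts at \<open>t^2\<close>, the expansion of
  \<open>k / m\<close> has no term of degree one, and \<open>e(0) = (2j+1) sqrt \<mu>\<close> is
  halved into \<open>(j + 1/2) sqrt \<mu>\<close>. Two demands shape the rest. Smoothness is
  required up to \<open>t = 1\<close>, although the equation says something only at
  \<open>t = 0\<close>; therefore Borel sums come with a bound on their distance to the leading
  term, which keeps \<open>e\<close> and the norm positive for every \<open>m \<ge> 1\<close>. And
  the cut-off must not spoil the formal solution: in the scaled variable it is
  \<open>Y (t * s)\<close>, whose Taylor series at \<open>t = 0\<close> is 1, so no order notices it
  and its error is part of a residual with vanishing Taylor series. What remains is to play a high
  power of \<open>t\<close> and sub-Gaussian growth in \<open>s\<close> against the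
  Gaussian.\<close>

lemma smooth_on_coinduct:
  assumes "P f"
    and step: "\<And>g. P g \<Longrightarrow> \<exists>g'. (\<forall>x\<in>S. (g has_derivative (\<lambda>h. g' h x)) (at x within S)) \<and> (\<forall>h. P (g' h))"
  shows "smooth_on S f"
proof -
  obtain d where d: "\<And>g. P g \<Longrightarrow> (\<forall>x\<in>S. (g has_derivative (\<lambda>h. d g h x)) (at x within S)) \<and> (\<forall>h. P (d g h))"
    using step by metis
  \<comment> \<open>Smoothness is a greatest fixed point: one choice \<open>d\<close> of derivatives
    staying inside \<open>P\<close>, iterated along the list of directions, supplies the whole
    family \<open>D\<close>.\<close>
  define D where "D = rec_list f (\<lambda>h hs g. d g h)"
  have D: "D [] = f" "D (h # hs) = d (D hs) h" for h hs
    by (auto simp: D_def)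
  have P: "P (D hs)" for hs
    by (induction hs) (use D d \<open>P f\<close> in auto)
  show ?thesis
    unfolding smooth_on_def using d[OF P] D by (intro exI[of _ D]) auto
qed

lemma smooth_onE:
  assumes "smooth_on S f"
  obtains f' where "\<And>x. x \<in> S \<Longrightarrow> (f has_derivative (\<lambda>h. f' h x)) (at x within S)" "\<And>h. smooth_on S (f' h)"
proof -
  from assms obtain D where D: "\<forall>x\<in>S. D [] x = f x"
     "\<forall>hs. \<forall>x\<in>S. (D hs has_derivative (\<lambda>h. D (h # hs) x)) (at x within S)"
    unfolding smooth_on_def by blast
  have "(f has_derivative (\<lambda>h. D [h] x)) (at x within S)" if "x \<in> S" for x
  proof (rule has_derivative_transform[OF that])
    show "(D [] has_derivative (\<lambda>h. D [h] x)) (at x within S)" using D(2) that by blast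
  qed (use D(1) in auto)
  moreover have "smooth_on S (D [h])" for h
    unfolding smooth_on_def using D by (intro exI[of _ "\<lambda>hs. D (hs @ [h])"]) auto
  ultimately show ?thesis by (rule that[of "\<lambda>h. D [h]"])
qed

lemma smooth_on_cong:
  assumes "smooth_on S f" "\<And>x. x \<in> S \<Longrightarrow> f x = g x"
  shows "smooth_on S g"
proof -
  from assms obtain D where "\<forall>x\<in>S. D [] x = f x"
     "\<forall>hs. \<forall>x\<in>S. (D hs has_derivative (\<lambda>h. D (h # hs) x)) (at x within S)"
    unfolding smooth_on_def by blast
  then show ?thesis
    unfolding smooth_on_def using assms(2) by (intro exI[of _ D]) auto
qed

lemma smooth_on_subset:
  assumes "smooth_on S f" "T \<subseteq> S"
  shows "smooth_on T f"
proof -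
  from assms obtain D where "\<forall>x\<in>S. D [] x = f x"
     "\<forall>hs. \<forall>x\<in>S. (D hs has_derivative (\<lambda>h. D (h # hs) x)) (at x within S)"
    unfolding smooth_on_def by blast
  then show ?thesis
    unfolding smooth_on_def using assms(2) has_derivative_subset by (intro exI[of _ D]) blast
qed

text \<open>Product and chain rules return sums, which leave a class such as the products
  \<open>B (f x) (g x)\<close>; the coinduction is therefore run up to finite sums.\<close>

inductive sum_closure :: "(('a \<Rightarrow> 'b::ab_group_add) \<Rightarrow> bool) \<Rightarrow> ('a \<Rightarrow> 'b) \<Rightarrow> bool" for P where
  base: "P f \<Longrightarrow> sum_closure P f"
| add: "sum_closure P f \<Longrightarrow> sum_closure P g \<Longrightarrow> sum_closure P (\<lambda>x. f x + g x)"

lemma smooth_on_coinduct_sum: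
  assumes "P f"
    and step: "\<And>g. P g \<Longrightarrow> \<exists>g'. (\<forall>x\<in>S. (g has_derivative (\<lambda>h. g' h x)) (at x within S)) \<and> (\<forall>h. sum_closure P (g' h))"
  shows "smooth_on S f"
proof (rule smooth_on_coinduct[where P = "sum_closure P"])
  show "sum_closure P f" using assms(1) by (rule sum_closure.base)
next
  fix g assume "sum_closure P g"
  then show "\<exists>g'. (\<forall>x\<in>S. (g has_derivative (\<lambda>h. g' h x)) (at x within S)) \<and> (\<forall>h. sum_closure P (g' h))"
  proof induction
    case (base f)
    then show ?case by (rule step)
  next
    case (add f g)
    then obtain f' g' where
      "\<forall>x\<in>S. (f has_derivative (\<lambda>h. f' h x)) (at x within S)" "\<forall>h. sum_closure P (f' h)"
      "\<forall>x\<in>S. (g has_derivative (\<lambda>h. g' h x)) (at x within S)" "\<forall>h. sum_closure P (g' h)"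
      by blast
    then show ?case
      by (intro exI[of _ "\<lambda>h x. f' h x + g' h x"])
        (auto intro!: has_derivative_add sum_closure.add)
  qed
qed

lemma smooth_on_const [intro, simp]: "smooth_on S (\<lambda>_. c)"
  by (rule smooth_on_coinduct[where P = "\<lambda>f. \<exists>c. f = (\<lambda>_. c)"])
    (auto intro!: exI[of _ "\<lambda>_ _. 0"])

lemma smooth_on_linear:
  assumes "bounded_linear L" "smooth_on S f"
  shows "smooth_on S (\<lambda>x. L (f x))"
proof (rule smooth_on_coinduct[where P = "\<lambda>g. \<exists>f. smooth_on S f \<and> g = (\<lambda>x. L (f x))"])
  show "\<exists>f'. smooth_on S f' \<and> (\<lambda>x. L (f x)) = (\<lambda>x. L (f' x))" using assms by blast
next
  fix g assume "\<exists>f. smooth_on S f \<and> g = (\<lambda>x. L (f x))"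
  then obtain f where f: "smooth_on S f" "g = (\<lambda>x. L (f x))" by blast
  from smooth_onE[OF f(1)] obtain f' where f':
    "\<And>x. x \<in> S \<Longrightarrow> (f has_derivative (\<lambda>h. f' h x)) (at x within S)" "\<And>h. smooth_on S (f' h)" by blast
  then show "\<exists>g'. (\<forall>x\<in>S. (g has_derivative (\<lambda>h. g' h x)) (at x within S)) \<and>
      (\<forall>h. \<exists>f. smooth_on S f \<and> g' h = (\<lambda>x. L (f x)))"
    using bounded_linear.has_derivative[OF assms(1) f'(1)] f'(2) unfolding f(2)
    by (intro exI[of _ "\<lambda>h x. L (f' h x)"]) blast
qed

lemma smooth_on_id: "smooth_on S (\<lambda>x. x)"
proof (rule smooth_on_coinduct[where P = "\<lambda>f. \<exists>a c. f = (\<lambda>x. a *\<^sub>R x + c)"])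
  have "(\<lambda>x::'a. x) = (\<lambda>x. 1 *\<^sub>R x + 0)" by simp
  then show "\<exists>a c. (\<lambda>x::'a. x) = (\<lambda>x. a *\<^sub>R x + c)" by blast
next
  fix g :: "'a \<Rightarrow> 'a" assume "\<exists>a c. g = (\<lambda>x. a *\<^sub>R x + c)"
  then obtain a c where g: "g = (\<lambda>x. a *\<^sub>R x + c)" by blast
  show "\<exists>g'. (\<forall>x\<in>S. (g has_derivative (\<lambda>h. g' h x)) (at x within S)) \<and> (\<forall>h. \<exists>a c. g' h = (\<lambda>x. a *\<^sub>R x + c))"
    unfolding g
  proof (intro exI[of _ "\<lambda>h x. a *\<^sub>R h"] conjI allI ballI)
    show "\<exists>b d. (\<lambda>x. a *\<^sub>R h) = (\<lambda>x. b *\<^sub>R x + d)" for h :: 'a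
      by (rule exI[of _ 0], rule exI[of _ "a *\<^sub>R h"]) simp
  qed (auto intro!: derivative_eq_intros)
qed

lemma smooth_on_bounded_linear:
  assumes "bounded_linear L" shows "smooth_on S L"
  using smooth_on_linear[OF assms smooth_on_id] .

lemma smooth_on_add:
  assumes "smooth_on S f" "smooth_on S g"
  shows "smooth_on S (\<lambda>x. f x + g x)"
proof (rule smooth_on_coinduct[where P = "\<lambda>u. \<exists>f g. smooth_on S f \<and> smooth_on S g \<and> u = (\<lambda>x. f x + g x)"])
  show "\<exists>f' g'. smooth_on S f' \<and> smooth_on S g' \<and> (\<lambda>x. f x + g x) = (\<lambda>x. f' x + g' x)" using assms by blast
next
  fix u assume "\<exists>f g. smooth_on S f \<and> smooth_on S g \<and> u = (\<lambda>x. f x + g x)"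
  then obtain f g where fg: "smooth_on S f" "smooth_on S g" "u = (\<lambda>x. f x + g x)" by blast
  obtain f' where f': "\<And>x. x \<in> S \<Longrightarrow> (f has_derivative (\<lambda>h. f' h x)) (at x within S)" "\<And>h. smooth_on S (f' h)"
    using smooth_onE[OF fg(1)] by blast
  obtain g' where g': "\<And>x. x \<in> S \<Longrightarrow> (g has_derivative (\<lambda>h. g' h x)) (at x within S)" "\<And>h. smooth_on S (g' h)"
    using smooth_onE[OF fg(2)] by blast
  show "\<exists>u'. (\<forall>x\<in>S. (u has_derivative (\<lambda>h. u' h x)) (at x within S)) \<and>
      (\<forall>h. \<exists>f g. smooth_on S f \<and> smooth_on S g \<and> u' h = (\<lambda>x. f x + g x))"
    using has_derivative_add[OF f'(1) g'(1)] f'(2) g'(2) unfolding fg(3)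
    by (intro exI[of _ "\<lambda>h x. f' h x + g' h x"]) blast
qed

lemma smooth_on_bilinear:
  assumes B: "bounded_bilinear B" and "smooth_on S f" "smooth_on S g"
  shows "smooth_on S (\<lambda>x. B (f x) (g x))"
proof (rule smooth_on_coinduct_sum[where P = "\<lambda>u. \<exists>f g. smooth_on S f \<and> smooth_on S g \<and> u = (\<lambda>x. B (f x) (g x))"])
  show "\<exists>f' g'. smooth_on S f' \<and> smooth_on S g' \<and> (\<lambda>x. B (f x) (g x)) = (\<lambda>x. B (f' x) (g' x))" using assms by blast
next
  fix u assume "\<exists>f g. smooth_on S f \<and> smooth_on S g \<and> u = (\<lambda>x. B (f x) (g x))"
  then obtain f g where fg: "smooth_on S f" "smooth_on S g" "u = (\<lambda>x. B (f x) (g x))" by blast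
  obtain f' where f': "\<And>x. x \<in> S \<Longrightarrow> (f has_derivative (\<lambda>h. f' h x)) (at x within S)" "\<And>h. smooth_on S (f' h)"
    using smooth_onE[OF fg(1)] by blast
  obtain g' where g': "\<And>x. x \<in> S \<Longrightarrow> (g has_derivative (\<lambda>h. g' h x)) (at x within S)" "\<And>h. smooth_on S (g' h)"
    using smooth_onE[OF fg(2)] by blast
  show "\<exists>u'. (\<forall>x\<in>S. (u has_derivative (\<lambda>h. u' h x)) (at x within S)) \<and>
      (\<forall>h. sum_closure (\<lambda>u. \<exists>f g. smooth_on S f \<and> smooth_on S g \<and> u = (\<lambda>x. B (f x) (g x))) (u' h))"
  proof (intro exI[of _ "\<lambda>h x. B (f x) (g' h x) + B (f' h x) (g x)"] conjI allI ballI)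
    fix x assume "x \<in> S"
    then show "(u has_derivative (\<lambda>h. B (f x) (g' h x) + B (f' h x) (g x))) (at x within S)"
      unfolding fg(3) using bounded_bilinear.FDERIV[OF B f'(1) g'(1)] by blast
  next
    fix h
    show "sum_closure (\<lambda>u. \<exists>f g. smooth_on S f \<and> smooth_on S g \<and> u = (\<lambda>x. B (f x) (g x)))
       (\<lambda>x. B (f x) (g' h x) + B (f' h x) (g x))"
      using f' g' fg by (intro sum_closure.add sum_closure.base) blast+
  qed
qed

lemmas smooth_on_mult = smooth_on_bilinear[OF bounded_bilinear_mult]
lemmas smooth_on_scaleR = smooth_on_bilinear[OF bounded_bilinear_scaleR]
lemmas smooth_on_inner = smooth_on_bilinear[OF bounded_bilinear_inner]

lemma smooth_on_minus: "smooth_on S f \<Longrightarrow> smooth_on S (\<lambda>x. - f x)"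
  by (rule smooth_on_linear[OF bounded_linear_minus[OF bounded_linear_ident]])

lemma smooth_on_diff: "smooth_on S f \<Longrightarrow> smooth_on S g \<Longrightarrow> smooth_on S (\<lambda>x. f x - g x)"
  using smooth_on_add[OF _ smooth_on_minus] by fastforce

lemma smooth_on_of_real:
  "smooth_on S f \<Longrightarrow> smooth_on S (\<lambda>x. of_real (f x) :: 'a::{real_normed_algebra_1,real_inner})"
  by (rule smooth_on_linear[OF bounded_linear_of_real])

lemma smooth_on_power:
  fixes f :: "_ \<Rightarrow> 'a::real_normed_algebra_1"
  shows "smooth_on S f \<Longrightarrow> smooth_on S (\<lambda>x. f x ^ k)"
  by (induction k) (auto intro: smooth_on_mult)

lemma smooth_on_continuous_on: "smooth_on S f \<Longrightarrow> continuous_on S f"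
  by (meson smooth_onE has_derivative_continuous_on)

lemma smooth_on_vector_derivative:
  fixes f :: "real \<Rightarrow> 'b::real_normed_vector"
  assumes "smooth_on S f"
  obtains f' where "\<And>x. x \<in> S \<Longrightarrow> (f has_vector_derivative f' x) (at x within S)" "smooth_on S f'"
proof -
  from smooth_onE[OF assms] obtain f' where
    f': "\<And>x. x \<in> S \<Longrightarrow> (f has_derivative (\<lambda>h. f' h x)) (at x within S)" "\<And>h. smooth_on S (f' h)" by blast
  have lin: "(\<lambda>h. f' h x) = (\<lambda>h. h *\<^sub>R f' 1 x)" if "x \<in> S" for x
  proof
    fix h
    show "f' h x = h *\<^sub>R f' 1 x"
      using linear_scale[OF has_derivative_linear[OF f'(1)[OF that]], of h 1] by simp
  qed
  have "(f has_vector_derivative f' 1 x) (at x within S)" if "x \<in> S" for x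
    using f'(1)[OF that] unfolding has_vector_derivative_def lin[OF that] .
  with f'(2) that show ?thesis by blast
qed

lemma smooth_on_coinduct_vector:
  fixes f :: "real \<Rightarrow> 'b::real_normed_vector"
  assumes "P f"
    and step: "\<And>g. P g \<Longrightarrow> \<exists>g'. (\<forall>x\<in>S. (g has_vector_derivative g' x) (at x within S)) \<and> P g'"
  shows "smooth_on S f"
\<comment> \<open>The derivative in direction \<open>h\<close> is \<open>h\<close> times the vector
  derivative; the factor \<open>c\<close> collects these scalars.\<close>
proof (rule smooth_on_coinduct[where P = "\<lambda>u. \<exists>c g. P g \<and> u = (\<lambda>x. c *\<^sub>R g x)"])
  show "\<exists>c g. P g \<and> f = (\<lambda>x. c *\<^sub>R g x)" using assms(1) by (intro exI[of _ 1] exI[of _ f]) auto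
next
  fix u assume "\<exists>c g. P g \<and> u = (\<lambda>x. c *\<^sub>R g x)"
  then obtain c g where g: "P g" "u = (\<lambda>x. c *\<^sub>R g x)" by blast
  then obtain g' where g': "\<And>x. x \<in> S \<Longrightarrow> (g has_vector_derivative g' x) (at x within S)" "P g'"
    using step by blast
  show "\<exists>u'. (\<forall>x\<in>S. (u has_derivative (\<lambda>h. u' h x)) (at x within S)) \<and> (\<forall>h. \<exists>c g. P g \<and> u' h = (\<lambda>x. c *\<^sub>R g x))"
  proof (intro exI[of _ "\<lambda>h x. (c * h) *\<^sub>R g' x"] conjI ballI allI)
    fix x assume "x \<in> S"
    from has_derivative_scaleR_right[OF g'(1)[OF this, unfolded has_vector_derivative_def], of c]
    show "(u has_derivative (\<lambda>h. (c * h) *\<^sub>R g' x)) (at x within S)" by (simp add: g)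
  qed (use g' in blast)
qed

text \<open>The functions \<open>a x *\<^sub>R F (g x)\<close> with \<open>a\<close> and
  \<open>F\<close> smooth are closed under differentiation up to sums. Since \<open>g\<close> is
  real valued, the derivative of \<open>F\<close> is a single function \<open>F'\<close> of the same
  type, and the directional derivative of \<open>g\<close> joins the weight
  \<open>a\<close>.\<close>

lemma smooth_on_compose:
  fixes F :: "real \<Rightarrow> 'b::real_normed_vector"
  assumes F: "smooth_on T F" and g: "smooth_on S g" "g ` S \<subseteq> T"
  shows "smooth_on S (\<lambda>x. F (g x))"
proof (rule smooth_on_coinduct_sum[where P = "\<lambda>u. \<exists>F a. smooth_on T F \<and> smooth_on S a \<and> u = (\<lambda>x. a x *\<^sub>R F (g x))"])
  show "\<exists>F' a. smooth_on T F' \<and> smooth_on S a \<and> (\<lambda>x. F (g x)) = (\<lambda>x. a x *\<^sub>R F' (g x))"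
    using F by (intro exI[of _ F] exI[of _ "\<lambda>_. 1"]) auto
next
  let ?P = "\<lambda>u. \<exists>F a. smooth_on T F \<and> smooth_on S a \<and> u = (\<lambda>x. a x *\<^sub>R F (g x))"
  fix u assume "?P u"
  then obtain F a where Fa: "smooth_on T F" "smooth_on S a" "u = (\<lambda>x. a x *\<^sub>R F (g x))" by blast
  obtain F' where F': "\<And>x. x \<in> T \<Longrightarrow> (F has_vector_derivative F' x) (at x within T)" "smooth_on T F'"
    using smooth_on_vector_derivative[OF Fa(1)] by blast
  obtain a' where a': "\<And>x. x \<in> S \<Longrightarrow> (a has_derivative (\<lambda>h. a' h x)) (at x within S)" "\<And>h. smooth_on S (a' h)"
    using smooth_onE[OF Fa(2)] by blast
  obtain g' where g': "\<And>x. x \<in> S \<Longrightarrow> (g has_derivative (\<lambda>h. g' h x)) (at x within S)" "\<And>h. smooth_on S (g' h)"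
    using smooth_onE[OF g(1)] by blast
  show "\<exists>u'. (\<forall>x\<in>S. (u has_derivative (\<lambda>h. u' h x)) (at x within S)) \<and> (\<forall>h. sum_closure ?P (u' h))"
  proof (intro exI[of _ "\<lambda>h x. (a x * g' h x) *\<^sub>R F' (g x) + a' h x *\<^sub>R F (g x)"] conjI allI ballI)
    fix x assume x: "x \<in> S"
    then have "((\<lambda>x. F (g x)) has_derivative (\<lambda>h. g' h x *\<^sub>R F' (g x))) (at x within S)"
      using has_derivative_in_compose2[of T F "\<lambda>y h. h *\<^sub>R F' y" g S x "\<lambda>h. g' h x"] F'(1) g g'(1)
      unfolding has_vector_derivative_def by blast
    from has_derivative_scaleR[OF a'(1)[OF x] this]
    show "(u has_derivative (\<lambda>h. (a x * g' h x) *\<^sub>R F' (g x) + a' h x *\<^sub>R F (g x))) (at x within S)"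
      unfolding Fa(3) by simp
  next
    fix h
    have "?P (\<lambda>x. (a x * g' h x) *\<^sub>R F' (g x))"
      by (intro exI[of _ F'] exI[of _ "\<lambda>x. a x * g' h x"] conjI smooth_on_mult Fa F' g' refl)
    moreover have "?P (\<lambda>x. a' h x *\<^sub>R F (g x))"
      by (intro exI[of _ F] exI[of _ "a' h"] conjI Fa a' refl)
    ultimately show "sum_closure ?P (\<lambda>x. (a x * g' h x) *\<^sub>R F' (g x) + a' h x *\<^sub>R F (g x))"
      by (intro sum_closure.add sum_closure.base)
  qed
qed

lemma smooth_on_frechet_derivative:
  assumes "smooth_on S f" "open S"
  shows "smooth_on S (\<lambda>x. frechet_derivative f (at x) h)"
    and "x \<in> S \<Longrightarrow> (f has_derivative frechet_derivative f (at x)) (at x)"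
proof -
  from smooth_onE[OF assms(1)] obtain f' where
    f': "\<And>x. x \<in> S \<Longrightarrow> (f has_derivative (\<lambda>h. f' h x)) (at x within S)" "\<And>h. smooth_on S (f' h)" by blast
  then have *: "(f has_derivative (\<lambda>h. f' h x)) (at x)" if "x \<in> S" for x
    using at_within_open[OF that assms(2)] that by metis
  then show "x \<in> S \<Longrightarrow> (f has_derivative frechet_derivative f (at x)) (at x)"
    by (metis frechet_derivative_at)
  have "f' h x = frechet_derivative f (at x) h" if "x \<in> S" for x
    using frechet_derivative_at[OF *[OF that]] by (rule fun_cong)
  then show "smooth_on S (\<lambda>x. frechet_derivative f (at x) h)"
    by (rule smooth_on_cong[OF f'(2)[of h]])
qed

text \<open>On an open set the derivative within the set is the full derivative, so
  \<open>frechet_derivative\<close> is one candidate for both sets and glues.\<close>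

lemma smooth_on_Un_open:
  assumes "smooth_on S f" "smooth_on T f" "open S" "open T"
  shows "smooth_on (S \<union> T) f"
proof (rule smooth_on_coinduct[where P = "\<lambda>f. smooth_on S f \<and> smooth_on T f"])
  fix g :: "'a \<Rightarrow> 'b" assume g: "smooth_on S g \<and> smooth_on T g"
  show "\<exists>g'. (\<forall>x\<in>S \<union> T. (g has_derivative (\<lambda>h. g' h x)) (at x within S \<union> T)) \<and> (\<forall>h. smooth_on S (g' h) \<and> smooth_on T (g' h))"
  proof (intro exI[of _ "\<lambda>h x. frechet_derivative g (at x) h"] conjI ballI allI)
    fix x assume "x \<in> S \<union> T"
    then have "(g has_derivative frechet_derivative g (at x)) (at x)"
      using g assms(3,4) smooth_on_frechet_derivative(2) by blast
    then show "(g has_derivative (\<lambda>h. frechet_derivative g (at x) h)) (at x within S \<union> T)"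
      by (rule has_derivative_at_withinI)
  qed (use g assms(3,4) smooth_on_frechet_derivative(1) in blast)+
qed (use assms in auto)

lemma smooth_on_powr:
  fixes f :: "_ \<Rightarrow> real"
  assumes "smooth_on S f" "\<And>x. x \<in> S \<Longrightarrow> f x > 0"
  shows "smooth_on S (\<lambda>x. f x powr a)"
proof -
  have "smooth_on {0<..} (\<lambda>x::real. x powr a)"
  proof (rule smooth_on_coinduct_vector[where P = "\<lambda>u. \<exists>c a. u = (\<lambda>x. c * x powr a)"])
    show "\<exists>c b. (\<lambda>x. x powr a) = (\<lambda>x. c * x powr b)" by (intro exI[of _ 1] exI[of _ a]) auto
  next
    fix u :: "real \<Rightarrow> real" assume "\<exists>c a. u = (\<lambda>x. c * x powr a)"
    then obtain c a where u: "u = (\<lambda>x. c * x powr a)" by blast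
    show "\<exists>g'. (\<forall>x\<in>{0<..}. (u has_vector_derivative g' x) (at x within {0<..})) \<and> (\<exists>c a. g' = (\<lambda>x. c * x powr a))"
      unfolding u has_real_derivative_iff_has_vector_derivative[symmetric]
      by (intro exI[of _ "\<lambda>x. (c * a) * x powr (a - 1)"])
        (auto intro!: derivative_eq_intros DERIV_cmult[THEN DERIV_cong] has_real_derivative_powr[THEN DERIV_subset])
  qed
  from smooth_on_compose[OF this assms(1)] assms(2) show ?thesis by auto
qed

lemma smooth_on_inverse:
  assumes "smooth_on S f" "\<And>x. x \<in> S \<Longrightarrow> f x > (0::real)"
  shows "smooth_on S (\<lambda>x. inverse (f x))"
  by (rule smooth_on_cong[OF smooth_on_powr[OF assms, of "-1"]]) (use assms(2) in \<open>force simp: powr_minus\<close>)+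

lemma smooth_on_powi:
  assumes "smooth_on S f" "\<And>x. x \<in> S \<Longrightarrow> f x > (0::real)"
  shows "smooth_on S (\<lambda>x. f x powi k)"
  by (rule smooth_on_cong[OF smooth_on_powr[OF assms, of "real_of_int k"]])
    (use assms(2) in \<open>auto intro!: powr_real_of_int' simp: less_imp_le less_imp_neq[THEN not_sym]\<close>)

lemma smooth_on_exp: "smooth_on S f \<Longrightarrow> smooth_on S (\<lambda>x. exp (f x :: real))"
proof -
  have "smooth_on UNIV (exp :: real \<Rightarrow> real)"
    by (rule smooth_on_coinduct_vector[where P = "\<lambda>u. u = exp"])
      (auto simp: has_real_derivative_iff_has_vector_derivative[symmetric])
  then show "smooth_on S f \<Longrightarrow> smooth_on S (\<lambda>x. exp (f x :: real))"
    using smooth_on_compose[of UNIV exp S f] by auto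
qed

lemma smooth_on_norm: "smooth_on (- {0}) (norm :: 'a::real_inner \<Rightarrow> real)"
proof (rule smooth_on_cong)
  show "smooth_on (- {0}) (\<lambda>x::'a. (x \<bullet> x) powr (1/2))"
    by (intro smooth_on_powr smooth_on_inner smooth_on_id) auto
qed (auto simp: norm_eq_sqrt_inner powr_half_sqrt)

lemma smooth_on_UNIV_if_supported:
  assumes "smooth_on U f" "open U" "closed K" "K \<subseteq> U" "\<And>x. x \<notin> K \<Longrightarrow> f x = 0"
  shows "smooth_on UNIV f"
proof -
  have "smooth_on (- K) f"
    by (rule smooth_on_cong[OF smooth_on_const[of _ 0]]) (use assms in auto)
  from smooth_on_Un_open[OF assms(1) this] assms show ?thesis
    by (metis Compl_partition2 Un_mono compl_le_compl_iff open_Compl smooth_on_subset subset_UNIV sup.order_iff Compl_partition order_refl)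
qed

section \<open>Plateau functions\<close>

text \<open>Multiples of the standard flat function \<open>exp (-1/x)\<close> by polynomials in
  \<open>1/x\<close>, extended by zero. The family is closed under differentiation, which makes
  smoothness across the origin a coinduction.\<close>

definition flat :: "real poly \<Rightarrow> real \<Rightarrow> real" where
  "flat p x = (if x > 0 then poly p (inverse x) * exp (- inverse x) else 0)"

lemma poly_times_exp_minus_tendsto_0: "((\<lambda>y. poly p y * exp (- y)) \<longlongrightarrow> (0::real)) at_top"
proof -
  have "((\<lambda>y. \<Sum>i\<le>degree p. coeff p i * (y ^ i / exp y)) \<longlongrightarrow> (\<Sum>i\<le>degree p. coeff p i * 0)) at_top"
    by (intro tendsto_intros tendsto_power_div_exp_0)
  then show ?thesis
    by (simp add: poly_altdef sum_divide_distrib exp_minus divide_inverse sum_distrib_right mult.assoc)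
qed

lemma flat_has_derivative:
  "(flat p has_real_derivative flat ([:0, 0, 1:] * (p - pderiv p)) x) (at x)"
proof -
  let ?q = "[:0, 0, 1:] * (p - pderiv p)"
  consider "x > 0" | "x < 0" | "x = 0" by linarith
  then show ?thesis
  proof cases
    case 1
    have "((\<lambda>x. poly p (inverse x) * exp (- inverse x)) has_real_derivative
        poly p (inverse x) * (exp (- inverse x) * (inverse x * inverse x)) +
        poly (pderiv p) (inverse x) * (- (inverse x * inverse x)) * exp (- inverse x)) (at x)"
      using 1 by (auto intro!: derivative_eq_intros DERIV_chain2[OF poly_DERIV] simp: power2_eq_square)
    then have "((\<lambda>x. poly p (inverse x) * exp (- inverse x)) has_real_derivative flat ?q x) (at x)"
      using 1 by (simp add: flat_def algebra_simps)
    then show ?thesis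
      by (rule has_field_derivative_transform_within_open[of _ _ _ "{0<..}"]) (use 1 in \<open>auto simp: flat_def\<close>)
  next
    case 2
    have "((\<lambda>x. 0) has_real_derivative flat ?q x) (at x)"
      using 2 by (simp add: flat_def)
    then show ?thesis
      by (rule has_field_derivative_transform_within_open[of _ _ _ "{..<0}"]) (use 2 in \<open>auto simp: flat_def\<close>)
  next
    case 3
    \<comment> \<open>\<open>pCons 0 p\<close> is \<open>X p\<close>: dividing
      \<open>flat p y\<close> by \<open>y\<close> only raises the degree of the polynomial in
      \<open>1/y\<close>, and the exponential still wins.\<close>
    have "((\<lambda>y. poly (pCons 0 p) (inverse y) * exp (- inverse y)) \<longlongrightarrow> 0) (at_right 0)"
      using poly_times_exp_minus_tendsto_0 filterlim_inverse_at_top_right by (rule filterlim_compose)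
    then have "((\<lambda>y. flat p y / y) \<longlongrightarrow> 0) (at_right 0)"
      by (rule Lim_transform_eventually)
        (auto simp: eventually_at_right_less flat_def field_simps intro!: eventually_mono[OF eventually_at_right_less[of 0]])
    moreover have "((\<lambda>y. flat p y / y) \<longlongrightarrow> 0) (at_left 0)"
      by (rule Lim_transform_eventually[OF tendsto_const])
        (auto simp: flat_def eventually_at_filter)
    ultimately have "((\<lambda>y. flat p y / y) \<longlongrightarrow> 0) (at 0)"
      by (simp add: filterlim_at_split)
    then show ?thesis
      by (simp add: 3 has_field_derivative_iff) (simp add: flat_def)
  qed
qed

lemma smooth_on_flat: "smooth_on S (flat p)"
proof (rule smooth_on_coinduct_vector[where P = "\<lambda>u. \<exists>p. u = flat p"])
  fix g assume "\<exists>p. g = flat p"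
  then obtain p where g: "g = flat p" by blast
  show "\<exists>g'. (\<forall>x\<in>S. (g has_vector_derivative g' x) (at x within S)) \<and> (\<exists>p. g' = flat p)"
    unfolding g has_real_derivative_iff_has_vector_derivative[symmetric]
    using flat_has_derivative has_field_derivative_at_within by blast
qed blast

lemma exists_plateau:
  fixes \<delta> :: real
  assumes "\<delta> > 0"
  obtains Y :: "real \<Rightarrow> real" where "smooth_on UNIV Y" "\<And>x. 0 \<le> Y x" "\<And>x. Y x \<le> 1"
    "\<And>x. \<bar>x\<bar> \<le> \<delta> \<Longrightarrow> Y x = 1" "\<And>x. \<bar>x\<bar> \<ge> 2 * \<delta> \<Longrightarrow> Y x = 0"
proof -
  define f where "f = flat 1"
  \<comment> \<open>An even quadratic with value 1 at \<open>\<plusminus> \<delta>\<close> and 0 at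
    \<open>\<plusminus> 2 \<delta>\<close>; it replaces \<open>|x|\<close>, which is not
    smooth.\<close>
  define u where "u = (\<lambda>x. (4 * \<delta>\<^sup>2 - x\<^sup>2) * inverse (3 * \<delta>\<^sup>2))"
  define Y where "Y = (\<lambda>x. f (u x) * inverse (f (u x) + f (1 - u x)))"
  have f: "f x \<ge> 0" "f x = 0 \<longleftrightarrow> x \<le> 0" for x
    by (auto simp: f_def flat_def)
  have pos: "f v + f (1 - v) > 0" for v
    using f(1)[of v] f(1)[of "1 - v"] f(2)[of v] f(2)[of "1 - v"] by linarith
  have "smooth_on UNIV u"
    unfolding u_def by (intro smooth_on_mult smooth_on_diff smooth_on_const smooth_on_power smooth_on_id)
  then have fu: "smooth_on UNIV (\<lambda>x. f (u x))" "smooth_on UNIV (\<lambda>x. f (1 - u x))"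
    unfolding f_def using smooth_on_compose[OF smooth_on_flat[of UNIV]]
    by (auto intro!: smooth_on_compose[OF smooth_on_flat[of UNIV]] smooth_on_diff)
  have "smooth_on UNIV Y"
    unfolding Y_def by (intro smooth_on_mult smooth_on_inverse smooth_on_add fu pos)
  moreover have "0 \<le> Y x" "Y x \<le> 1" for x
    using f[of "u x"] f[of "1 - u x"] pos[of "u x"] by (auto simp: Y_def field_simps)
  moreover have "Y x = 1" if "\<bar>x\<bar> \<le> \<delta>" for x
  proof -
    have "x\<^sup>2 \<le> \<delta>\<^sup>2" using that by (metis abs_ge_zero power2_abs power_mono)
    then have "u x \<ge> 1" using assms by (simp add: u_def field_simps)
    then show ?thesis using f(2)[of "1 - u x"] pos[of "u x"] by (simp add: Y_def)
  qed
  moreover have "Y x = 0" if "\<bar>x\<bar> \<ge> 2 * \<delta>" for x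
  proof -
    have "(2 * \<delta>)\<^sup>2 \<le> x\<^sup>2" using that assms by (metis abs_ge_zero less_imp_le mult_nonneg_nonneg power2_abs power_mono zero_le_numeral)
    then have "u x \<le> 0" using assms by (simp add: u_def field_simps)
    then show ?thesis using f(2)[of "u x"] by (simp add: Y_def)
  qed
  ultimately show ?thesis by (rule that)
qed

section \<open>Symbols\<close>

text \<open>A symbol is a function of \<open>t \<in> [0, 1]\<close> and \<open>s \<in> \<real>\<close> all of whose partial derivatives are
  \<open>O(exp (\<eta> s\<^sup>2))\<close> for every \<open>\<eta> > 0\<close>, uniformly in \<open>t\<close>: these are the amplitudes that a
  Gaussian factor turns into Schwartz functions.\<close>

definition subgaussian :: "(real \<Rightarrow> real \<Rightarrow> real) \<Rightarrow> bool" where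
  "subgaussian F \<longleftrightarrow> (\<forall>\<eta>>0. \<exists>C. \<forall>t\<in>{0..1}. \<forall>s. \<bar>F t s\<bar> \<le> C * exp (\<eta> * s\<^sup>2))"

text \<open>The mixed derivative \<open>Fts\<close> is demanded in both orders, so the symmetry of
  second derivatives is part of the notion. The derivatives in \<open>t\<close> are one-sided at 0
  and 1.\<close>

definition partials ::
    "(real \<Rightarrow> real \<Rightarrow> real) \<Rightarrow> (real \<Rightarrow> real \<Rightarrow> real) \<Rightarrow> (real \<Rightarrow> real \<Rightarrow> real) \<Rightarrow> (real \<Rightarrow> real \<Rightarrow> real) \<Rightarrow> bool" where
  "partials F Ft Fs Fts \<longleftrightarrow> (\<forall>t\<in>{0..1}. \<forall>s.
     ((\<lambda>t. F t s) has_real_derivative Ft t s) (at t within {0..1}) \<and>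
     (F t has_real_derivative Fs t s) (at s) \<and>
     ((\<lambda>t. Fs t s) has_real_derivative Fts t s) (at t within {0..1}) \<and>
     (Ft t has_real_derivative Fts t s) (at s))"

coinductive symbol :: "(real \<Rightarrow> real \<Rightarrow> real) \<Rightarrow> bool" where
  symbolI: "subgaussian F \<Longrightarrow> partials F Ft Fs Fts \<Longrightarrow> symbol Ft \<Longrightarrow> symbol Fs \<Longrightarrow> symbol F"

text \<open>Derivatives of a generator are sums and products that also involve known symbols such as
  \<open>s\<close> and \<open>t\<close>. Coinduction up to this algebra lets each step speak of the
  generators only.\<close>

inductive symbol_algebra :: "((real \<Rightarrow> real \<Rightarrow> real) \<Rightarrow> bool) \<Rightarrow> (real \<Rightarrow> real \<Rightarrow> real) \<Rightarrow> bool" for P where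
  gen: "P F \<Longrightarrow> symbol_algebra P F"
| sym: "symbol F \<Longrightarrow> symbol_algebra P F"
| add: "symbol_algebra P F \<Longrightarrow> symbol_algebra P G \<Longrightarrow> symbol_algebra P (\<lambda>t s. F t s + G t s)"
| mult: "symbol_algebra P F \<Longrightarrow> symbol_algebra P G \<Longrightarrow> symbol_algebra P (\<lambda>t s. F t s * G t s)"

lemma subgaussianE:
  assumes "subgaussian F" "\<eta> > 0"
  obtains C where "C \<ge> 0" "\<And>t s. t \<in> {0..1} \<Longrightarrow> \<bar>F t s\<bar> \<le> C * exp (\<eta> * s\<^sup>2)"
proof -
  from assms obtain C where C: "\<forall>t\<in>{0..1}. \<forall>s. \<bar>F t s\<bar> \<le> C * exp (\<eta> * s\<^sup>2)"
    unfolding subgaussian_def by blast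
  have "\<bar>F t s\<bar> \<le> max C 0 * exp (\<eta> * s\<^sup>2)" if "t \<in> {0..1}" for t s
  proof -
    have "C * exp (\<eta> * s\<^sup>2) \<le> max C 0 * exp (\<eta> * s\<^sup>2)" by (intro mult_right_mono) auto
    with C[rule_format, OF that, of s] show ?thesis by linarith
  qed
  then show ?thesis using that[of "max C 0"] by auto
qed

lemma subgaussian_add:
  assumes "subgaussian F" "subgaussian G"
  shows "subgaussian (\<lambda>t s. F t s + G t s)"
  unfolding subgaussian_def
proof (intro allI impI)
  fix \<eta> :: real assume "\<eta> > 0"
  obtain C where C: "C \<ge> 0" "\<And>t s. t \<in> {0..1} \<Longrightarrow> \<bar>F t s\<bar> \<le> C * exp (\<eta> * s\<^sup>2)"
    by (rule subgaussianE[OF assms(1) \<open>\<eta> > 0\<close>]) (rule that)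
  obtain D where D: "D \<ge> 0" "\<And>t s. t \<in> {0..1} \<Longrightarrow> \<bar>G t s\<bar> \<le> D * exp (\<eta> * s\<^sup>2)"
    by (rule subgaussianE[OF assms(2) \<open>\<eta> > 0\<close>]) (rule that)
  show "\<exists>C. \<forall>t\<in>{0..1}. \<forall>s. \<bar>F t s + G t s\<bar> \<le> C * exp (\<eta> * s\<^sup>2)"
  proof (intro exI[of _ "C + D"] ballI allI)
    fix t s :: real assume "t \<in> {0..1}"
    then show "\<bar>F t s + G t s\<bar> \<le> (C + D) * exp (\<eta> * s\<^sup>2)"
      using C(2)[of t s] D(2)[of t s] abs_triangle_ineq[of "F t s" "G t s"] by (simp add: distrib_right)
  qed
qed

lemma subgaussian_mult:
  assumes "subgaussian F" "subgaussian G"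
  shows "subgaussian (\<lambda>t s. F t s * G t s)"
  unfolding subgaussian_def
proof (intro allI impI)
  fix \<eta> :: real assume "\<eta> > 0"
  then have "\<eta> / 2 > 0" by simp
  obtain C where C: "C \<ge> 0" "\<And>t s. t \<in> {0..1} \<Longrightarrow> \<bar>F t s\<bar> \<le> C * exp (\<eta> / 2 * s\<^sup>2)"
    by (rule subgaussianE[OF assms(1) \<open>\<eta> / 2 > 0\<close>]) (rule that)
  obtain D where D: "D \<ge> 0" "\<And>t s. t \<in> {0..1} \<Longrightarrow> \<bar>G t s\<bar> \<le> D * exp (\<eta> / 2 * s\<^sup>2)"
    by (rule subgaussianE[OF assms(2) \<open>\<eta> / 2 > 0\<close>]) (rule that)
  show "\<exists>C. \<forall>t\<in>{0..1}. \<forall>s. \<bar>F t s * G t s\<bar> \<le> C * exp (\<eta> * s\<^sup>2)"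
  proof (intro exI[of _ "C * D"] ballI allI)
    fix t s :: real assume t: "t \<in> {0..1}"
    have "\<bar>F t s * G t s\<bar> \<le> (C * exp (\<eta> / 2 * s\<^sup>2)) * (D * exp (\<eta> / 2 * s\<^sup>2))"
      unfolding abs_mult using C D t by (intro mult_mono) auto
    also have "\<dots> = C * D * (exp (\<eta> / 2 * s\<^sup>2) * exp (\<eta> / 2 * s\<^sup>2))" by simp
    also have "exp (\<eta> / 2 * s\<^sup>2) * exp (\<eta> / 2 * s\<^sup>2) = exp (\<eta> * s\<^sup>2)"
      by (simp flip: exp_add)
    finally show "\<bar>F t s * G t s\<bar> \<le> C * D * exp (\<eta> * s\<^sup>2)" .
  qed
qed

lemma subgaussian_bounded:
  assumes "\<And>t s. t \<in> {0..1} \<Longrightarrow> \<bar>F t s\<bar> \<le> C"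
  shows "subgaussian F"
  unfolding subgaussian_def
proof (intro allI impI exI[of _ C] ballI)
  fix \<eta> t s :: real assume "0 < \<eta>" "t \<in> {0..1}"
  have "1 \<le> exp (\<eta> * s\<^sup>2)" using \<open>0 < \<eta>\<close> by simp
  moreover have "C \<ge> 0" using assms[OF \<open>t \<in> {0..1}\<close>, of s] by linarith
  ultimately show "\<bar>F t s\<bar> \<le> C * exp (\<eta> * s\<^sup>2)"
    using assms[OF \<open>t \<in> {0..1}\<close>, of s] mult_left_mono[of 1 "exp (\<eta> * s\<^sup>2)" C] by linarith
qed

lemma subgaussian_identity: "subgaussian (\<lambda>t s. s)"
  unfolding subgaussian_def
proof (intro allI impI)
  fix \<eta> :: real assume eta: "\<eta> > 0"
  show "\<exists>C. \<forall>t\<in>{0..1::real}. \<forall>s. \<bar>s\<bar> \<le> C * exp (\<eta> * s\<^sup>2)"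
  proof (intro exI[of _ "max 1 (1 / \<eta>)"] ballI allI)
    fix s :: real
    have "\<bar>s\<bar> \<le> 1 + s\<^sup>2" using zero_le_power2[of "\<bar>s\<bar> - 1"] unfolding power2_diff by simp
    also have "\<dots> \<le> max 1 (1 / \<eta>) * (1 + \<eta> * s\<^sup>2)"
    proof -
      have "s\<^sup>2 = (1 / \<eta>) * (\<eta> * s\<^sup>2)" using eta by simp
      also have "\<dots> \<le> max 1 (1 / \<eta>) * (\<eta> * s\<^sup>2)" using eta by (intro mult_right_mono) auto
      finally show ?thesis by (simp add: distrib_left)
    qed
    also have "\<dots> \<le> max 1 (1 / \<eta>) * exp (\<eta> * s\<^sup>2)"
      by (intro mult_left_mono exp_ge_add_one_self) auto
    finally show "\<bar>s\<bar> \<le> max 1 (1 / \<eta>) * exp (\<eta> * s\<^sup>2)" .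
  qed
qed

lemma partialsD:
  assumes "partials F Ft Fs Fts" "t \<in> {0..1}"
  shows "((\<lambda>t. F t s) has_real_derivative Ft t s) (at t within {0..1})"
    and "(F t has_real_derivative Fs t s) (at s)"
    and "((\<lambda>t. Fs t s) has_real_derivative Fts t s) (at t within {0..1})"
    and "(Ft t has_real_derivative Fts t s) (at s)"
  using assms unfolding partials_def by auto

lemma partials_add:
  assumes "partials F Ft Fs Fts" "partials G Gt Gs Gts"
  shows "partials (\<lambda>t s. F t s + G t s) (\<lambda>t s. Ft t s + Gt t s) (\<lambda>t s. Fs t s + Gs t s) (\<lambda>t s. Fts t s + Gts t s)"
  using assms unfolding partials_def by (auto intro!: DERIV_add)

lemma partials_mult:
  assumes "partials F Ft Fs Fts" "partials G Gt Gs Gts"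
  shows "partials (\<lambda>t s. F t s * G t s) (\<lambda>t s. Ft t s * G t s + F t s * Gt t s) (\<lambda>t s. Fs t s * G t s + F t s * Gs t s)
     (\<lambda>t s. (Fts t s * G t s + Fs t s * Gt t s) + (Ft t s * Gs t s + F t s * Gts t s))"
  unfolding partials_def
proof (intro ballI allI conjI)
  fix t s :: real assume t: "t \<in> {0..1}"
  note F = partialsD[OF assms(1) t, of s] and G = partialsD[OF assms(2) t, of s]
  show "((\<lambda>t. F t s * G t s) has_real_derivative Ft t s * G t s + F t s * Gt t s) (at t within {0..1})"
    using DERIV_mult[OF F(1) G(1)] by (simp add: algebra_simps)
  show "((\<lambda>s. F t s * G t s) has_real_derivative Fs t s * G t s + F t s * Gs t s) (at s)"
    using DERIV_mult[OF F(2) G(2)] by (simp add: algebra_simps)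
  show "((\<lambda>t. Fs t s * G t s + F t s * Gs t s) has_real_derivative
      Fts t s * G t s + Fs t s * Gt t s + (Ft t s * Gs t s + F t s * Gts t s)) (at t within {0..1})"
    using DERIV_add[OF DERIV_mult[OF F(3) G(1)] DERIV_mult[OF F(1) G(3)]] by (simp add: algebra_simps)
  show "((\<lambda>s. Ft t s * G t s + F t s * Gt t s) has_real_derivative
      Fts t s * G t s + Fs t s * Gt t s + (Ft t s * Gs t s + F t s * Gts t s)) (at s)"
    using DERIV_add[OF DERIV_mult[OF F(4) G(2)] DERIV_mult[OF F(2) G(4)]] by (simp add: algebra_simps)
qed

text \<open>Sub-Gaussian growth survives products because the arbitrary rate \<open>\<eta>\<close>
  can be split in halves; with the Leibniz rule, the generated algebra inherits every requirement
  from its generators.\<close>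

lemma symbol_coinduct_algebra:
  assumes step: "\<And>F. P F \<Longrightarrow> subgaussian F \<and> (\<exists>Ft Fs Fts. partials F Ft Fs Fts \<and> symbol_algebra P Ft \<and> symbol_algebra P Fs)"
    and "symbol_algebra P F"
  shows "symbol F"
proof (rule symbol.coinduct[where X = "symbol_algebra P", OF assms(2)])
  fix F assume "symbol_algebra P F"
  then have "subgaussian F \<and> (\<exists>Ft Fs Fts. partials F Ft Fs Fts \<and> symbol_algebra P Ft \<and> symbol_algebra P Fs)"
  proof induction
    case (gen F)
    then show ?case by (rule step)
  next
    case (sym F)
    then show ?case by (metis symbol.cases symbol_algebra.sym)
  next
    case (add F G)
    then obtain Ft Fs Fts Gt Gs Gts where *: "partials F Ft Fs Fts" "partials G Gt Gs Gts"
      "symbol_algebra P Ft" "symbol_algebra P Fs" "symbol_algebra P Gt" "symbol_algebra P Gs" by blast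
    show ?case
      using add subgaussian_add partials_add[OF *(1,2)] symbol_algebra.add[OF *(3,5)] symbol_algebra.add[OF *(4,6)] by blast
  next
    case (mult F G)
    then obtain Ft Fs Fts Gt Gs Gts where *: "partials F Ft Fs Fts" "partials G Gt Gs Gts"
      "symbol_algebra P Ft" "symbol_algebra P Fs" "symbol_algebra P Gt" "symbol_algebra P Gs" by blast
    have "symbol_algebra P (\<lambda>t s. Ft t s * G t s + F t s * Gt t s)" "symbol_algebra P (\<lambda>t s. Fs t s * G t s + F t s * Gs t s)"
      by (intro symbol_algebra.add symbol_algebra.mult * mult)+
    with mult subgaussian_mult partials_mult[OF *(1,2)] show ?case by blast
  qed
  then show "\<exists>F' Ft Fs Fts. F = F' \<and> subgaussian F' \<and> partials F' Ft Fs Fts \<and>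
      (symbol_algebra P Ft \<or> symbol Ft) \<and> (symbol_algebra P Fs \<or> symbol Fs)" by blast
qed

lemma symbol_add: "symbol F \<Longrightarrow> symbol G \<Longrightarrow> symbol (\<lambda>t s. F t s + G t s)"
  by (rule symbol_coinduct_algebra[where P = "\<lambda>_. False"]) (auto intro: symbol_algebra.intros)

lemma symbol_mult: "symbol F \<Longrightarrow> symbol G \<Longrightarrow> symbol (\<lambda>t s. F t s * G t s)"
  by (rule symbol_coinduct_algebra[where P = "\<lambda>_. False"]) (auto intro: symbol_algebra.intros)

lemma symbol_fun_of_t:
  assumes "smooth_on {0..1} c"
  shows "symbol (\<lambda>t s. c t)"
proof (rule symbol_coinduct_algebra)
  let ?P = "\<lambda>F. \<exists>c::real \<Rightarrow> real. smooth_on {0..1} c \<and> F = (\<lambda>t s. c t)"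
  show "symbol_algebra ?P (\<lambda>t s. c t)"
    using assms by (blast intro: symbol_algebra.gen)
  fix F :: "real \<Rightarrow> real \<Rightarrow> real" assume "?P F"
  then obtain c :: "real \<Rightarrow> real" where c: "smooth_on {0..1} c" "F = (\<lambda>t s. c t)" by blast
  obtain c' where c': "\<And>x. x \<in> {0..1} \<Longrightarrow> (c has_vector_derivative c' x) (at x within {0..1})" "smooth_on {0..1} c'"
    using smooth_on_vector_derivative[OF c(1)] by blast
  have "bounded (c ` {0..1})"
    using smooth_on_continuous_on[OF c(1)] by (intro compact_imp_bounded compact_continuous_image) auto
  then obtain C where "\<forall>t\<in>{0..1}. \<bar>c t\<bar> \<le> C" unfolding bounded_iff by auto
  then have "subgaussian F" unfolding c(2) by (intro subgaussian_bounded) auto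
  moreover have "partials F (\<lambda>t s. c' t) (\<lambda>t s. 0) (\<lambda>t s. 0)"
    using c' unfolding c partials_def by (auto simp: has_real_derivative_iff_has_vector_derivative)
  moreover have "symbol_algebra ?P (\<lambda>t s. c' t)" "symbol_algebra ?P (\<lambda>t s. 0)"
    using c'(2) smooth_on_const[of "{0..1}" 0] by (blast intro: symbol_algebra.gen)+
  ultimately show "subgaussian F \<and> (\<exists>Ft Fs Fts. partials F Ft Fs Fts \<and> symbol_algebra ?P Ft \<and> symbol_algebra ?P Fs)"
    by blast
qed

lemma symbol_const: "symbol (\<lambda>t s. c)"
  using symbol_fun_of_t[of "\<lambda>_. c"] by simp

lemma symbol_t: "symbol (\<lambda>t s. t)"
  by (rule symbol_fun_of_t[OF smooth_on_id])

lemma symbol_s: "symbol (\<lambda>t s. s)"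
proof (rule symbolI)
  show "partials (\<lambda>t s. s) (\<lambda>t s. 0) (\<lambda>t s. 1) (\<lambda>t s. 0)" by (auto simp: partials_def)
qed (rule subgaussian_identity symbol_const)+

lemma symbol_minus: "symbol F \<Longrightarrow> symbol (\<lambda>t s. - F t s)"
  using symbol_mult[OF symbol_const[of "-1"]] by simp

lemma symbol_diff: "symbol F \<Longrightarrow> symbol G \<Longrightarrow> symbol (\<lambda>t s. F t s - G t s)"
  using symbol_add[OF _ symbol_minus, of F G] by simp

lemma symbol_power: "symbol F \<Longrightarrow> symbol (\<lambda>t s. F t s ^ k)"
  by (induction k) (auto intro: symbol_mult symbol_const)

lemma symbol_poly: "symbol (\<lambda>t s. poly p s)"
proof (induction p)
  case (pCons a p)
  from symbol_add[OF symbol_const symbol_mult[OF symbol_s this(2)]] show ?case by simp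
qed (simp add: symbol_const)

text \<open>Compact support bounds \<open>Y\<close> and all its derivatives. Differentiating in
  \<open>t\<close> or in \<open>s\<close> multiplies \<open>Y' (t * s)\<close> by \<open>s\<close>
  or by \<open>t\<close>, and both factors are symbols.\<close>

lemma symbol_scaled:
  assumes "smooth_on UNIV Y" "compact K" "\<And>x. x \<notin> K \<Longrightarrow> Y x = 0"
  shows "symbol (\<lambda>t s. Y (t * s))"
proof (rule symbol_coinduct_algebra)
  let ?Q = "\<lambda>Y::real \<Rightarrow> real. smooth_on UNIV Y \<and> (\<forall>x. x \<notin> K \<longrightarrow> Y x = 0)"
  let ?P = "\<lambda>F. \<exists>Y. ?Q Y \<and> F = (\<lambda>t s. Y (t * s))"
  show "symbol_algebra ?P (\<lambda>t s. Y (t * s))"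
    using assms by (blast intro: symbol_algebra.gen)
  have der: "\<exists>Y'. (\<forall>x. (Y has_real_derivative Y' x) (at x)) \<and> ?Q Y'" if Q: "?Q Y" for Y :: "real \<Rightarrow> real"
  proof -
    obtain Y' where Y': "\<And>x. (Y has_vector_derivative Y' x) (at x)" "smooth_on UNIV Y'"
      using smooth_on_vector_derivative[of UNIV Y] Q by auto
    have "Y' x = 0" if "x \<notin> K" for x
    proof -
      have "(Y has_real_derivative 0) (at x)"
        by (rule has_field_derivative_transform_within_open[of "\<lambda>_. 0" _ _ "- K"])
          (use Q that \<open>compact K\<close> in \<open>auto intro: compact_imp_closed\<close>)
      with Y'(1)[of x] show ?thesis
        by (metis DERIV_unique has_real_derivative_iff_has_vector_derivative)
    qed
    with Y' show ?thesis by (auto simp: has_real_derivative_iff_has_vector_derivative)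
  qed
  fix F :: "real \<Rightarrow> real \<Rightarrow> real" assume "?P F"
  then obtain Y :: "real \<Rightarrow> real" where Y: "?Q Y" "F = (\<lambda>t s. Y (t * s))" by blast
  obtain Y' where Y': "\<And>x. (Y has_real_derivative Y' x) (at x)" "?Q Y'" using der[OF Y(1)] by blast
  obtain Y'' where Y'': "\<And>x. (Y' has_real_derivative Y'' x) (at x)" "?Q Y''" using der[OF Y'(2)] by blast
  have "bounded (Y ` K)"
    using Y(1) assms(2) by (intro compact_imp_bounded compact_continuous_image)
      (auto intro: smooth_on_continuous_on smooth_on_subset)
  then obtain C where C: "\<forall>x\<in>K. \<bar>Y x\<bar> \<le> C" unfolding bounded_iff by auto
  have "\<bar>Y x\<bar> \<le> \<bar>C\<bar>" for x using C Y(1) by (cases "x \<in> K") fastforce+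
  then have "subgaussian F" unfolding Y(2) by (intro subgaussian_bounded)
  moreover have "partials F (\<lambda>t s. s * Y' (t * s)) (\<lambda>t s. t * Y' (t * s)) (\<lambda>t s. Y' (t * s) + t * (s * Y'' (t * s)))"
    unfolding Y partials_def
  proof (intro ballI allI conjI)
    fix t s :: real
    have c: "((\<lambda>t. Z (t * s)) has_real_derivative Z' (t * s) * s) (at t within {0..1})"
      "((\<lambda>s. Z (t * s)) has_real_derivative Z' (t * s) * t) (at s)"
      if "\<And>x. (Z has_real_derivative Z' x) (at x)" for Z Z'
      by (auto intro!: DERIV_chain2[OF that] derivative_eq_intros)
    show "((\<lambda>t. Y (t * s)) has_real_derivative s * Y' (t * s)) (at t within {0..1})"
      "((\<lambda>s. Y (t * s)) has_real_derivative t * Y' (t * s)) (at s)"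
      using c[of Y Y', OF Y'(1)] by (simp_all add: mult.commute)
    show "((\<lambda>t. t * Y' (t * s)) has_real_derivative Y' (t * s) + t * (s * Y'' (t * s))) (at t within {0..1})"
      using DERIV_mult[OF DERIV_ident c(1)[of Y' Y'', OF Y''(1)]] by (simp add: algebra_simps)
    show "((\<lambda>s. s * Y' (t * s)) has_real_derivative Y' (t * s) + t * (s * Y'' (t * s))) (at s)"
      using DERIV_mult[OF DERIV_ident c(2)[of Y' Y'', OF Y''(1)]] by (simp add: algebra_simps)
  qed
  moreover have "symbol_algebra ?P (\<lambda>t s. Y' (t * s))"
    using Y'(2) by (blast intro: symbol_algebra.gen)
  then have "symbol_algebra ?P (\<lambda>t s. s * Y' (t * s))" "symbol_algebra ?P (\<lambda>t s. t * Y' (t * s))"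
    by (rule symbol_algebra.mult[OF symbol_algebra.sym[OF symbol_s]], rule symbol_algebra.mult[OF symbol_algebra.sym[OF symbol_t]])
  ultimately show "subgaussian F \<and> (\<exists>Ft Fs Fts. partials F Ft Fs Fts \<and> symbol_algebra ?P Ft \<and> symbol_algebra ?P Fs)"
    by blast
qed

lemma symbol_cong:
  assumes "symbol F" "\<And>t s. t \<in> {0..1} \<Longrightarrow> F t s = G t s"
  shows "symbol G"
  using assms(1)
proof cases
  case (symbolI Ft Fs Fts)
  have "subgaussian G" using symbolI(1) assms(2) unfolding subgaussian_def by simp
  moreover have "partials G Ft Fs Fts"
    unfolding partials_def
  proof (intro ballI allI)
    fix t s :: real assume t: "t \<in> {0..1}"
    have "F t = G t" using assms(2)[OF t] by blast
    moreover have "((\<lambda>t. G t s) has_real_derivative Ft t s) (at t within {0..1})"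
      by (rule has_field_derivative_transform_within[of "\<lambda>t. F t s" _ _ _ 1])
        (use symbolI(2) t assms(2) in \<open>auto simp: partials_def\<close>)
    ultimately show "((\<lambda>t. G t s) has_real_derivative Ft t s) (at t within {0..1}) \<and>
     (G t has_real_derivative Fs t s) (at s) \<and>
     ((\<lambda>t. Fs t s) has_real_derivative Fts t s) (at t within {0..1}) \<and>
     (Ft t has_real_derivative Fts t s) (at s)"
      using partialsD(2,3,4)[OF symbolI(2) t] by simp
  qed
  ultimately show ?thesis using symbolI(3,4) by (blast intro: symbol.symbolI)
qed

text \<open>The default value 0 off \<open>{0..1}\<close> turns rules such as \<open>Dt_add\<close>,
  \<open>Dt_mult\<close> and \<open>Ds_Dt\<close> into equations between functions, so that they
  rewrite under iteration.\<close>

definition Dt :: "(real \<Rightarrow> real \<Rightarrow> real) \<Rightarrow> real \<Rightarrow> real \<Rightarrow> real" where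
  "Dt F t s = (if t \<in> {0..1} then vector_derivative (\<lambda>t. F t s) (at t within {0..1}) else 0)"

definition Ds :: "(real \<Rightarrow> real \<Rightarrow> real) \<Rightarrow> real \<Rightarrow> real \<Rightarrow> real" where
  "Ds F t s = (if t \<in> {0..1} then deriv (F t) s else 0)"

lemma Dt_eqI:
  "((\<lambda>t. F t s) has_real_derivative d) (at t within {0..1}) \<Longrightarrow> t \<in> {0..1} \<Longrightarrow> Dt F t s = d"
  unfolding Dt_def has_real_derivative_iff_has_vector_derivative
  using vector_derivative_within_cbox[of 0 1] by (simp add: vector_derivative_within_closed_interval)

lemma Ds_eqI: "(F t has_real_derivative d) (at s) \<Longrightarrow> t \<in> {0..1} \<Longrightarrow> Ds F t s = d"
  unfolding Ds_def by (simp add: DERIV_imp_deriv)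

text \<open>On \<open>{0..1}\<close> the existential witnesses in \<open>symbol\<close> are forced
  to be \<open>Dt F\<close> and \<open>Ds F\<close>, so these canonical operators can replace them.
  They commute because both orders yield the common witness \<open>Fts\<close>.\<close>

lemma symbolD:
  assumes "symbol F"
  shows symbol_subgaussian: "subgaussian F"
    and symbol_Dt: "symbol (Dt F)"
    and symbol_Ds: "symbol (Ds F)"
    and symbol_partials: "partials F (Dt F) (Ds F) (Dt (Ds F))"
    and Ds_Dt: "Ds (Dt F) = Dt (Ds F)"
proof -
  from assms obtain Ft Fs Fts where F: "subgaussian F" "partials F Ft Fs Fts" "symbol Ft" "symbol Fs"
    by cases blast
  have Ft: "Dt F t s = Ft t s" and Fs: "Ds F t s = Fs t s" if "t \<in> {0..1}" for t s
    using F(2) that unfolding partials_def by (auto intro: Dt_eqI Ds_eqI)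
  then show "symbol (Dt F)" "symbol (Ds F)"
    using symbol_cong F(3,4) by metis+
  show "subgaussian F" by fact
  have 1: "((\<lambda>t. Ds F t s) has_real_derivative Fts t s) (at t within {0..1})" if "t \<in> {0..1}" for t s
    by (rule has_field_derivative_transform_within[of "\<lambda>t. Fs t s" _ _ _ 1])
      (use F(2) that Fs in \<open>auto simp: partials_def\<close>)
  have 2: "Dt F t = Ft t" if "t \<in> {0..1}" for t using Ft that by blast
  have 3: "(Dt F t has_real_derivative Fts t s) (at s)" if "t \<in> {0..1}" for t s
    using 2[OF that] F(2) that unfolding partials_def by simp
  show eq: "Ds (Dt F) = Dt (Ds F)"
  proof (intro ext)
    fix t s
    show "Ds (Dt F) t s = Dt (Ds F) t s"
    proof (cases "t \<in> {0..1}")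
      case True
      then show ?thesis using Dt_eqI[of "Ds F" s "Fts t s" t] Ds_eqI[of "Dt F" t "Fts t s" s] 1[OF True] 3[OF True] by simp
    qed (auto simp: Dt_def Ds_def)
  qed
  show "partials F (Dt F) (Ds F) (Dt (Ds F))"
    unfolding partials_def
  proof (intro ballI allI conjI)
    fix t s :: real assume t: "t \<in> {0..1}"
    have "Dt (Ds F) t s = Fts t s" using Dt_eqI[of "Ds F" s "Fts t s" t] 1[OF t] t by blast
    then show "((\<lambda>t. F t s) has_real_derivative Dt F t s) (at t within {0..1})"
      "(F t has_real_derivative Ds F t s) (at s)"
      "((\<lambda>t. Ds F t s) has_real_derivative Dt (Ds F) t s) (at t within {0..1})"
      "(Dt F t has_real_derivative Dt (Ds F) t s) (at s)"
      using partialsD(1,2)[OF F(2) t, of s] 1[OF t] 3[OF t] Ft[OF t] Fs[OF t] by simp_all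
  qed
qed

lemma symbol_has_derivative:
  assumes "symbol F" "t \<in> {0..1}"
  shows "((\<lambda>t. F t s) has_real_derivative Dt F t s) (at t within {0..1})"
    and "(F t has_real_derivative Ds F t s) (at s)"
  using symbol_partials[OF assms(1)] assms(2) unfolding partials_def by auto

section \<open>Taylor series of symbols\<close>

lemma symbol_Dt_funpow: "symbol F \<Longrightarrow> symbol ((Dt ^^ k) F)"
  by (induction k) (auto intro: symbol_Dt)

lemma Dt_add:
  assumes "symbol F" "symbol G"
  shows "Dt (\<lambda>t s. F t s + G t s) = (\<lambda>t s. Dt F t s + Dt G t s)"
proof (intro ext)
  fix t s
  show "Dt (\<lambda>t s. F t s + G t s) t s = Dt F t s + Dt G t s"
  proof (cases "t \<in> {0..1}")
    case True
    show ?thesis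
      by (rule Dt_eqI[OF _ True]) (intro DERIV_add symbol_has_derivative assms True)
  qed (auto simp: Dt_def)
qed

lemma Dt_mult:
  assumes "symbol F" "symbol G"
  shows "Dt (\<lambda>t s. F t s * G t s) = (\<lambda>t s. Dt F t s * G t s + F t s * Dt G t s)"
proof (intro ext)
  fix t s
  show "Dt (\<lambda>t s. F t s * G t s) t s = Dt F t s * G t s + F t s * Dt G t s"
  proof (cases "t \<in> {0..1}")
    case True
    show ?thesis
      by (rule Dt_eqI[OF _ True])
        (use DERIV_mult[OF symbol_has_derivative(1)[OF assms(1) True] symbol_has_derivative(1)[OF assms(2) True]] in
          \<open>simp add: algebra_simps\<close>)
  qed (auto simp: Dt_def)
qed

lemma Dt_cong:
  assumes "\<And>t s. t \<in> {0..1} \<Longrightarrow> F t s = G t s"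
  shows "Dt F = Dt G"
proof (intro ext)
  fix t s
  have "((\<lambda>t. F t s) has_vector_derivative D) (at t within {0..1}) \<longleftrightarrow>
      ((\<lambda>t. G t s) has_vector_derivative D) (at t within {0..1})" if "t \<in> {0..1}" for D
    using assms that by (intro has_vector_derivative_cong_ev) (auto simp: eventually_nhds_top intro!: always_eventually)
  then show "Dt F t s = Dt G t s"
    unfolding Dt_def vector_derivative_def by simp
qed

text \<open>The coefficient of each power of \<open>t\<close> has to be a polynomial in
  \<open>s\<close>; expansions then live in the ring of power series over \<open>real poly\<close>,
  and asymptotic calculus becomes algebra in that ring.\<close>

definition has_taylor :: "(real \<Rightarrow> real \<Rightarrow> real) \<Rightarrow> real poly fps \<Rightarrow> bool" where
  "has_taylor F f \<longleftrightarrow> symbol F \<and> (\<forall>k s. (Dt ^^ k) F 0 s = fact k * poly (fps_nth f k) s)"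

lemma has_taylor_symbol: "has_taylor F f \<Longrightarrow> symbol F"
  by (simp add: has_taylor_def)

lemma has_taylor_at_0: "has_taylor F f \<Longrightarrow> F 0 s = poly (fps_nth f 0) s"
  using spec[of "\<lambda>k. \<forall>s. (Dt ^^ k) F 0 s = fact k * poly (fps_nth f k) s" 0] by (simp add: has_taylor_def)

lemma has_taylor_Dt: "has_taylor F f \<Longrightarrow> has_taylor (Dt F) (fps_deriv f)"
  unfolding has_taylor_def
proof (elim conjE, intro conjI allI)
  fix k s
  assume "symbol F" and *: "\<forall>k s. (Dt ^^ k) F 0 s = fact k * poly (fps_nth f k) s"
  show "(Dt ^^ k) (Dt F) 0 s = fact k * poly (fps_nth (fps_deriv f) k) s"
    using *[rule_format, of "Suc k" s] by (simp add: funpow_swap1 algebra_simps)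
qed (rule symbol_Dt)

lemma has_taylor_cong:
  assumes "has_taylor F f" "\<And>t s. t \<in> {0..1} \<Longrightarrow> F t s = G t s"
  shows "has_taylor G f"
proof -
  have "(Dt ^^ k) F 0 s = (Dt ^^ k) G 0 s" for k s
    using Dt_cong[OF assms(2)] assms(2) by (cases k) (auto simp: funpow_Suc_right simp del: funpow.simps)
  then show ?thesis
    using assms symbol_cong unfolding has_taylor_def by metis
qed

lemma Dt_funpow_add:
  assumes "symbol F" "symbol G"
  shows "(Dt ^^ k) (\<lambda>t s. F t s + G t s) = (\<lambda>t s. (Dt ^^ k) F t s + (Dt ^^ k) G t s)"
  by (induction k) (auto simp: Dt_add symbol_Dt_funpow assms)

lemma has_taylor_add:
  assumes "has_taylor F f" "has_taylor G g"
  shows "has_taylor (\<lambda>t s. F t s + G t s) (f + g)"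
  using assms unfolding has_taylor_def by (auto simp: Dt_funpow_add symbol_add distrib_left)

text \<open>A single differentiation in \<open>t\<close> corresponds to
  \<open>fps_deriv_mult\<close>; with \<open>F\<close> and \<open>G\<close> general in the
  induction, no binomial sums appear.\<close>

lemma has_taylor_mult:
  assumes "has_taylor F f" "has_taylor G g"
  shows "has_taylor (\<lambda>t s. F t s * G t s) (f * g)"
proof -
  have "(Dt ^^ k) (\<lambda>t s. F t s * G t s) 0 s = fact k * poly (fps_nth (f * g) k) s" for k s
    using assms
  proof (induction k arbitrary: F G f g)
    case 0
    then show ?case by (simp add: has_taylor_at_0)
  next
    case (Suc k)
    note [simp] = has_taylor_symbol[OF Suc.prems(1)] has_taylor_symbol[OF Suc.prems(2)]
    have "(Dt ^^ Suc k) (\<lambda>t s. F t s * G t s) 0 s =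
        (Dt ^^ k) (\<lambda>t s. Dt F t s * G t s + F t s * Dt G t s) 0 s"
      by (simp add: Dt_mult funpow_Suc_right del: funpow.simps)
    also have "\<dots> = (Dt ^^ k) (\<lambda>t s. Dt F t s * G t s) 0 s + (Dt ^^ k) (\<lambda>t s. F t s * Dt G t s) 0 s"
      by (simp add: Dt_funpow_add symbol_mult symbol_Dt)
    also have "\<dots> = fact k * poly (fps_nth (fps_deriv f * g) k) s + fact k * poly (fps_nth (f * fps_deriv g) k) s"
      using Suc.IH[OF has_taylor_Dt[OF Suc.prems(1)] Suc.prems(2)] Suc.IH[OF Suc.prems(1) has_taylor_Dt[OF Suc.prems(2)]]
      by simp
    also have "\<dots> = fact k * poly (fps_nth (fps_deriv (f * g)) k) s"
      by (simp add: fps_deriv_mult distrib_left flip: poly_add) (simp add: algebra_simps)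
    also have "\<dots> = fact (Suc k) * poly (fps_nth (f * g) (Suc k)) s"
      by (simp only: fps_deriv_nth) (simp add: algebra_simps)
    finally show ?case .
  qed
  with assms show ?thesis by (auto simp: has_taylor_def symbol_mult)
qed

lemma has_taylor_poly: "has_taylor (\<lambda>t s. poly p s) (fps_const p)"
proof -
  have zero: "Dt (\<lambda>t s. h s) = (\<lambda>t s. 0)" for h
    using Dt_eqI[of "\<lambda>t s. h s" _ 0] by (auto simp: fun_eq_iff) (auto simp: Dt_def)
  have "(Dt ^^ Suc k) (\<lambda>t s. poly p s) = (\<lambda>t s. 0)" for k
    by (induction k) (auto simp: zero)
  then have "(Dt ^^ k) (\<lambda>t s. poly p s) 0 s = fact k * poly (fps_nth (fps_const p) k) s" for k s
    by (cases k) auto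
  then show ?thesis by (simp add: has_taylor_def symbol_poly)
qed

lemma has_taylor_const: "has_taylor (\<lambda>t s. c) (fps_const [:c:])"
  using has_taylor_poly[of "[:c:]"] by simp

lemma has_taylor_t: "has_taylor (\<lambda>t s. t) fps_X"
proof -
  have 1: "has_taylor (Dt (\<lambda>t s. t)) (fps_const [:1:])"
    by (rule has_taylor_cong[OF has_taylor_const[of 1]]) (use Dt_eqI[of "\<lambda>t s. t" _ 1] in auto)
  have "(Dt ^^ k) (\<lambda>t s. t) 0 s = fact k * poly (fps_nth fps_X k) s" for k s
  proof (cases k)
    case (Suc j)
    have "(Dt ^^ Suc j) (\<lambda>t s. t) 0 s = fact j * poly (fps_nth (fps_const [:1:]) j) s"
      using 1 unfolding has_taylor_def by (simp add: funpow_Suc_right del: funpow.simps)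
    then show ?thesis unfolding Suc by (cases j) auto
  qed auto
  then show ?thesis by (simp add: has_taylor_def symbol_t)
qed

lemma has_taylor_minus: "has_taylor F f \<Longrightarrow> has_taylor (\<lambda>t s. - F t s) (- f)"
proof -
  assume F: "has_taylor F f"
  have "fps_const [:-1:] = (-1 :: real poly fps)"
    by (simp add: fps_eq_iff one_pCons)
  with has_taylor_mult[OF has_taylor_const[of "-1"] F] show ?thesis by simp
qed

lemma has_taylor_diff: "has_taylor F f \<Longrightarrow> has_taylor G g \<Longrightarrow> has_taylor (\<lambda>t s. F t s - G t s) (f - g)"
  using has_taylor_add[OF _ has_taylor_minus, of F f G g] by simp

lemma has_taylor_power: "has_taylor F f \<Longrightarrow> has_taylor (\<lambda>t s. F t s ^ k) (f ^ k)"
proof (induction k)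
  case 0
  then show ?case using has_taylor_const[of 1] by (simp add: one_pCons[symmetric])
qed (auto intro: has_taylor_mult)

lemma has_taylor_sum:
  assumes "finite A" "\<And>i. i \<in> A \<Longrightarrow> has_taylor (F i) (f i)"
  shows "has_taylor (\<lambda>t s. \<Sum>i\<in>A. F i t s) (\<Sum>i\<in>A. f i)"
  using assms
proof (induction A)
  case empty
  then show ?case using has_taylor_const[of 0] by simp
qed (auto intro: has_taylor_add)

lemma has_taylor_unique:
  assumes "has_taylor F f" "has_taylor F g"
  shows "f = g"
proof (rule fps_ext)
  fix k
  have "poly (fps_nth f k) = poly (fps_nth g k)"
  proof
    fix s
    show "poly (fps_nth f k) s = poly (fps_nth g k) s"
      using assms unfolding has_taylor_def by (metis fact_nonzero mult_cancel_left)
  qed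
  then show "fps_nth f k = fps_nth g k" by (simp add: poly_eq_poly_eq_iff)
qed

lemma Dt_funpow_frozen: "(Dt ^^ k) (\<lambda>t s. F t s\<^sub>0) = (\<lambda>t s. (Dt ^^ k) F t s\<^sub>0)"
  by (induction k) (auto simp: Dt_def fun_eq_iff)

lemma symbol_smooth_in_t:
  assumes "symbol F"
  shows "smooth_on {0..1} (\<lambda>t. F t s)"
proof (rule smooth_on_coinduct_vector[where P = "\<lambda>u. \<exists>F. symbol F \<and> u = (\<lambda>t. F t s)"])
  fix u assume "\<exists>F. symbol F \<and> u = (\<lambda>t. F t s)"
  then obtain F where F: "symbol F" "u = (\<lambda>t. F t s)" by blast
  then show "\<exists>g'. (\<forall>x\<in>{0..1}. (u has_vector_derivative g' x) (at x within {0..1})) \<and> (\<exists>F. symbol F \<and> g' = (\<lambda>t. F t s))"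
    using symbol_has_derivative(1)[OF F(1)] symbol_Dt[OF F(1)]
    unfolding has_real_derivative_iff_has_vector_derivative by (intro exI[of _ "\<lambda>t. Dt F t s"]) auto
qed (use assms in blast)

text \<open>Freezing \<open>s\<close> turns a symbol into a function of \<open>t\<close> alone. This
  extracts the eigenvalue correction from a Borel sum in two variables.\<close>

lemma has_taylor_frozen:
  assumes "has_taylor F f"
  shows "has_taylor (\<lambda>t s. F t s\<^sub>0) (Abs_fps (\<lambda>k. [:poly (fps_nth f k) s\<^sub>0:]))"
  using assms unfolding has_taylor_def
  by (simp add: Dt_funpow_frozen symbol_fun_of_t[OF symbol_smooth_in_t])

lemma exists_taylor_fun_of_t:
  assumes "smooth_on {0..1} c"
  obtains d where "has_taylor (\<lambda>t s. c t) (Abs_fps (\<lambda>k. [:d k:]))"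
proof -
  have "has_taylor (\<lambda>t s. c t) (Abs_fps (\<lambda>k. [:(Dt ^^ k) (\<lambda>t s. c t) 0 0 / fact k:]))"
    using Dt_funpow_frozen[of _ "\<lambda>t s. c t" 0] symbol_fun_of_t[OF assms]
    by (auto simp: has_taylor_def fun_eq_iff)
  then show ?thesis by (rule that)
qed

lemma has_taylor_Ds:
  assumes "has_taylor F f"
  shows "has_taylor (Ds F) (Abs_fps (\<lambda>k. pderiv (fps_nth f k)))"
proof -
  have F: "symbol F" using assms by (rule has_taylor_symbol)
  have comm: "(Dt ^^ k) (Ds F) = Ds ((Dt ^^ k) F)" for k
    by (induction k) (auto simp: Ds_Dt symbol_Dt_funpow F)
  have "Ds ((Dt ^^ k) F) 0 s = fact k * poly (pderiv (fps_nth f k)) s" for k s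
  proof (rule Ds_eqI)
    have "(Dt ^^ k) F 0 = (\<lambda>s. fact k * poly (fps_nth f k) s)"
      using assms by (auto simp: has_taylor_def)
    then show "((Dt ^^ k) F 0 has_real_derivative fact k * poly (pderiv (fps_nth f k)) s) (at s)"
      by (auto intro!: DERIV_cmult poly_DERIV)
  qed auto
  with comm F show ?thesis by (simp add: has_taylor_def symbol_Ds)
qed

lemma smooth_on_UNIV_deriv:
  assumes "smooth_on UNIV (Y :: real \<Rightarrow> real)"
  shows "(Y has_real_derivative deriv Y x) (at x)" "smooth_on UNIV (deriv Y)"
proof -
  obtain Y' where Y': "\<And>x. (Y has_real_derivative Y' x) (at x)" "smooth_on UNIV Y'"
    using smooth_on_vector_derivative[OF assms] by (auto simp: has_real_derivative_iff_has_vector_derivative)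
  then have "deriv Y = Y'" by (auto intro: DERIV_imp_deriv)
  with Y' show "(Y has_real_derivative deriv Y x) (at x)" "smooth_on UNIV (deriv Y)" by auto
qed

lemma smooth_on_UNIV_deriv_funpow:
  "smooth_on UNIV (Y :: real \<Rightarrow> real) \<Longrightarrow> smooth_on UNIV ((deriv ^^ k) Y)"
  by (induction k) (auto intro: smooth_on_UNIV_deriv)

text \<open>Each derivative in \<open>t\<close> brings out one factor \<open>s\<close>, so the
  coefficient of \<open>t ^ k\<close> is a monomial of degree \<open>k\<close>: slowly varying
  coefficients become polynomial perturbations of the oscillator.\<close>

lemma has_taylor_scaled:
  assumes "smooth_on UNIV Y" "compact K" "\<And>x. x \<notin> K \<Longrightarrow> Y x = 0"
  shows "has_taylor (\<lambda>t s. Y (t * s)) (Abs_fps (\<lambda>k. monom ((deriv ^^ k) Y 0 / fact k) k))"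
proof -
  have D: "(Dt ^^ k) (\<lambda>t s. Y (t * s)) t s = s ^ k * (deriv ^^ k) Y (t * s)" if "t \<in> {0..1}" for k t s
    using that
  proof (induction k arbitrary: t s)
    case (Suc k)
    have "Dt ((Dt ^^ k) (\<lambda>t s. Y (t * s))) = Dt (\<lambda>t s. s ^ k * (deriv ^^ k) Y (t * s))"
      by (rule Dt_cong) (rule Suc.IH)
    moreover have "Dt (\<lambda>t s. s ^ k * (deriv ^^ k) Y (t * s)) t s = s ^ k * ((deriv ^^ Suc k) Y (t * s) * s)"
      by (intro Dt_eqI[OF _ Suc.prems] DERIV_cmult)
        (auto intro!: derivative_eq_intros
          DERIV_chain2[OF smooth_on_UNIV_deriv(1)[OF smooth_on_UNIV_deriv_funpow[OF assms(1)]]])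
    ultimately show ?case by simp
  qed auto
  have "symbol (\<lambda>t s. Y (t * s))" using assms by (rule symbol_scaled)
  then show ?thesis
    using D by (simp add: has_taylor_def poly_monom)
qed

text \<open>When \<open>F 0 s = 0\<close>, the mean value inequality bounds \<open>F\<close> by
  \<open>t\<close> times a bound of \<open>Dt F\<close>. Each vanishing coefficient thus gains a
  power of \<open>t\<close>, while the rate in \<open>s\<close> stays the same.\<close>

lemma has_taylor_vanishing_order:
  assumes "has_taylor F f" "\<And>k. k < N \<Longrightarrow> fps_nth f k = 0" "\<eta> > 0"
  obtains C where "C \<ge> 0" "\<And>t s. t \<in> {0..1} \<Longrightarrow> \<bar>F t s\<bar> \<le> C * t ^ N * exp (\<eta> * s\<^sup>2)"
proof -
  have "\<exists>C\<ge>0. \<forall>t\<in>{0..1}. \<forall>s. \<bar>F t s\<bar> \<le> C * t ^ N * exp (\<eta> * s\<^sup>2)"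
    using assms(1,2)
  proof (induction N arbitrary: F f)
    case 0
    obtain C where "C \<ge> 0" "\<And>t s. t \<in> {0..1} \<Longrightarrow> \<bar>F t s\<bar> \<le> C * exp (\<eta> * s\<^sup>2)"
      using subgaussianE[OF symbol_subgaussian[OF has_taylor_symbol[OF 0(1)]] assms(3)] by metis
    then show ?case by auto
  next
    case (Suc N)
    have "\<exists>C\<ge>0. \<forall>t\<in>{0..1}. \<forall>s. \<bar>Dt F t s\<bar> \<le> C * t ^ N * exp (\<eta> * s\<^sup>2)"
      by (rule Suc.IH[OF has_taylor_Dt[OF Suc.prems(1)]]) (simp add: Suc.prems(2))
    then obtain C where C: "C \<ge> 0" "\<And>t s. t \<in> {0..1} \<Longrightarrow> \<bar>Dt F t s\<bar> \<le> C * t ^ N * exp (\<eta> * s\<^sup>2)"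
      by blast
    have "\<bar>F t s\<bar> \<le> C * t ^ Suc N * exp (\<eta> * s\<^sup>2)" if t: "t \<in> {0..1}" for t s
    proof -
      have "norm (F t s - F 0 s) \<le> (C * t ^ N * exp (\<eta> * s\<^sup>2)) * norm (t - 0)"
      proof (rule field_differentiable_bound[where S = "{0..t}" and f' = "\<lambda>t. Dt F t s"])
        fix z assume z: "z \<in> {0..t}"
        then have z1: "z \<in> {0..1}" using t by auto
        show "((\<lambda>t. F t s) has_field_derivative Dt F z s) (at z within {0..t})"
          by (rule DERIV_subset[OF symbol_has_derivative(1)[OF has_taylor_symbol[OF Suc.prems(1)] z1]]) (use t in auto)
        have "C * z ^ N * exp (\<eta> * s\<^sup>2) \<le> C * t ^ N * exp (\<eta> * s\<^sup>2)"
          using z C(1) by (intro mult_right_mono mult_left_mono power_mono) auto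
        then show "norm (Dt F z s) \<le> C * t ^ N * exp (\<eta> * s\<^sup>2)"
          using C(2)[OF z1, of s] by simp
      qed (use t in auto)
      moreover have "F 0 s = 0"
        using has_taylor_at_0[OF Suc.prems(1)] Suc.prems(2)[of 0] by simp
      ultimately show ?thesis using t by (simp add: mult_ac)
    qed
    with C(1) show ?case by blast
  qed
  then show ?thesis using that by blast
qed

lemma has_taylor_remainder:
  assumes "has_taylor F f" "\<eta> > 0"
  obtains C where "C \<ge> 0"
    "\<And>t s. t \<in> {0..1} \<Longrightarrow> \<bar>F t s - (\<Sum>k<N. poly (fps_nth f k) s * t ^ k)\<bar> \<le> C * t ^ N * exp (\<eta> * s\<^sup>2)"
proof (rule has_taylor_vanishing_order)
  show "has_taylor (\<lambda>t s. F t s - (\<Sum>k<N. poly (fps_nth f k) s * t ^ k))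
     (f - (\<Sum>k<N. fps_const (fps_nth f k) * fps_X ^ k))"
    by (intro has_taylor_diff has_taylor_sum has_taylor_mult has_taylor_power has_taylor_poly has_taylor_t assms) auto
  fix k assume "k < N"
  have "fps_nth (\<Sum>k<N. fps_const (fps_nth f k) * fps_X ^ k) k = (\<Sum>i<N. if i = k then fps_nth f k else 0)"
    unfolding fps_sum_nth by (rule sum.cong) (auto simp: fps_X_power_nth)
  also have "\<dots> = fps_nth f k" using \<open>k < N\<close> by simp
  finally show "fps_nth (f - (\<Sum>k<N. fps_const (fps_nth f k) * fps_X ^ k)) k = 0"
    by (simp only: fps_sub_nth diff_self)
qed (use assms that in auto)

text \<open>A second order Taylor bound with one constant for all pairs of parameters. It serves
  twice: for difference quotients in every Schwartz seminorm, and for differentiation under the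
  integral.\<close>

lemma symbol_difference_quotient:
  assumes "symbol F" "\<eta> > 0"
  obtains C where "C \<ge> 0" "\<And>t u s. t \<in> {0..1} \<Longrightarrow> u \<in> {0..1} \<Longrightarrow>
    \<bar>F u s - F t s - (u - t) * Dt F t s\<bar> \<le> C * (u - t)\<^sup>2 * exp (\<eta> * s\<^sup>2)"
proof -
  obtain C where C: "C \<ge> 0" "\<And>t s. t \<in> {0..1} \<Longrightarrow> \<bar>Dt (Dt F) t s\<bar> \<le> C * exp (\<eta> * s\<^sup>2)"
    using subgaussianE[OF symbol_subgaussian[OF symbol_Dt[OF symbol_Dt[OF assms(1)]]] assms(2)] by metis
  have lip: "\<bar>Dt F u s - Dt F t s\<bar> \<le> C * exp (\<eta> * s\<^sup>2) * \<bar>u - t\<bar>" if "t \<in> {0..1}" "u \<in> {0..1}" for t u s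
    using field_differentiable_bound[of "{0..1}" "\<lambda>t. Dt F t s" "\<lambda>t. Dt (Dt F) t s" "C * exp (\<eta> * s\<^sup>2)" u t]
      symbol_has_derivative(1)[OF symbol_Dt[OF assms(1)]] C(2) that by simp
  have "\<bar>F u s - F t s - (u - t) * Dt F t s\<bar> \<le> C * (u - t)\<^sup>2 * exp (\<eta> * s\<^sup>2)"
    if tu: "t \<in> {0..1}" "u \<in> {0..1}" for t u s
  proof -
    \<comment> \<open>Subtracting the tangent \<open>v * Dt F t s\<close> leaves a function of
      \<open>v\<close> with derivative \<open>Dt F v s - Dt F t s\<close>, which is small by
      \<open>lip\<close>.\<close>
    have "norm ((F u s - u * Dt F t s) - (F t s - t * Dt F t s)) \<le> (C * exp (\<eta> * s\<^sup>2) * \<bar>u - t\<bar>) * norm (u - t)"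
    proof (rule field_differentiable_bound[where S = "{min t u..max t u}" and f' = "\<lambda>v. Dt F v s - Dt F t s"])
      fix z assume z: "z \<in> {min t u..max t u}"
      then have z1: "z \<in> {0..1}" using tu by auto
      have "((\<lambda>v. F v s - v * Dt F t s) has_field_derivative Dt F z s - Dt F t s) (at z within {0..1})"
        using symbol_has_derivative(1)[OF assms(1) z1] by (auto intro!: derivative_eq_intros)
      then show "((\<lambda>v. F v s - v * Dt F t s) has_field_derivative Dt F z s - Dt F t s) (at z within {min t u..max t u})"
        by (rule DERIV_subset) (use tu in auto)
      have "\<bar>Dt F z s - Dt F t s\<bar> \<le> C * exp (\<eta> * s\<^sup>2) * \<bar>z - t\<bar>" by (rule lip[OF tu(1) z1])
      also have "\<dots> \<le> C * exp (\<eta> * s\<^sup>2) * \<bar>u - t\<bar>" using z C(1) by (intro mult_left_mono) auto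
      finally show "norm (Dt F z s - Dt F t s) \<le> C * exp (\<eta> * s\<^sup>2) * \<bar>u - t\<bar>" by simp
    qed auto
    also have "(C * exp (\<eta> * s\<^sup>2) * \<bar>u - t\<bar>) * norm (u - t) = C * (u - t)\<^sup>2 * exp (\<eta> * s\<^sup>2)"
      by (simp add: power2_eq_square)
    also have "(F u s - u * Dt F t s) - (F t s - t * Dt F t s) = F u s - F t s - (u - t) * Dt F t s"
      by (simp add: algebra_simps)
    finally show ?thesis by simp
  qed
  then show ?thesis using that C(1) by blast
qed

section \<open>Borel summation\<close>

text \<open>\<open>A l i\<close> plays the \<open>i\<close>-th derivative of the \<open>l\<close>-th
  factor in \<open>t\<close>, and \<open>U i k\<close> is the series differentiated \<open>i\<close>
  times in \<open>t\<close> and \<open>k\<close> times in \<open>s\<close>. The majorants justify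
  termwise differentiation, so the family of all \<open>U i k\<close> is closed under both
  derivatives.\<close>

lemma symbol_series:
  fixes A :: "nat \<Rightarrow> nat \<Rightarrow> real \<Rightarrow> real" and p :: "nat \<Rightarrow> real poly"
  assumes der: "\<And>l i t. t \<in> {0..1} \<Longrightarrow> (A l i has_real_derivative A l (Suc i) t) (at t within {0..1})"
    and bnd: "\<And>i k \<eta>. \<eta> > 0 \<Longrightarrow>
      \<exists>b. summable b \<and> (\<forall>l. \<forall>t\<in>{0..1}. \<forall>s. \<bar>A l i t * poly ((pderiv ^^ k) (p l)) s\<bar> \<le> b l * exp (\<eta> * s\<^sup>2))"
  defines "U \<equiv> \<lambda>i k t s. \<Sum>l. A l i t * poly ((pderiv ^^ k) (p l)) s"
  shows "symbol (U 0 0)" and "t \<in> {0..1} \<Longrightarrow> (Dt ^^ i) (U 0 0) t s = U i 0 t s"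
proof -
  have sg: "subgaussian (U i k)" for i k
    unfolding subgaussian_def
  proof (intro allI impI)
    fix \<eta> :: real assume "\<eta> > 0"
    from bnd[OF this, of i k] obtain b where b: "summable b"
      "\<And>l t s. t \<in> {0..1} \<Longrightarrow> \<bar>A l i t * poly ((pderiv ^^ k) (p l)) s\<bar> \<le> b l * exp (\<eta> * s\<^sup>2)" by blast
    have "\<bar>U i k t s\<bar> \<le> suminf b * exp (\<eta> * s\<^sup>2)" if "t \<in> {0..1}" for t s
    proof -
      have "\<bar>U i k t s\<bar> \<le> (\<Sum>l. b l * exp (\<eta> * s\<^sup>2))"
        unfolding U_def using norm_suminf_le[of "\<lambda>l. A l i t * poly ((pderiv ^^ k) (p l)) s" "\<lambda>l. b l * exp (\<eta> * s\<^sup>2)"]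
          b(2)[OF that, of _ s] summable_mult2[OF b(1)] by simp
      also have "\<dots> = suminf b * exp (\<eta> * s\<^sup>2)" using suminf_mult2[OF b(1)] by simp
      finally show ?thesis .
    qed
    then show "\<exists>C. \<forall>t\<in>{0..1}. \<forall>s. \<bar>U i k t s\<bar> \<le> C * exp (\<eta> * s\<^sup>2)" by blast
  qed
  have summ: "summable (\<lambda>l. A l i t * poly ((pderiv ^^ k) (p l)) s)" if t: "t \<in> {0..1}" for i k t s
  proof -
    from bnd[of 1 i k] obtain b where b: "summable b"
      "\<And>l t s. t \<in> {0..1} \<Longrightarrow> \<bar>A l i t * poly ((pderiv ^^ k) (p l)) s\<bar> \<le> b l * exp (1 * s\<^sup>2)" by auto
    show ?thesis
      by (rule summable_comparison_test'[OF summable_mult2[OF b(1)], of 0]) (use b(2)[OF t, of _ s] in auto)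
  qed
  have dt: "((\<lambda>t. U i k t s) has_real_derivative U (Suc i) k t s) (at t within {0..1})" if t: "t \<in> {0..1}" for i k t s
  proof -
    from bnd[of 1 "Suc i" k] obtain b where b: "summable b"
      "\<And>l t s. t \<in> {0..1} \<Longrightarrow> \<bar>A l (Suc i) t * poly ((pderiv ^^ k) (p l)) s\<bar> \<le> b l * exp (1 * s\<^sup>2)" by auto
    have "\<exists>g. \<forall>x\<in>{0..1}. (\<lambda>l. A l i x * poly ((pderiv ^^ k) (p l)) s) sums g x \<and>
        (g has_field_derivative U (Suc i) k x s) (at x within {0..1})"
    proof (rule has_field_derivative_series)
      show "uniform_limit {0..1} (\<lambda>n x. \<Sum>l<n. A l (Suc i) x * poly ((pderiv ^^ k) (p l)) s)
          (\<lambda>x. U (Suc i) k x s) sequentially"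
        unfolding U_def
        by (rule Weierstrass_m_test[OF _ summable_mult2[OF b(1)]]) (use b(2)[of _ _ s] in auto)
      show "((\<lambda>x. A n i x * poly ((pderiv ^^ k) (p n)) s) has_field_derivative
          A n (Suc i) x * poly ((pderiv ^^ k) (p n)) s) (at x within {0..1})" if "x \<in> {0..1}" for n x
        using der[OF that, of n i] by (rule DERIV_cmult_right)
    qed (use t summ in auto)
    then obtain g where g: "\<And>x. x \<in> {0..1} \<Longrightarrow> (\<lambda>l. A l i x * poly ((pderiv ^^ k) (p l)) s) sums g x"
      "\<And>x. x \<in> {0..1} \<Longrightarrow> (g has_field_derivative U (Suc i) k x s) (at x within {0..1})" by blast
    have "g x = U i k x s" if "x \<in> {0..1}" for x
      using sums_unique[OF g(1)[OF that]] by (simp add: U_def)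
    then show ?thesis
      using t by (intro has_field_derivative_transform_within[OF g(2)[OF t], of 1]) auto
  qed
  have ds: "(U i k t has_real_derivative U i (Suc k) t s) (at s)" if t: "t \<in> {0..1}" for i k t s
  proof -
    from bnd[of 1 i "Suc k"] obtain b where b: "summable b"
      "\<And>l t s. t \<in> {0..1} \<Longrightarrow> \<bar>A l i t * poly ((pderiv ^^ Suc k) (p l)) s\<bar> \<le> b l * exp (1 * s\<^sup>2)" by auto
    have b0: "b l \<ge> 0" for l using b(2)[OF t, of l 0] by simp
    \<comment> \<open>The majorant grows with \<open>s\<close>, so uniform convergence is available
      only on bounded intervals; a neighbourhood of \<open>s\<close> is enough.\<close>
    have "\<exists>g. \<forall>x\<in>{s-1..s+1}. (\<lambda>l. A l i t * poly ((pderiv ^^ k) (p l)) x) sums g x \<and>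
        (g has_field_derivative U i (Suc k) t x) (at x within {s-1..s+1})"
    proof (rule has_field_derivative_series)
      show "uniform_limit {s-1..s+1} (\<lambda>n x. \<Sum>l<n. A l i t * poly ((pderiv ^^ Suc k) (p l)) x)
          (\<lambda>x. U i (Suc k) t x) sequentially"
        unfolding U_def
      proof (rule Weierstrass_m_test[OF _ summable_mult2[OF b(1)]])
        fix l x assume x: "x \<in> {s-1..s+1}"
        have "x\<^sup>2 \<le> (\<bar>s\<bar> + 1)\<^sup>2" using x by (subst abs_le_square_iff[symmetric]) auto
        then have "b l * exp (1 * x\<^sup>2) \<le> b l * exp ((\<bar>s\<bar> + 1)\<^sup>2)" by (intro mult_left_mono b0) auto
        with b(2)[OF t, of l x] show "norm (A l i t * poly ((pderiv ^^ Suc k) (p l)) x) \<le> b l * exp ((\<bar>s\<bar> + 1)\<^sup>2)" by simp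
      qed
      show "((\<lambda>x. A l i t * poly ((pderiv ^^ k) (p l)) x) has_field_derivative
          A l i t * poly ((pderiv ^^ Suc k) (p l)) x) (at x within {s-1..s+1})" for l x
        by (auto intro!: DERIV_cmult poly_DERIV[THEN has_field_derivative_at_within])
      show "s \<in> {s-1..s+1}" by simp
    qed (use t summ in auto)
    then obtain g where g: "\<And>x. x \<in> {s-1..s+1} \<Longrightarrow> (\<lambda>l. A l i t * poly ((pderiv ^^ k) (p l)) x) sums g x"
      "\<And>x. x \<in> {s-1..s+1} \<Longrightarrow> (g has_field_derivative U i (Suc k) t x) (at x within {s-1..s+1})" by blast
    have g': "g x = U i k t x" if "x \<in> {s-1<..<s+1}" for x
      using sums_unique[OF g(1)[of x]] that by (simp add: U_def)
    have "(g has_field_derivative U i (Suc k) t s) (at s)"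
      using g(2)[of s] by (simp add: at_within_Icc_at)
    then show ?thesis
      by (rule has_field_derivative_transform_within_open[of _ _ _ "{s-1<..<s+1}"]) (use g' in auto)
  qed
  have "symbol F" if "\<exists>i k. F = U i k" for F
    using that
  proof (rule symbol.coinduct[where X = "\<lambda>F. \<exists>i k. F = U i k"])
    fix F assume "\<exists>i k. F = U i k"
    then obtain i k where F: "F = U i k" by blast
    have "partials F (U (Suc i) k) (U i (Suc k)) (U (Suc i) (Suc k))"
      unfolding partials_def F using dt ds by blast
    then show "\<exists>F' Ft Fs Fts. F = F' \<and> subgaussian F' \<and> partials F' Ft Fs Fts \<and>
       ((\<exists>i k. Ft = U i k) \<or> symbol Ft) \<and> ((\<exists>i k. Fs = U i k) \<or> symbol Fs)"
      using sg F by blast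
  qed
  then show "symbol (U 0 0)" by blast
  show "(Dt ^^ i) (U 0 0) t s = U i 0 t s" if "t \<in> {0..1}"
    using that
  proof (induction i arbitrary: t s)
    case (Suc i)
    have "Dt ((Dt ^^ i) (U 0 0)) = Dt (U i 0)" by (rule Dt_cong) (rule Suc.IH)
    then show ?case using Dt_eqI[OF dt[OF Suc.prems] Suc.prems] by simp
  qed auto
qed

lemma deriv_funpow_local:
  fixes f g :: "real \<Rightarrow> real"
  assumes "open S" "\<And>x. x \<in> S \<Longrightarrow> f x = g x" "x \<in> S"
  shows "(deriv ^^ i) f x = (deriv ^^ i) g x"
  using assms(3)
proof (induction i arbitrary: x)
  case (Suc i)
  have "\<forall>\<^sub>F y in nhds x. (deriv ^^ i) f y = (deriv ^^ i) g y"
    using Suc assms(1) eventually_nhds by blast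
  then show ?case by (auto intro: deriv_cong_ev)
qed (use assms in auto)

lemma deriv_funpow_poly: "(deriv ^^ i) (poly q) = poly ((pderiv ^^ i) (q :: real poly))"
proof (induction i)
  case (Suc i)
  have "deriv (poly r) = poly (pderiv r)" for r :: "real poly"
    by (intro ext DERIV_imp_deriv poly_DERIV)
  with Suc show ?case by simp
qed auto

lemma smooth_compact_support_bounded:
  fixes Y :: "real \<Rightarrow> real"
  assumes "smooth_on UNIV Y" "compact K" "\<And>x. x \<notin> K \<Longrightarrow> Y x = 0"
  obtains B where "B \<ge> 0" "\<And>x. \<bar>(deriv ^^ i) Y x\<bar> \<le> B"
proof -
  have zero: "(deriv ^^ i) Y x = 0" if "x \<notin> K" for x
  proof -
    have "(pderiv ^^ i) 0 = (0 :: real poly)" by (induction i) auto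
    moreover have "(deriv ^^ i) Y x = (deriv ^^ i) (poly 0) x"
      by (rule deriv_funpow_local[of "- K"]) (use that assms compact_imp_closed in auto)
    ultimately show ?thesis by (simp add: deriv_funpow_poly)
  qed
  have "bounded ((deriv ^^ i) Y ` K)"
    using assms(2) smooth_on_UNIV_deriv_funpow[OF assms(1)] smooth_on_subset[of UNIV _ K]
    by (intro compact_imp_bounded compact_continuous_image smooth_on_continuous_on) auto
  then obtain C where C: "\<forall>x\<in>K. \<bar>(deriv ^^ i) Y x\<bar> \<le> C" unfolding bounded_iff by auto
  have "\<bar>(deriv ^^ i) Y x\<bar> \<le> \<bar>C\<bar>" for x using C zero[of x] by (cases "x \<in> K") fastforce+
  then show ?thesis using that[of "\<bar>C\<bar>"] by auto
qed

lemma higher_pderiv_eq_0: "degree p < k \<Longrightarrow> (pderiv ^^ k) (p :: real poly) = 0"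
proof (induction k arbitrary: p)
  case (Suc k)
  show ?case
  proof (cases "degree p = 0")
    case True
    then have "pderiv p = 0" by (simp add: pderiv_eq_0_iff)
    then show ?thesis by (simp add: funpow_Suc_right del: funpow.simps)
  next
    case False
    then show ?thesis using Suc by (simp add: funpow_Suc_right degree_pderiv del: funpow.simps)
  qed
qed auto

lemma poly_higher_pderiv_0: "poly ((pderiv ^^ i) q) 0 = fact i * coeff (q :: real poly) i"
proof (induction i arbitrary: q)
  case (Suc i)
  have "poly ((pderiv ^^ Suc i) q) 0 = fact i * coeff (pderiv q) i"
    using Suc by (simp add: funpow_Suc_right del: funpow.simps)
  then show ?case by (simp add: coeff_pderiv)
qed (simp add: poly_0_coeff_0)

text \<open>For \<open>l \<ge> 1\<close> the term \<open>t ^ l * P l\<close> is multiplied by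
  \<open>ch (L l * t)\<close>. A large \<open>L l\<close> confines it to small \<open>t\<close> and
  makes it small together with its \<open>t\<close>-derivatives of order below \<open>l\<close>, yet
  leaves its germ at \<open>t = 0\<close> unchanged. The comparison with \<open>P 0\<close> is what
  later keeps quantities away from zero on all of \<open>[0, 1]\<close>.\<close>

theorem borel_summation:
  fixes P :: "nat \<Rightarrow> real poly"
  assumes eps: "\<epsilon> > 0"
  obtains F where "has_taylor F (Abs_fps P)"
    "\<And>t s. t \<in> {0..1} \<Longrightarrow> \<bar>F t s - poly (P 0) s\<bar> \<le> \<epsilon> * exp (s\<^sup>2)"
proof -
  obtain ch :: "real \<Rightarrow> real" where ch': "smooth_on UNIV ch" "\<And>x. 0 \<le> ch x" "\<And>x. ch x \<le> 1"
    "\<And>x. \<bar>x\<bar> \<le> 1/2 \<Longrightarrow> ch x = 1" "\<And>x. \<bar>x\<bar> \<ge> 2 * (1/2) \<Longrightarrow> ch x = 0"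
    by (rule exists_plateau[of "1/2"]) (simp, rule that)
  then have ch: "smooth_on UNIV ch" "\<And>x. \<bar>x\<bar> \<le> 1/2 \<Longrightarrow> ch x = 1" "\<And>x. \<bar>x\<bar> \<ge> 1 \<Longrightarrow> ch x = 0"
    by simp_all
  define D where "D = (\<lambda>l i. (deriv ^^ i) (\<lambda>u. u ^ l * ch u))"
  have psi: "smooth_on UNIV (\<lambda>u. u ^ l * ch u)" for l
    by (intro smooth_on_mult smooth_on_power smooth_on_id ch)
  have D_der: "(D l i has_real_derivative D l (Suc i) u) (at u)" for l i u
    using smooth_on_UNIV_deriv(1)[OF smooth_on_UNIV_deriv_funpow[OF psi]] by (simp add: D_def)
  have D_bnd: "\<exists>B\<ge>0. \<forall>u. \<bar>D l i u\<bar> \<le> B" for l i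
  proof (rule smooth_compact_support_bounded[OF psi[of l] compact_Icc[of "-1" 1], where i = i])
    show "u ^ l * ch u = 0" if "u \<notin> {-1..1}" for u using ch(3)[of u] that by auto
  qed (auto simp: D_def)
  have D_0: "D l i 0 = (if i = l then fact l else 0)" for l i
  proof -
    have "D l i 0 = (deriv ^^ i) (poly (monom 1 l)) 0"
      unfolding D_def by (rule deriv_funpow_local[of "ball 0 (1/2)"]) (auto simp: poly_monom ch(2))
    also have "\<dots> = poly ((pderiv ^^ i) (monom 1 l)) 0" by (simp only: deriv_funpow_poly)
    also have "\<dots> = (if i = l then fact l else 0)"
      by (simp add: poly_higher_pderiv_0)
    finally show ?thesis .
  qed
  have poly_bnd: "\<exists>C\<ge>0. \<forall>s. \<bar>poly q s\<bar> \<le> C * exp (\<eta> * s\<^sup>2)" if "\<eta> > 0" for q and \<eta> :: real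
    using subgaussianE[OF symbol_subgaussian[OF symbol_poly[of q]] that] by (metis atLeastAtMost_iff order_refl zero_le_one)
  \<comment> \<open>The rate \<open>1 / l\<close> is a diagonal choice: one scale \<open>L l\<close>
    per term serves every \<open>\<eta>\<close>, because \<open>1 / l \<le> \<eta>\<close> from some
    \<open>l\<close> on.\<close>
  define good where "good = (\<lambda>l L. L \<ge> 1 \<and> (\<forall>i<l. \<forall>k u s.
      \<bar>(L ^ i / L ^ l * D l i u) * poly ((pderiv ^^ k) (P l)) s\<bar> \<le> \<epsilon> / 2 ^ l * exp (s\<^sup>2 / real l)))"
  have "\<exists>L. good l L" if "l \<ge> 1" for l
  proof -
    obtain b where b: "\<And>i. b i \<ge> 0" "\<And>i u. \<bar>D l i u\<bar> \<le> b i" using D_bnd[of l] by metis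
    define B where "B = sum b {..<l}"
    have B: "\<bar>D l i u\<bar> \<le> B" if "i < l" for i u
      using b(2)[of i u] member_le_sum[of i "{..<l}" b] that b(1) unfolding B_def by force
    have "\<exists>C\<ge>0. \<forall>s. \<bar>poly ((pderiv ^^ k) (P l)) s\<bar> \<le> C * exp (1 / real l * s\<^sup>2)" for k
      using that by (intro poly_bnd) auto
    then obtain c where c: "\<And>k. c k \<ge> 0" "\<And>k s. \<bar>poly ((pderiv ^^ k) (P l)) s\<bar> \<le> c k * exp (1 / real l * s\<^sup>2)" by metis
    \<comment> \<open>Derivatives of \<open>P l\<close> beyond its degree vanish, so a finite sum
      gives one constant for all \<open>k\<close>.\<close>
    define C where "C = sum c {..degree (P l)}"
    have C0: "C \<ge> 0" unfolding C_def by (intro sum_nonneg c)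
    have C: "\<bar>poly ((pderiv ^^ k) (P l)) s\<bar> \<le> C * exp (s\<^sup>2 / real l)" for k s
    proof (cases "k \<le> degree (P l)")
      case True
      then have "c k \<le> C" unfolding C_def by (intro member_le_sum) (auto simp: c)
      have "\<bar>poly ((pderiv ^^ k) (P l)) s\<bar> \<le> c k * exp (s\<^sup>2 / real l)" using c(2)[of k s] by simp
      also have "\<dots> \<le> C * exp (s\<^sup>2 / real l)" using \<open>c k \<le> C\<close> by (intro mult_right_mono) auto
      finally show ?thesis .
    qed (use higher_pderiv_eq_0[of "P l" k] C0 in auto)
    \<comment> \<open>For \<open>i < l\<close> the scaling factor \<open>L ^ i / L ^ l\<close> is at
      most \<open>1 / L\<close>; this value of \<open>L\<close> makes \<open>B * C / L\<close> at
      most \<open>\<epsilon> / 2 ^ l\<close>.\<close>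
    define L where "L = max 1 (B * C * 2 ^ l / \<epsilon>)"
    have "(B * C * 2 ^ l / \<epsilon>) * (\<epsilon> / 2 ^ l) \<le> L * (\<epsilon> / 2 ^ l)"
      unfolding L_def using eps by (intro mult_right_mono) auto
    then have L: "L \<ge> 1" "B * C \<le> L * (\<epsilon> / 2 ^ l)"
      using eps by (auto simp: L_def)
    have B0: "B \<ge> 0" unfolding B_def by (intro sum_nonneg b)
    have "\<bar>(L ^ i / L ^ l * D l i u) * poly ((pderiv ^^ k) (P l)) s\<bar> \<le> \<epsilon> / 2 ^ l * exp (s\<^sup>2 / real l)" if il: "i < l" for i k u s
    proof -
      have "L * L ^ i \<le> L ^ l"
        using power_increasing[of "Suc i" l L] il L(1) by simp
      then have "L ^ i / L ^ l \<le> 1 / L" using L(1) by (simp add: field_simps)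
      then have "\<bar>(L ^ i / L ^ l * D l i u) * poly ((pderiv ^^ k) (P l)) s\<bar> \<le> (1 / L * B) * (C * exp (s\<^sup>2 / real l))"
        unfolding abs_mult using L(1) B[OF il, of u] C[of k s] B0 by (intro mult_mono) auto
      also have "\<dots> = (B * C / L) * exp (s\<^sup>2 / real l)" by simp
      also have "\<dots> \<le> \<epsilon> / 2 ^ l * exp (s\<^sup>2 / real l)"
        using L by (intro mult_right_mono) (auto simp: field_simps)
      finally show ?thesis .
    qed
    with L(1) show ?thesis unfolding good_def by blast
  qed
  then obtain L where "\<And>l. l \<ge> 1 \<Longrightarrow> good l (L l)" by metis
  then have L: "L l \<ge> 1" "i < l \<Longrightarrow>
      \<bar>(L l ^ i / L l ^ l * D l i u) * poly ((pderiv ^^ k) (P l)) s\<bar> \<le> \<epsilon> / 2 ^ l * exp (s\<^sup>2 / real l)" if "l \<ge> 1" for l i k u s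
    using that unfolding good_def by blast+
  \<comment> \<open>For \<open>l \<ge> 1\<close> this is the \<open>i\<close>-th derivative of
    \<open>t ^ l * ch (L l * t)\<close>. The term \<open>l = 0\<close> carries no cut-off, so that
    \<open>F - P 0\<close> consists of small terms only.\<close>
  define A where "A = (\<lambda>l i t. if l = 0 then (if i = 0 then 1 else 0) else L l ^ i / L l ^ l * D l i (L l * t))"
  have A_der: "(A l i has_real_derivative A l (Suc i) t) (at t within T)" for l i t T
  proof (cases "l = 0")
    case False
    have "((\<lambda>t. L l ^ i / L l ^ l * D l i (L l * t)) has_real_derivative
        L l ^ i / L l ^ l * (D l (Suc i) (L l * t) * L l)) (at t within T)"
      by (intro DERIV_cmult DERIV_chain2[OF D_der]) (auto intro!: derivative_eq_intros)
    then show ?thesis using False by (simp add: A_def field_simps)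
  qed (simp add: A_def)
  have A_small: "\<bar>A l i t * poly ((pderiv ^^ k) (P l)) s\<bar> \<le> \<epsilon> / 2 ^ l * exp (s\<^sup>2 / real l)" if "i < l" for l i k t s
    using L(2)[of l i "L l * t" k s] that by (simp add: A_def)
  have A_bnd: "\<exists>b. summable b \<and> (\<forall>l. \<forall>t\<in>{0..1}. \<forall>s. \<bar>A l i t * poly ((pderiv ^^ k) (P l)) s\<bar> \<le> b l * exp (\<eta> * s\<^sup>2))"
    if eta: "\<eta> > 0" for i k \<eta>
  proof -
    obtain N1 :: nat where "1 / \<eta> < real N1" using reals_Archimedean2 by blast
    \<comment> \<open>Beyond \<open>N\<close> both \<open>i < l\<close> and
      \<open>1 / l \<le> \<eta>\<close> hold and the terms are geometrically small; the finitely
      many others need only some bound.\<close>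
    define N where "N = max i N1 + 1"
    have "\<exists>c. \<forall>t\<in>{0..1}. \<forall>s. \<bar>A l i t * poly ((pderiv ^^ k) (P l)) s\<bar> \<le> c * exp (\<eta> * s\<^sup>2)" for l
    proof -
      obtain B where "B \<ge> 0" "\<And>u. \<bar>D l i u\<bar> \<le> B" using D_bnd by blast
      then have "\<bar>A l i t\<bar> \<le> max 1 (\<bar>L l ^ i / L l ^ l\<bar> * B)" for t
        using mult_left_mono[of "\<bar>D l i (L l * t)\<bar>" B "\<bar>L l ^ i / L l ^ l\<bar>"]
        by (cases "l = 0") (auto simp: A_def abs_mult le_max_iff_disj)
      moreover obtain C where "C \<ge> 0" "\<And>s. \<bar>poly ((pderiv ^^ k) (P l)) s\<bar> \<le> C * exp (\<eta> * s\<^sup>2)"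
        using poly_bnd[OF eta] by blast
      ultimately have "\<bar>A l i t * poly ((pderiv ^^ k) (P l)) s\<bar> \<le> max 1 (\<bar>L l ^ i / L l ^ l\<bar> * B) * (C * exp (\<eta> * s\<^sup>2))" for t s
        unfolding abs_mult by (intro mult_mono) auto
      then show ?thesis by (intro exI[of _ "max 1 (\<bar>L l ^ i / L l ^ l\<bar> * B) * C"]) (auto simp: mult.assoc)
    qed
    then obtain c where c: "\<And>l t s. t \<in> {0..1} \<Longrightarrow> \<bar>A l i t * poly ((pderiv ^^ k) (P l)) s\<bar> \<le> c l * exp (\<eta> * s\<^sup>2)" by metis
    define b where "b = (\<lambda>l. if l \<le> N then c l else \<epsilon> / 2 ^ l)"
    have "summable (\<lambda>l. \<epsilon> * (1 / 2) ^ l)" by (intro summable_mult summable_geometric) auto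
    then have "summable (\<lambda>l. \<epsilon> / 2 ^ l)" by (simp add: power_one_over field_simps)
    moreover have "\<forall>\<^sub>F l in sequentially. b l = \<epsilon> / 2 ^ l"
      using eventually_gt_at_top[of N] by eventually_elim (simp add: b_def)
    ultimately have "summable b" using summable_cong by metis
    moreover have "\<bar>A l i t * poly ((pderiv ^^ k) (P l)) s\<bar> \<le> b l * exp (\<eta> * s\<^sup>2)" if t: "t \<in> {0..1}" for l t s
    proof (cases "l \<le> N")
      case False
      then have l: "i < l" "1 / \<eta> < real l" using \<open>1 / \<eta> < real N1\<close> by (auto simp: N_def)
      then have "1 / real l \<le> \<eta>" using eta by (simp add: field_simps)
      then have "1 / real l * s\<^sup>2 \<le> \<eta> * s\<^sup>2" by (intro mult_right_mono) auto
      then have "exp (s\<^sup>2 / real l) \<le> exp (\<eta> * s\<^sup>2)" by simp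
      then have "\<epsilon> / 2 ^ l * exp (s\<^sup>2 / real l) \<le> \<epsilon> / 2 ^ l * exp (\<eta> * s\<^sup>2)"
        using eps by (intro mult_left_mono) auto
      then show ?thesis using A_small[OF l(1), of t k s] False by (simp add: b_def)
    qed (use c[OF t] in \<open>simp add: b_def\<close>)
    ultimately show ?thesis by blast
  qed
  define F where "F = (\<lambda>t s. \<Sum>l. A l 0 t * poly (P l) s)"
  have F: "symbol F" "t \<in> {0..1} \<Longrightarrow> (Dt ^^ i) F t s = (\<Sum>l. A l i t * poly (P l) s)" for t i s
    using symbol_series[of A P, OF A_der A_bnd] unfolding F_def by simp_all
  have A_0: "A l i 0 = (if i = l then fact l else 0)" for l i
    using L(1)[of l] by (auto simp: A_def D_0)
  have "(Dt ^^ i) F 0 s = fact i * poly (P i) s" for i s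
    using F(2)[of 0 i s] suminf_finite[of "{i}" "\<lambda>l. A l i 0 * poly (P l) s"] by (simp add: A_0)
  then have taylor: "has_taylor F (Abs_fps P)" using F(1) by (simp add: has_taylor_def)
  moreover have "\<bar>F t s - poly (P 0) s\<bar> \<le> \<epsilon> * exp (s\<^sup>2)" if t: "t \<in> {0..1}" for t s
  proof -
    have bound: "\<bar>A (Suc l) 0 t * poly (P (Suc l)) s\<bar> \<le> \<epsilon> * exp (s\<^sup>2) * (1/2) ^ Suc l" for l
    proof -
      have "s\<^sup>2 / real (Suc l) \<le> s\<^sup>2 / 1" by (intro divide_left_mono) auto
      then have "exp (s\<^sup>2 / real (Suc l)) \<le> exp (s\<^sup>2)" by simp
      then have "\<epsilon> / 2 ^ Suc l * exp (s\<^sup>2 / real (Suc l)) \<le> \<epsilon> / 2 ^ Suc l * exp (s\<^sup>2)"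
        using eps by (intro mult_left_mono) auto
      with A_small[of 0 "Suc l" t 0 s] show ?thesis by (simp add: field_simps power_one_over)
    qed
    have sums: "(\<lambda>l. \<epsilon> * exp (s\<^sup>2) * (1/2) ^ Suc l) sums (\<epsilon> * exp (s\<^sup>2) * 1)"
      by (intro sums_mult power_half_series)
    have summ: "summable (\<lambda>l. A l 0 t * poly (P l) s)"
      using summable_comparison_test'[OF sums_summable[OF sums], of 0 "\<lambda>l. A (Suc l) 0 t * poly (P (Suc l)) s"] bound
        summable_Suc_iff[of "\<lambda>l. A l 0 t * poly (P l) s"] by simp
    have "F t s - poly (P 0) s = (\<Sum>l. A (Suc l) 0 t * poly (P (Suc l)) s)"
      using suminf_split_head[OF summ] by (simp add: F_def A_def)
    also have "\<bar>\<dots>\<bar> \<le> (\<Sum>l. \<epsilon> * exp (s\<^sup>2) * (1/2) ^ Suc l)"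
      using norm_suminf_le[of "\<lambda>l. A (Suc l) 0 t * poly (P (Suc l)) s"] bound sums_summable[OF sums] by simp
    also have "\<dots> = \<epsilon> * exp (s\<^sup>2)" using sums_unique[OF sums] by simp
    finally show ?thesis .
  qed
  ultimately show ?thesis by (rule that)
qed

section \<open>Gaussian packets\<close>

text \<open>Conjugating \<open>\<partial>\<^sub>s\<close> by the Gaussian \<open>exp (- \<alpha> s\<^sup>2 / 2)\<close>.\<close>

definition gauss_deriv :: "real \<Rightarrow> (real \<Rightarrow> real \<Rightarrow> real) \<Rightarrow> real \<Rightarrow> real \<Rightarrow> real" where
  "gauss_deriv \<alpha> F t s = Ds F t s - \<alpha> * s * F t s"

lemma symbol_gauss_deriv: "symbol F \<Longrightarrow> symbol (gauss_deriv \<alpha> F)"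
  unfolding gauss_deriv_def by (intro symbol_diff symbol_Ds symbol_mult symbol_const symbol_s)

lemma symbol_gauss_deriv_funpow: "symbol F \<Longrightarrow> symbol ((gauss_deriv \<alpha> ^^ k) F)"
  by (induction k) (auto intro: symbol_gauss_deriv)

lemma Dt_gauss_deriv:
  assumes F: "symbol F"
  shows "Dt (gauss_deriv \<alpha> F) = gauss_deriv \<alpha> (Dt F)"
proof (intro ext)
  fix t s
  show "Dt (gauss_deriv \<alpha> F) t s = gauss_deriv \<alpha> (Dt F) t s"
  proof (cases "t \<in> {0..1}")
    case True
    have "((\<lambda>t. gauss_deriv \<alpha> F t s) has_real_derivative Dt (Ds F) t s - \<alpha> * s * Dt F t s) (at t within {0..1})"
      unfolding gauss_deriv_def
      by (intro DERIV_diff DERIV_cmult symbol_has_derivative(1) True symbol_Ds F)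
    then show ?thesis
      using Dt_eqI[OF _ True] Ds_Dt[OF F] by (metis gauss_deriv_def)
  qed (auto simp: Dt_def Ds_def gauss_deriv_def)
qed

definition gaussian :: "real \<Rightarrow> real \<Rightarrow> real" where
  "gaussian \<alpha> s = exp (- (\<alpha> * s\<^sup>2 / 2))"

lemma gaussian_nonneg [simp]: "gaussian \<alpha> s \<ge> 0"
  by (simp add: gaussian_def)

lemma gaussian_times_has_derivative:
  assumes "symbol F" "t \<in> {0..1}"
  shows "((\<lambda>s. F t s * gaussian \<alpha> s) has_real_derivative gauss_deriv \<alpha> F t s * gaussian \<alpha> s) (at s)"
proof -
  have "(gaussian \<alpha> has_real_derivative - \<alpha> * s * gaussian \<alpha> s) (at s)"
    unfolding gaussian_def[abs_def] by (auto intro!: derivative_eq_intros)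
  from DERIV_mult[OF symbol_has_derivative(2)[OF assms] this] show ?thesis
    by (simp add: gauss_deriv_def algebra_simps)
qed

text \<open>The three coefficients cover a single packet (\<open>1, 0, 0\<close>) as well as the
  error of a difference quotient in \<open>t\<close>, so membership in the Schwartz space and
  differentiability with values in it rest on the same computation.\<close>

lemma iter_deriv_gaussian:
  assumes "symbol F" "t \<in> {0..1}" "u \<in> {0..1}"
  shows "iter_deriv b (\<lambda>x. of_real ((c\<^sub>1 * F u x + c\<^sub>2 * F t x + c\<^sub>3 * Dt F t x) * gaussian \<alpha> x)) =
    (\<lambda>x. of_real ((c\<^sub>1 * (gauss_deriv \<alpha> ^^ b) F u x + c\<^sub>2 * (gauss_deriv \<alpha> ^^ b) F t x +
      c\<^sub>3 * Dt ((gauss_deriv \<alpha> ^^ b) F) t x) * gaussian \<alpha> x))"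
  using assms(1)
proof (induction b arbitrary: F)
  case 0
  then show ?case by (simp add: iter_deriv_def)
next
  case (Suc b)
  let ?f = "\<lambda>F x. (c\<^sub>1 * F u x + c\<^sub>2 * F t x + c\<^sub>3 * Dt F t x) * gaussian \<alpha> x"
  have "(?f F has_real_derivative ?f (gauss_deriv \<alpha> F) x) (at x)" for x
  proof -
    have "((\<lambda>x. c\<^sub>1 * (F u x * gaussian \<alpha> x) + c\<^sub>2 * (F t x * gaussian \<alpha> x) + c\<^sub>3 * (Dt F t x * gaussian \<alpha> x))
      has_real_derivative c\<^sub>1 * (gauss_deriv \<alpha> F u x * gaussian \<alpha> x) + c\<^sub>2 * (gauss_deriv \<alpha> F t x * gaussian \<alpha> x) +
        c\<^sub>3 * (gauss_deriv \<alpha> (Dt F) t x * gaussian \<alpha> x)) (at x)"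
      by (intro DERIV_add DERIV_cmult gaussian_times_has_derivative Suc symbol_Dt assms)
    then show ?thesis by (simp add: Dt_gauss_deriv Suc algebra_simps)
  qed
  then have "((\<lambda>x. of_real (?f F x) :: complex) has_vector_derivative of_real (?f (gauss_deriv \<alpha> F) x)) (at x)" for x
    by (intro has_vector_derivative_of_real) (simp add: has_real_derivative_iff_has_vector_derivative)
  then have "(\<lambda>x. vector_derivative (\<lambda>x. of_real (?f F x) :: complex) (at x)) = (\<lambda>x. of_real (?f (gauss_deriv \<alpha> F) x))"
    by (intro ext vector_derivative_at)
  then have "iter_deriv (Suc b) (\<lambda>x. of_real (?f F x)) = iter_deriv b (\<lambda>x. of_real (?f (gauss_deriv \<alpha> F) x))"
    by (simp add: iter_deriv_def funpow_Suc_right del: funpow.simps)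
  with Suc.IH[OF symbol_gauss_deriv[OF Suc.prems]] show ?case
    by (simp add: funpow_swap1)
qed

lemma power_times_gaussian_bounded:
  assumes "\<alpha> > 0" "\<eta> < \<alpha> / 2"
  obtains C where "C \<ge> 0" "\<And>x. \<bar>x ^ a\<bar> * exp (\<eta> * x\<^sup>2) * gaussian \<alpha> x \<le> C"
proof -
  have "\<alpha> / 2 - \<eta> > 0" using assms by simp
  obtain C where C: "C \<ge> 0" "\<And>(t::real) s. t \<in> {0..1} \<Longrightarrow> \<bar>s ^ a\<bar> \<le> C * exp ((\<alpha> / 2 - \<eta>) * s\<^sup>2)"
    by (rule subgaussianE[OF symbol_subgaussian[OF symbol_power[OF symbol_s, of a]] \<open>\<alpha> / 2 - \<eta> > 0\<close>]) (rule that)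
  have "\<bar>x ^ a\<bar> * exp (\<eta> * x\<^sup>2) * gaussian \<alpha> x \<le> C" for x
  proof -
    have "\<bar>x ^ a\<bar> * (exp (\<eta> * x\<^sup>2) * gaussian \<alpha> x) \<le> (C * exp ((\<alpha> / 2 - \<eta>) * x\<^sup>2)) * (exp (\<eta> * x\<^sup>2) * gaussian \<alpha> x)"
      using C(2)[of 0 x] by (intro mult_right_mono) simp_all
    also have "\<dots> = C * exp ((\<alpha> / 2 - \<eta>) * x\<^sup>2 + \<eta> * x\<^sup>2 + - (\<alpha> * x\<^sup>2 / 2))"
      by (simp only: gaussian_def exp_add mult.assoc)
    also have "(\<alpha> / 2 - \<eta>) * x\<^sup>2 + \<eta> * x\<^sup>2 + - (\<alpha> * x\<^sup>2 / 2) = 0" by (simp add: algebra_simps)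
    also have "C * exp 0 = C" by simp
    finally show ?thesis by (simp add: mult.assoc)
  qed
  with C(1) show ?thesis using that by blast
qed

lemma schwartz_gaussian:
  assumes "\<alpha> > 0" "symbol F" "t \<in> {0..1}"
  shows "schwartz (\<lambda>x. of_real (F t x * gaussian \<alpha> x))"
  unfolding schwartz_def
proof (intro conjI allI)
  show "smooth_on UNIV (\<lambda>x. of_real (F t x * gaussian \<alpha> x) :: complex)"
  proof (intro smooth_on_of_real smooth_on_coinduct_vector[where P = "\<lambda>u. \<exists>F. symbol F \<and> u = (\<lambda>x. F t x * gaussian \<alpha> x)"])
    fix u assume "\<exists>F. symbol F \<and> u = (\<lambda>x. F t x * gaussian \<alpha> x)"
    then obtain F where F: "symbol F" "u = (\<lambda>x. F t x * gaussian \<alpha> x)" by blast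
    show "\<exists>g'. (\<forall>x\<in>UNIV. (u has_vector_derivative g' x) (at x)) \<and> (\<exists>F. symbol F \<and> g' = (\<lambda>x. F t x * gaussian \<alpha> x))"
      unfolding F(2) has_real_derivative_iff_has_vector_derivative[symmetric]
      using gaussian_times_has_derivative[OF F(1) assms(3)] symbol_gauss_deriv[OF F(1)]
      by (intro exI[of _ "\<lambda>x. gauss_deriv \<alpha> F t x * gaussian \<alpha> x"]) blast
  qed (use assms in blast)
next
  fix a b
  have eq: "iter_deriv b (\<lambda>x. of_real (F t x * gaussian \<alpha> x)) = (\<lambda>x. of_real ((gauss_deriv \<alpha> ^^ b) F t x * gaussian \<alpha> x))"
    using iter_deriv_gaussian[OF assms(2,3,3), of b 1 0 0 \<alpha>] by simp
  have "\<alpha> / 4 > 0" using assms(1) by simp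
  obtain C where C: "C \<ge> 0" "\<And>t s. t \<in> {0..1} \<Longrightarrow> \<bar>(gauss_deriv \<alpha> ^^ b) F t s\<bar> \<le> C * exp (\<alpha> / 4 * s\<^sup>2)"
    by (rule subgaussianE[OF symbol_subgaussian[OF symbol_gauss_deriv_funpow[OF assms(2)]] \<open>\<alpha> / 4 > 0\<close>]) (rule that)
  obtain D where D: "D \<ge> 0" "\<And>x. \<bar>x ^ a\<bar> * exp (\<alpha> / 4 * x\<^sup>2) * gaussian \<alpha> x \<le> D"
    by (rule power_times_gaussian_bounded[OF assms(1), of "\<alpha> / 4" a]) (use assms(1) that in auto)
  have "norm (x ^ a *\<^sub>R iter_deriv b (\<lambda>x. of_real (F t x * gaussian \<alpha> x)) x) \<le> C * D" for x
  proof -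
    have "norm (x ^ a *\<^sub>R iter_deriv b (\<lambda>x. of_real (F t x * gaussian \<alpha> x)) x) =
        \<bar>(gauss_deriv \<alpha> ^^ b) F t x\<bar> * (\<bar>x ^ a\<bar> * gaussian \<alpha> x)"
      by (simp add: eq abs_mult flip: of_real_mult)
    also have "\<dots> \<le> (C * exp (\<alpha> / 4 * x\<^sup>2)) * (\<bar>x ^ a\<bar> * gaussian \<alpha> x)"
      using C(2)[OF assms(3)] by (intro mult_right_mono) auto
    also have "\<dots> = C * (\<bar>x ^ a\<bar> * exp (\<alpha> / 4 * x\<^sup>2) * gaussian \<alpha> x)" by simp
    also have "\<dots> \<le> C * D" using C D by (intro mult_left_mono) auto
    finally show ?thesis .
  qed
  then show "bounded (range (\<lambda>x. x ^ a *\<^sub>R iter_deriv b (\<lambda>x. of_real (F t x * gaussian \<alpha> x)) x))"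
    unfolding bounded_iff by blast
qed

lemma power2_as_abs: "e\<^sup>2 = \<bar>e\<bar> * \<bar>e :: real\<bar>"
  by (simp add: power2_eq_square)

text \<open>The quadratic error of \<open>symbol_difference_quotient\<close>, divided by
  \<open>|u - t|\<close>, leaves seminorms of size \<open>|u - t|\<close>. The growth rate
  \<open>\<alpha> / 4\<close> uses half of the Gaussian; the other half absorbs the power
  \<open>x ^ a\<close>.\<close>

theorem smooth_schwartz_valued_gaussian:
  assumes \<alpha>: "\<alpha> > 0" and F: "symbol F"
  shows "smooth_schwartz_valued {0..1} (\<lambda>t x. of_real (F t x * gaussian \<alpha> x))"
  unfolding smooth_schwartz_valued_def
proof (intro exI[of _ "\<lambda>k t x. of_real ((Dt ^^ k) F t x * gaussian \<alpha> x)"] conjI ballI allI)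
  fix k t a b assume t: "t \<in> {0..1::real}"
  let ?F = "(Dt ^^ k) F"
  have Fk: "symbol ?F" by (rule symbol_Dt_funpow[OF F])
  show "schwartz (\<lambda>x. of_real (?F t x * gaussian \<alpha> x))"
    by (rule schwartz_gaussian[OF \<alpha> Fk t])
  have "\<alpha> / 4 > 0" using \<alpha> by simp
  let ?G = "(gauss_deriv \<alpha> ^^ b) ?F"
  obtain C where C: "C \<ge> 0" "\<And>t u s. t \<in> {0..1} \<Longrightarrow> u \<in> {0..1} \<Longrightarrow>
      \<bar>?G u s - ?G t s - (u - t) * Dt ?G t s\<bar> \<le> C * (u - t)\<^sup>2 * exp (\<alpha> / 4 * s\<^sup>2)"
    by (rule symbol_difference_quotient[OF symbol_gauss_deriv_funpow[OF Fk, of b \<alpha>] \<open>\<alpha> / 4 > 0\<close>]) (rule that)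
  obtain D where D: "D \<ge> 0" "\<And>x. \<bar>x ^ a\<bar> * exp (\<alpha> / 4 * x\<^sup>2) * gaussian \<alpha> x \<le> D"
    by (rule power_times_gaussian_bounded[OF \<alpha>, of "\<alpha> / 4" a]) (use \<alpha> that in auto)
  let ?q = "\<lambda>u x. (of_real (?F u x * gaussian \<alpha> x) - of_real (?F t x * gaussian \<alpha> x)) /\<^sub>R (u - t) -
      of_real ((Dt ^^ Suc k) F t x * gaussian \<alpha> x) :: complex"
  have bound: "norm (x ^ a *\<^sub>R iter_deriv b (?q u) x) \<le> C * D * \<bar>u - t\<bar>" if u: "u \<in> {0..1}" "u \<noteq> t" for u x
  proof -
    have "?q u = (\<lambda>x. of_real ((inverse (u - t) * ?F u x + (- inverse (u - t)) * ?F t x + (- 1) * Dt ?F t x) * gaussian \<alpha> x))"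
      by (auto simp: scaleR_conv_of_real algebra_simps)
    then have "iter_deriv b (?q u) x =
        of_real ((inverse (u - t) * ?G u x + (- inverse (u - t)) * ?G t x + (- 1) * Dt ?G t x) * gaussian \<alpha> x)"
      using iter_deriv_gaussian[OF Fk t u(1), of b "inverse (u - t)" "- inverse (u - t)" "- 1" \<alpha>] by simp
    also have "inverse (u - t) * ?G u x + (- inverse (u - t)) * ?G t x + (- 1) * Dt ?G t x =
        (?G u x - ?G t x - (u - t) * Dt ?G t x) / (u - t)"
    proof -
      have "inverse e * c + (- inverse e) * d + (- 1) * z = (c - d - e * z) / e" if "e \<noteq> 0" for c d e z :: real
        using that by (simp add: field_simps)
      from this[of "u - t"] u(2) show ?thesis by simp
    qed
    finally have "norm (x ^ a *\<^sub>R iter_deriv b (?q u) x) =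
        \<bar>?G u x - ?G t x - (u - t) * Dt ?G t x\<bar> / \<bar>u - t\<bar> * (\<bar>x ^ a\<bar> * gaussian \<alpha> x)"
      by (simp add: abs_mult flip: of_real_mult of_real_diff of_real_divide)
    also have "\<dots> \<le> (C * (u - t)\<^sup>2 * exp (\<alpha> / 4 * x\<^sup>2)) / \<bar>u - t\<bar> * (\<bar>x ^ a\<bar> * gaussian \<alpha> x)"
      using C(2)[OF t u(1), of x] by (intro mult_right_mono divide_right_mono) auto
    also have "\<dots> = C * \<bar>u - t\<bar> * (\<bar>x ^ a\<bar> * exp (\<alpha> / 4 * x\<^sup>2) * gaussian \<alpha> x)"
      using u(2) by (simp add: power2_as_abs[of "u - t"] del: abs_mult_self_eq)
    also have "\<dots> \<le> C * \<bar>u - t\<bar> * D" using C D by (intro mult_left_mono) auto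
    finally show ?thesis by (simp add: mult_ac)
  qed
  have seminorm: "\<bar>schwartz_seminorm a b (?q u)\<bar> \<le> C * D * \<bar>u - t\<bar>" if u: "u \<in> {0..1}" "u \<noteq> t" for u
  proof -
    have "0 \<le> norm (0 ^ a *\<^sub>R iter_deriv b (?q u) 0)" by simp
    also have "\<dots> \<le> schwartz_seminorm a b (?q u)"
      unfolding schwartz_seminorm_def
      by (intro cSUP_upper bdd_aboveI2[where M = "C * D * \<bar>u - t\<bar>"] bound[OF u]) auto
    finally have "0 \<le> schwartz_seminorm a b (?q u)" .
    moreover have "schwartz_seminorm a b (?q u) \<le> C * D * \<bar>u - t\<bar>"
      unfolding schwartz_seminorm_def by (intro cSUP_least bound[OF u]) auto
    ultimately show ?thesis by simp
  qed
  show "((\<lambda>u. schwartz_seminorm a b (?q u)) \<longlongrightarrow> 0) (at t within {0..1})"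
  proof (rule Lim_null_comparison)
    show "\<forall>\<^sub>F u in at t within {0..1}. norm (schwartz_seminorm a b (?q u)) \<le> C * D * \<bar>u - t\<bar>"
      using seminorm by (auto simp: eventually_at_filter)
    have "((\<lambda>u. C * D * \<bar>u - t\<bar>) \<longlongrightarrow> C * D * \<bar>t - t\<bar>) (at t within {0..1})" by (intro tendsto_intros)
    then show "((\<lambda>u. C * D * \<bar>u - t\<bar>) \<longlongrightarrow> 0) (at t within {0..1})" by simp
  qed
qed auto

text \<open>Completing the square gives \<open>|s| \<le> s^2 + 1/4\<close>, so a two-sided
  exponential dominates the Gaussian.\<close>

lemma integrable_gaussian:
  fixes \<beta> :: real
  assumes "\<beta> > 0"
  shows "integrable lborel (\<lambda>s. exp (- (\<beta> * s\<^sup>2)))"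
proof -
  define h where "h = (\<lambda>x::real. indicator {0..} x * exp (- \<beta> * x))"
  have meas: "h \<in> borel_measurable borel" unfolding h_def by measurable
  have "(\<lambda>x. exp (- \<beta> * x)) absolutely_integrable_on {0..}"
    by (intro nonnegative_absolutely_integrable_1 integrable_on_exp_minus_to_infinity assms) auto
  then have "integrable lebesgue h" by (simp add: set_integrable_def h_def)
  then have h: "integrable lborel h" using meas by (simp add: integrable_completion)
  then have "integrable lborel (\<lambda>x. h (0 + (-1) * x))" by (rule lborel_integrable_real_affine) auto
  with h have "integrable lborel (\<lambda>x. exp (\<beta> / 4) * (h x + h (- x)))" by simp
  then show ?thesis
  proof (rule Bochner_Integration.integrable_bound)
    show "(\<lambda>s. exp (- (\<beta> * s\<^sup>2))) \<in> borel_measurable lborel" by measurable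
    have "exp (- (\<beta> * s\<^sup>2)) \<le> exp (\<beta> / 4) * (h s + h (- s))" for s
    proof -
      have "\<bar>s\<bar> \<le> s\<^sup>2 + 1/4" using zero_le_power2[of "\<bar>s\<bar> - 1/2"] unfolding power2_diff by (simp add: power2_eq_square)
      then have "\<beta> * \<bar>s\<bar> \<le> \<beta> * (s\<^sup>2 + 1/4)" using assms by (intro mult_left_mono) auto
      then have "exp (- (\<beta> * s\<^sup>2)) \<le> exp (\<beta> / 4 - \<beta> * \<bar>s\<bar>)" by (simp add: algebra_simps)
      also have "\<dots> = exp (\<beta> / 4) * exp (- \<beta> * \<bar>s\<bar>)" by (simp flip: exp_add)
      also have "\<dots> \<le> exp (\<beta> / 4) * (h s + h (- s))"
        by (intro mult_left_mono) (auto simp: h_def abs_if indicator_def)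
      finally show ?thesis .
    qed
    then show "AE s in lborel. norm (exp (- (\<beta> * s\<^sup>2))) \<le> norm (exp (\<beta> / 4) * (h s + h (- s)))"
      by (intro AE_I2) (auto intro: order_trans[OF _ abs_ge_self])
  qed
qed

lemma symbol_measurable:
  assumes "symbol F" "t \<in> {0..1}"
  shows "F t \<in> borel_measurable borel"
  using symbol_has_derivative(2)[OF assms]
  by (intro borel_measurable_continuous_onI DERIV_continuous_on) auto

lemma symbol_gaussian_integrable:
  assumes "\<beta> > 0" "symbol F" "t \<in> {0..1}"
  shows "integrable lborel (\<lambda>s. F t s * exp (- (\<beta> * s\<^sup>2)))"
proof -
  have "\<beta> / 2 > 0" using assms by simp
  obtain C where C: "C \<ge> 0" "\<And>t s. t \<in> {0..1} \<Longrightarrow> \<bar>F t s\<bar> \<le> C * exp (\<beta> / 2 * s\<^sup>2)"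
    by (rule subgaussianE[OF symbol_subgaussian[OF assms(2)] \<open>\<beta> / 2 > 0\<close>]) (rule that)
  show ?thesis
  proof (rule Bochner_Integration.integrable_bound)
    show "integrable lborel (\<lambda>s. C * exp (- (\<beta> / 2 * s\<^sup>2)))"
      by (intro integrable_mult_right integrable_gaussian \<open>\<beta> / 2 > 0\<close>)
    show "(\<lambda>s. F t s * exp (- (\<beta> * s\<^sup>2))) \<in> borel_measurable lborel"
      using symbol_measurable[OF assms(2,3)] by measurable
    have "norm (F t s * exp (- (\<beta> * s\<^sup>2))) \<le> C * exp (- (\<beta> / 2 * s\<^sup>2))" for s
    proof -
      have "\<bar>F t s\<bar> * exp (- (\<beta> * s\<^sup>2)) \<le> (C * exp (\<beta> / 2 * s\<^sup>2)) * exp (- (\<beta> * s\<^sup>2))"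
        using C(2)[OF assms(3)] by (intro mult_right_mono) auto
      also have "\<dots> = C * exp (- (\<beta> / 2 * s\<^sup>2))"
        by (simp add: mult.assoc flip: exp_add)
      finally show ?thesis by (simp add: abs_mult)
    qed
    then show "AE s in lborel. norm (F t s * exp (- (\<beta> * s\<^sup>2))) \<le> norm (C * exp (- (\<beta> / 2 * s\<^sup>2)))"
      using C(1) by (intro AE_I2) (simp add: abs_mult)
  qed
qed

text \<open>Integrals of symbols against a fixed Gaussian are closed under differentiation in
  \<open>t\<close>: half of the Gaussian pays for the growth of the second order error, the other
  half keeps it integrable.\<close>

lemma smooth_on_gaussian_integral:
  assumes \<beta>: "\<beta> > 0" and F: "symbol F"
  shows "smooth_on {0..1} (\<lambda>t. LINT s|lborel. F t s * exp (- (\<beta> * s\<^sup>2)))"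
proof (rule smooth_on_coinduct_vector[where P = "\<lambda>u. \<exists>F. symbol F \<and> u = (\<lambda>t. LINT s|lborel. F t s * exp (- (\<beta> * s\<^sup>2)))"])
  fix v assume "\<exists>F. symbol F \<and> v = (\<lambda>t. LINT s|lborel. F t s * exp (- (\<beta> * s\<^sup>2)))"
  then obtain F where F: "symbol F" and v: "v = (\<lambda>t. LINT s|lborel. F t s * exp (- (\<beta> * s\<^sup>2)))" by blast
  let ?N = "\<lambda>F t. LINT s|lborel. F t s * exp (- (\<beta> * s\<^sup>2))"
  have "\<beta> / 2 > 0" using \<beta> by simp
  obtain C where C: "C \<ge> 0" "\<And>t u s. t \<in> {0..1} \<Longrightarrow> u \<in> {0..1} \<Longrightarrow>
      \<bar>F u s - F t s - (u - t) * Dt F t s\<bar> \<le> C * (u - t)\<^sup>2 * exp (\<beta> / 2 * s\<^sup>2)"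
    by (rule symbol_difference_quotient[OF F \<open>\<beta> / 2 > 0\<close>]) (rule that)
  note int = symbol_gaussian_integrable[OF \<beta>]
  define M where "M = (LINT s|lborel. exp (- (\<beta> / 2 * s\<^sup>2)))"
  have est: "\<bar>?N F u - ?N F t - (u - t) * ?N (Dt F) t\<bar> \<le> C * M * (u - t)\<^sup>2" if tu: "t \<in> {0..1}" "u \<in> {0..1}" for t u
  proof -
    have eq: "?N F u - ?N F t - (u - t) * ?N (Dt F) t =
        (LINT s|lborel. (F u s - F t s - (u - t) * Dt F t s) * exp (- (\<beta> * s\<^sup>2)))"
      using int[OF F tu(1)] int[OF F tu(2)] int[OF symbol_Dt[OF F] tu(1)]
      by (simp add: left_diff_distrib mult.assoc)
    have "norm (LINT s|lborel. (F u s - F t s - (u - t) * Dt F t s) * exp (- (\<beta> * s\<^sup>2)))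
        \<le> (LINT s|lborel. C * (u - t)\<^sup>2 * exp (- (\<beta> / 2 * s\<^sup>2)))"
    proof (rule Bochner_Integration.integral_norm_bound_integral)
      have "integrable lborel (\<lambda>s. F u s * exp (- (\<beta> * s\<^sup>2)) - F t s * exp (- (\<beta> * s\<^sup>2)) -
          (u - t) * (Dt F t s * exp (- (\<beta> * s\<^sup>2))))"
        by (intro Bochner_Integration.integrable_diff integrable_mult_right int F symbol_Dt tu)
      then show "integrable lborel (\<lambda>s. (F u s - F t s - (u - t) * Dt F t s) * exp (- (\<beta> * s\<^sup>2)))"
        by (simp add: left_diff_distrib mult.assoc)
      show "integrable lborel (\<lambda>s. C * (u - t)\<^sup>2 * exp (- (\<beta> / 2 * s\<^sup>2)))"
        by (intro integrable_mult_right integrable_gaussian \<open>\<beta> / 2 > 0\<close>)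
      fix s
      have "\<bar>F u s - F t s - (u - t) * Dt F t s\<bar> * exp (- (\<beta> * s\<^sup>2)) \<le> (C * (u - t)\<^sup>2 * exp (\<beta> / 2 * s\<^sup>2)) * exp (- (\<beta> * s\<^sup>2))"
        using C(2)[OF tu] by (intro mult_right_mono) auto
      also have "\<dots> = C * (u - t)\<^sup>2 * exp (- (\<beta> / 2 * s\<^sup>2))"
        by (simp add: mult.assoc flip: exp_add)
      finally show "norm ((F u s - F t s - (u - t) * Dt F t s) * exp (- (\<beta> * s\<^sup>2))) \<le> C * (u - t)\<^sup>2 * exp (- (\<beta> / 2 * s\<^sup>2))"
        by (simp add: abs_mult)
    qed
    also have "\<dots> = C * M * (u - t)\<^sup>2" by (simp add: M_def)
    finally show ?thesis unfolding eq by simp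
  qed
  have "(v has_real_derivative ?N (Dt F) t) (at t within {0..1})" if t: "t \<in> {0..1}" for t
    unfolding has_field_derivative_iff
  proof (rule LIM_zero_cancel, rule Lim_null_comparison)
    show "\<forall>\<^sub>F u in at t within {0..1}. norm ((v u - v t) / (u - t) - ?N (Dt F) t) \<le> C * M * \<bar>u - t\<bar>"
      unfolding eventually_at_filter
    proof (intro always_eventually allI impI)
      fix u assume u: "u \<noteq> t" "u \<in> {0..1}"
      have eq: "(v u - v t) / (u - t) - ?N (Dt F) t = (?N F u - ?N F t - (u - t) * ?N (Dt F) t) / (u - t)"
        using u(1) by (simp add: v field_simps)
      have "norm ((?N F u - ?N F t - (u - t) * ?N (Dt F) t) / (u - t)) \<le> C * M * (u - t)\<^sup>2 / \<bar>u - t\<bar>"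
        using est[OF t u(2)] by (simp add: divide_right_mono)
      also have "\<dots> = C * M * \<bar>u - t\<bar>"
        using u(1) by (simp add: power2_as_abs[of "u - t"] del: abs_mult_self_eq)
      finally show "norm ((v u - v t) / (u - t) - ?N (Dt F) t) \<le> C * M * \<bar>u - t\<bar>" unfolding eq .
    qed
    have "((\<lambda>u. C * M * \<bar>u - t\<bar>) \<longlongrightarrow> C * M * \<bar>t - t\<bar>) (at t within {0..1})" by (intro tendsto_intros)
    then show "((\<lambda>u. C * M * \<bar>u - t\<bar>) \<longlongrightarrow> 0) (at t within {0..1})" by simp
  qed
  then show "\<exists>g'. (\<forall>x\<in>{0..1}. (v has_vector_derivative g' x) (at x within {0..1})) \<and> (\<exists>F. symbol F \<and> g' = ?N F)"
    using symbol_Dt[OF F] unfolding has_real_derivative_iff_has_vector_derivative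
    by (intro exI[of _ "?N (Dt F)"] conjI ballI exI[of _ "Dt F"]) auto
qed (use F in blast)

section \<open>The formal quasi-mode\<close>

text \<open>The shifted oscillator \<open>- d^2 + \<alpha>^2 s^2 - (2j + 1) \<alpha>\<close>,
  conjugated by \<open>exp (- \<alpha> s^2 / 2)\<close> and acting on polynomials.\<close>

definition hermite_op :: "real \<Rightarrow> nat \<Rightarrow> real poly \<Rightarrow> real poly" where
  "hermite_op \<alpha> j p = - pderiv (pderiv p) + smult (2 * \<alpha>) (pCons 0 (pderiv p) - smult (real j) p)"

text \<open>The operator is triangular in the monomial basis: a diagonal entry that for
  \<open>\<alpha> > 0\<close> vanishes only at \<open>k = j\<close>, and one entry coming from
  degree \<open>k + 2\<close>. All solvability statements rest on this shape.\<close>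

lemma coeff_hermite_op:
  "coeff (hermite_op \<alpha> j p) k = 2 * \<alpha> * (real k - real j) * coeff p k - real ((k + 1) * (k + 2)) * coeff p (k + 2)"
proof -
  have "coeff (pCons 0 (pderiv p)) k = real k * coeff p k"
    by (cases k) (auto simp: coeff_pderiv)
  then show ?thesis
    by (simp add: hermite_op_def coeff_pderiv algebra_simps)
qed

lemma hermite_op_add: "hermite_op \<alpha> j (p + q) = hermite_op \<alpha> j p + hermite_op \<alpha> j q"
  by (rule poly_eqI) (simp add: coeff_hermite_op algebra_simps)

lemma hermite_op_diff: "hermite_op \<alpha> j (p - q) = hermite_op \<alpha> j p - hermite_op \<alpha> j q"
  by (rule poly_eqI) (simp add: coeff_hermite_op algebra_simps)

lemma hermite_op_peel:
  assumes "\<alpha> > 0" "n \<noteq> j" "\<And>k. k \<ge> Suc n \<Longrightarrow> coeff F k = 0"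
  shows "k \<ge> n \<Longrightarrow> coeff (F - hermite_op \<alpha> j (monom (coeff F n / (2 * \<alpha> * (real n - real j))) n)) k = 0"
  using assms by (cases "k = n") (auto simp: coeff_hermite_op)

text \<open>Leading coefficients are eliminated one after the other; below degree \<open>j\<close>
  no diagonal entry vanishes.\<close>

lemma hermite_op_solve_below:
  assumes "\<alpha> > 0" "n \<le> j" "\<And>k. k \<ge> n \<Longrightarrow> coeff F k = 0"
  shows "\<exists>p. (\<forall>k\<ge>n. coeff p k = 0) \<and> hermite_op \<alpha> j p = F"
  using assms(2,3)
proof (induction n arbitrary: F)
  case 0
  then have "F = 0" by (intro poly_eqI) auto
  then show ?case by (intro exI[of _ 0]) (auto simp: hermite_op_def)
next
  case (Suc n)
  let ?q = "monom (coeff F n / (2 * \<alpha> * (real n - real j))) n"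
  have "\<exists>p. (\<forall>k\<ge>n. coeff p k = 0) \<and> hermite_op \<alpha> j p = F - hermite_op \<alpha> j ?q"
    using Suc.prems by (intro Suc.IH hermite_op_peel assms(1)) auto
  then obtain p where "\<forall>k\<ge>n. coeff p k = 0" "hermite_op \<alpha> j p = F - hermite_op \<alpha> j ?q" by blast
  then show ?case by (intro exI[of _ "p + ?q"]) (auto simp: hermite_op_add)
qed

text \<open>The monic Hermite polynomial of degree \<open>j\<close>, up to scaling of the variable.
  As the diagonal entry at \<open>j\<close> is zero, the image of \<open>s ^ j\<close> has degree
  below \<open>j\<close>, where it can be corrected.\<close>

lemma hermite_op_kernel:
  assumes "\<alpha> > 0"
  obtains H where "hermite_op \<alpha> j H = 0" "coeff H j = 1" "\<And>k. k > j \<Longrightarrow> coeff H k = 0"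
proof -
  have "\<exists>p. (\<forall>k\<ge>j. coeff p k = 0) \<and> hermite_op \<alpha> j p = hermite_op \<alpha> j (monom 1 j)"
    by (intro hermite_op_solve_below assms) (auto simp: coeff_hermite_op)
  then obtain p where p: "\<And>k. k \<ge> j \<Longrightarrow> coeff p k = 0" "hermite_op \<alpha> j p = hermite_op \<alpha> j (monom 1 j)" by blast
  show ?thesis
    by (rule that[of "monom 1 j - p"]) (auto simp: hermite_op_diff p)
qed

text \<open>A Fredholm alternative by elimination instead of orthogonality: degree \<open>j\<close>
  is the only one where the operator cannot remove a leading coefficient, and there a multiple of
  \<open>H\<close> removes it. That multiple becomes the eigenvalue correction.\<close>

lemma hermite_op_solvable:
  assumes \<alpha>: "\<alpha> > 0" and H: "coeff H j = 1" "\<And>k. k > j \<Longrightarrow> coeff H k = 0"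
  shows "\<exists>p e. hermite_op \<alpha> j p = F + smult e H"
proof -
  have "\<exists>p e. hermite_op \<alpha> j p = F + smult e H" if "\<And>k. k \<ge> n \<Longrightarrow> coeff F k = 0" for n
    using that
  proof (induction n arbitrary: F)
    case 0
    then have "F = 0" by (intro poly_eqI) auto
    then show ?case by (intro exI[of _ 0]) (auto simp: hermite_op_def)
  next
    case (Suc n)
    show ?case
    proof (cases "n = j")
      case True
      have "\<exists>p e. hermite_op \<alpha> j p = (F - smult (coeff F j) H) + smult e H"
      proof (rule Suc.IH)
        fix k assume "k \<ge> n"
        then show "coeff (F - smult (coeff F j) H) k = 0"
          using Suc.prems[of k] H True by (cases "k = n") auto
      qed
      then obtain p e where "hermite_op \<alpha> j p = (F - smult (coeff F j) H) + smult e H" by blast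
      then have "hermite_op \<alpha> j p = F + smult (e - coeff F j) H" by (simp add: smult_diff_left)
      then show ?thesis by blast
    next
      case False
      let ?q = "monom (coeff F n / (2 * \<alpha> * (real n - real j))) n"
      have "\<exists>p e. hermite_op \<alpha> j p = (F - hermite_op \<alpha> j ?q) + smult e H"
        using Suc.prems by (intro Suc.IH hermite_op_peel \<alpha> False) auto
      then obtain p e where "hermite_op \<alpha> j p = (F - hermite_op \<alpha> j ?q) + smult e H" by blast
      then have "hermite_op \<alpha> j (p + ?q) = F + smult e H" by (simp add: hermite_op_add)
      then show ?thesis by blast
    qed
  qed
  from this[of "Suc (degree F)"] show ?thesis by (simp add: coeff_eq_0)
qed

definition fps_gauss_deriv :: "real \<Rightarrow> real poly fps \<Rightarrow> real poly fps" where
  "fps_gauss_deriv \<alpha> f = Abs_fps (\<lambda>k. pderiv (fps_nth f k)) - fps_const [:0, \<alpha>:] * f"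

lemma fps_nth_gauss_deriv:
  "fps_nth (fps_gauss_deriv \<alpha> f) k = pderiv (fps_nth f k) - [:0, \<alpha>:] * fps_nth f k"
  by (simp add: fps_gauss_deriv_def)

lemma has_taylor_gauss_deriv:
  assumes "has_taylor F f"
  shows "has_taylor (gauss_deriv \<alpha> F) (fps_gauss_deriv \<alpha> f)"
proof -
  have "has_taylor (\<lambda>t s. \<alpha> * s) (fps_const [:0, \<alpha>:])"
    using has_taylor_poly[of "[:0, \<alpha>:]"] by (simp add: mult.commute)
  then show ?thesis
    unfolding gauss_deriv_def fps_gauss_deriv_def
    by (intro has_taylor_diff has_taylor_Ds has_taylor_mult assms)
qed

lemma gauss_deriv_twice_eq_hermite_op:
  "- (pderiv (pderiv p - [:0, \<alpha>:] * p) - [:0, \<alpha>:] * (pderiv p - [:0, \<alpha>:] * p)) + [:0, 0, \<alpha>\<^sup>2:] * p -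
     smult ((2 * real j + 1) * \<alpha>) p = hermite_op \<alpha> j p" (is "?l = ?r")
proof -
  have "poly ?l x = poly ?r x" for x
    by (simp add: pderiv_diff pderiv_mult pderiv_pCons pderiv_smult hermite_op_def algebra_simps power2_eq_square)
  then show ?thesis by (simp add: poly_eq_poly_eq_iff[symmetric] fun_eq_iff)
qed

lemma fps_mult_nth_cong:
  assumes "\<And>i. i \<le> k \<Longrightarrow> fps_nth f i = fps_nth f' i" "\<And>i. i \<le> k \<Longrightarrow> fps_nth g i = fps_nth g' i"
  shows "fps_nth (f * g) k = fps_nth (f' * g') k"
  unfolding fps_mult_nth using assms by (intro sum.cong) auto

text \<open>Order by order in \<open>t\<close>, a polynomial and an eigenvalue correction are chosen so that the
  right-hand side lies in the range of the Hermite operator.\<close>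

lemma formal_quasi_mode:
  fixes A\<^sub>1 A\<^sub>2 A\<^sub>3 A\<^sub>4 :: "real poly fps"
  assumes \<alpha>: "\<alpha> > 0" and a: "a \<noteq> 0"
  obtains f e where "fps_nth f 0 \<noteq> 0" "e 0 = (2 * real j + 1) * \<alpha>"
    "fps_const [:a:] * (- fps_gauss_deriv \<alpha> (fps_gauss_deriv \<alpha> f) + fps_const [:0, 0, \<alpha>\<^sup>2:] * f - Abs_fps (\<lambda>k. [:e k:]) * f) +
     fps_X * (- (A\<^sub>1 * fps_gauss_deriv \<alpha> (fps_gauss_deriv \<alpha> f)) - A\<^sub>2 * fps_gauss_deriv \<alpha> f + A\<^sub>3 * f - A\<^sub>4 * (Abs_fps (\<lambda>k. [:e k:]) * f)) = 0"
proof -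
  obtain H where H: "hermite_op \<alpha> j H = 0" "coeff H j = 1" "\<And>k. k > j \<Longrightarrow> coeff H k = 0"
    using hermite_op_kernel[OF \<alpha>, of j] by blast
  define G where "G = fps_gauss_deriv \<alpha>"
  define fs es where "fs = (\<lambda>q :: nat \<Rightarrow> real poly \<times> real. Abs_fps (\<lambda>k. fst (q k)))"
    and "es = (\<lambda>q :: nat \<Rightarrow> real poly \<times> real. Abs_fps (\<lambda>k. [:snd (q k):]))"
  \<comment> \<open>\<open>S\<close> will be multiplied by \<open>fps_X\<close>, so order
    \<open>l\<close> sees only its coefficient \<open>l - 1\<close>, and by \<open>S_cong\<close>
    this depends only on data of index below \<open>l\<close>: the recursion is well
    founded.\<close>
  define S where "S = (\<lambda>q. - (A\<^sub>1 * G (G (fs q))) - A\<^sub>2 * G (fs q) + A\<^sub>3 * fs q - A\<^sub>4 * (es q * fs q))"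
  have S_cong: "fps_nth (S q) k = fps_nth (S q') k" if "\<And>i. i \<le> k \<Longrightarrow> q i = q' i" for q q' k
  proof -
    have f: "fps_nth (fs q) i = fps_nth (fs q') i" and e: "fps_nth (es q) i = fps_nth (es q') i" if "i \<le> k" for i
      using \<open>\<And>i. i \<le> k \<Longrightarrow> q i = q' i\<close> that by (auto simp: fs_def es_def)
    then have g: "fps_nth (G (fs q)) i = fps_nth (G (fs q')) i" "fps_nth (G (G (fs q))) i = fps_nth (G (G (fs q'))) i" if "i \<le> k" for i
      using that by (auto simp: G_def fps_nth_gauss_deriv)
    have ef: "fps_nth (es q * fs q) i = fps_nth (es q' * fs q') i" if "i \<le> k" for i
      using f e that by (intro fps_mult_nth_cong) auto
    have "fps_nth (A\<^sub>1 * G (G (fs q))) k = fps_nth (A\<^sub>1 * G (G (fs q'))) k" "fps_nth (A\<^sub>2 * G (fs q)) k = fps_nth (A\<^sub>2 * G (fs q')) k"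
      "fps_nth (A\<^sub>3 * fs q) k = fps_nth (A\<^sub>3 * fs q') k" "fps_nth (A\<^sub>4 * (es q * fs q)) k = fps_nth (A\<^sub>4 * (es q' * fs q')) k"
      by (intro fps_mult_nth_cong refl f g ef; assumption)+
    then show ?thesis by (simp only: S_def fps_sub_nth fps_add_nth fps_neg_nth)
  qed
  \<comment> \<open>The two end terms of the convolution of eigenvalue and amplitude are split off:
    the one with the leading eigenvalue completes \<open>hermite_op\<close>, the one with the
    leading amplitude is the free multiple of \<open>H\<close>. The interior sum is already
    known.\<close>
  define P where "P = (\<lambda>q l r. if l = 0 then r = (H, (2 * real j + 1) * \<alpha>) else
      smult a (hermite_op \<alpha> j (fst r) - smult (snd r) H - (\<Sum>i\<in>{1..<l}. smult (snd (q i)) (fst (q (l - i))))) +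
      fps_nth (S q) (l - 1) = 0)"
  have "\<exists>q. \<forall>l. P q l (q l)"
  proof (rule dependent_wellorder_choice)
    fix r and q q' :: "nat \<Rightarrow> real poly \<times> real" and l assume qq: "\<And>i. i < l \<Longrightarrow> q i = q' i"
    have "(\<Sum>i\<in>{1..<l}. smult (snd (q i)) (fst (q (l - i)))) = (\<Sum>i\<in>{1..<l}. smult (snd (q' i)) (fst (q' (l - i))))"
      using qq by (intro sum.cong) auto
    moreover have "fps_nth (S q) (l - 1) = fps_nth (S q') (l - 1)" if "l > 0"
      using qq that by (intro S_cong) auto
    ultimately show "P q l r = P q' l r" by (simp add: P_def)
  next
    fix l and q :: "nat \<Rightarrow> real poly \<times> real"
    show "\<exists>r. P q l r"
    proof (cases "l = 0")
      case False
      let ?s = "\<Sum>i\<in>{1..<l}. smult (snd (q i)) (fst (q (l - i)))"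
      obtain p e where pe: "hermite_op \<alpha> j p = (?s - smult (1 / a) (fps_nth (S q) (l - 1))) + smult e H"
        using hermite_op_solvable[OF \<alpha> H(2,3)] by blast
      have "smult a (hermite_op \<alpha> j p - smult e H - ?s) + fps_nth (S q) (l - 1) = 0"
        unfolding pe using a by (simp add: smult_diff_right)
      then show ?thesis using False by (intro exI[of _ "(p, e)"]) (simp add: P_def)
    qed (auto simp: P_def)
  qed
  then obtain q where q: "\<And>l. P q l (q l)" by blast
  define f e where "f = fs q" and "e = (\<lambda>k. snd (q k))"
  have E: "es q = Abs_fps (\<lambda>k. [:e k:])" by (simp add: es_def e_def)
  have q0: "q 0 = (H, (2 * real j + 1) * \<alpha>)" using q[of 0] by (simp add: P_def)
  have main: "fps_nth (fps_const [:a:] * (- G (G f) + fps_const [:0, 0, \<alpha>\<^sup>2:] * f - es q * f) + fps_X * S q) l = 0" for l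
  proof -
    let ?p = "fst (q l)"
    have fl: "fps_nth f l = ?p" by (simp add: f_def fs_def)
    have conv: "fps_nth (es q * f) l = (\<Sum>i=0..l. smult (snd (q i)) (fst (q (l - i))))"
      by (simp add: fps_mult_nth es_def f_def fs_def)
    have herm: "- fps_nth (G (G f)) l + [:0, 0, \<alpha>\<^sup>2:] * ?p - smult ((2 * real j + 1) * \<alpha>) ?p = hermite_op \<alpha> j ?p"
      using gauss_deriv_twice_eq_hermite_op[of ?p \<alpha> j] by (simp only: G_def fps_nth_gauss_deriv fl)
    have nth: "fps_nth (fps_const [:a:] * (- G (G f) + fps_const [:0, 0, \<alpha>\<^sup>2:] * f - es q * f) + fps_X * S q) l =
      smult a (- fps_nth (G (G f)) l + [:0, 0, \<alpha>\<^sup>2:] * ?p - (\<Sum>i=0..l. smult (snd (q i)) (fst (q (l - i))))) +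
      (if l = 0 then 0 else fps_nth (S q) (l - 1))"
      by (simp only: fps_add_nth fps_mult_left_const_nth fps_sub_nth fps_neg_nth fl conv fps_X_mult_nth) simp
    show ?thesis
    proof (cases "l = 0")
      case True
      with herm show ?thesis unfolding nth by (simp add: q0 H)
    next
      case False
      have "(\<Sum>i=0..l. smult (snd (q i)) (fst (q (l - i)))) =
          smult ((2 * real j + 1) * \<alpha>) ?p + (\<Sum>i\<in>{1..<l}. smult (snd (q i)) (fst (q (l - i)))) + smult (snd (q l)) H"
      proof -
        have "{0..l} = insert 0 (insert l {1..<l})" using False by auto
        then show ?thesis using False by (simp add: q0)
      qed
      then have "- fps_nth (G (G f)) l + [:0, 0, \<alpha>\<^sup>2:] * ?p - (\<Sum>i=0..l. smult (snd (q i)) (fst (q (l - i)))) =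
          hermite_op \<alpha> j ?p - smult (snd (q l)) H - (\<Sum>i\<in>{1..<l}. smult (snd (q i)) (fst (q (l - i))))"
        unfolding herm[symmetric] by simp
      then show ?thesis unfolding nth using q[of l] False by (simp add: P_def)
    qed
  qed
  have "fps_nth f 0 \<noteq> 0" using q0 H(2) by (auto simp: f_def fs_def)
  moreover have "e 0 = (2 * real j + 1) * \<alpha>" by (simp add: e_def q0)
  moreover have "fps_const [:a:] * (- G (G f) + fps_const [:0, 0, \<alpha>\<^sup>2:] * f - es q * f) + fps_X * S q = 0"
    by (rule fps_ext) (simp only: main fps_zero_nth)
  ultimately show ?thesis
    using that[of f e] unfolding S_def E G_def f_def[symmetric] by blast
qed

section \<open>Weak derivatives of test functions\<close>

lemma test_functionE:
  assumes "test_function U f"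
  obtains K where "smooth_on UNIV f" "compact K" "K \<subseteq> U" "\<And>x. x \<notin> K \<Longrightarrow> f x = 0"
  using assms unfolding test_function_def by blast

lemma test_function_has_derivative:
  "test_function U f \<Longrightarrow> (f has_derivative frechet_derivative f (at x)) (at x)"
  using smooth_on_frechet_derivative(2)[of UNIV f x] unfolding test_function_def by auto

lemma test_function_deriv:
  assumes "test_function U (f :: 'a::real_normed_vector \<Rightarrow> 'b::real_normed_vector)"
  shows "test_function U (\<lambda>x. frechet_derivative f (at x) b)"
proof -
  obtain K where K: "smooth_on UNIV f" "compact K" "K \<subseteq> U" "\<And>x. x \<notin> K \<Longrightarrow> f x = 0"
    by (rule test_functionE[OF assms]) (rule that)
  have "frechet_derivative f (at x) b = 0" if "x \<notin> K" for x
  proof -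
    have "(f has_derivative (\<lambda>_. 0)) (at x)"
      by (rule has_derivative_transform_within_open[of "\<lambda>_. 0" _ _ _ "- K"])
        (use K that compact_imp_closed in auto)
    then show ?thesis by (simp flip: frechet_derivative_at)
  qed
  with K show ?thesis
    unfolding test_function_def using smooth_on_frechet_derivative(1)[of UNIV f b] by auto
qed

lemma test_function_continuous: "test_function U f \<Longrightarrow> continuous_on S f"
  by (meson continuous_on_subset smooth_on_continuous_on subset_UNIV test_function_def)

lemma test_function_integrable:
  fixes f :: "'a::euclidean_space \<Rightarrow> 'b::{banach, second_countable_topology}"
  assumes "test_function U f"
  shows "integrable lborel f"
proof -
  obtain K where K: "smooth_on UNIV f" "compact K" "K \<subseteq> U" "\<And>x. x \<notin> K \<Longrightarrow> f x = 0"
    by (rule test_functionE[OF assms]) (rule that)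
  have "integrable lborel (\<lambda>x. indicator K x *\<^sub>R f x)"
    by (rule borel_integrable_compact[OF K(2) test_function_continuous[OF assms]])
  moreover have "(\<lambda>x. indicator K x *\<^sub>R f x) = f" using K(4) by (auto simp: indicator_def)
  ultimately show ?thesis by simp
qed

lemma test_function_scaleR:
  assumes "test_function U (\<phi> :: _ \<Rightarrow> real)" "smooth_on UNIV u"
  shows "test_function U (\<lambda>x. \<phi> x *\<^sub>R u x)"
  using assms unfolding test_function_def by (auto intro: smooth_on_scaleR)

text \<open>Lebesgue measure is translation invariant, so every difference quotient integrates to
  zero; dominated convergence carries this to the derivative.\<close>

lemma integral_directional_derivative_eq_0:
  fixes f :: "'a::euclidean_space \<Rightarrow> complex"
  assumes f: "test_function U f"
  shows "(LINT x|lborel. frechet_derivative f (at x) b) = 0"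
proof -
  let ?g = "\<lambda>x. frechet_derivative f (at x) b"
  obtain K where K: "smooth_on UNIV f" "compact K" "K \<subseteq> U" "\<And>x. x \<notin> K \<Longrightarrow> f x = 0"
    by (rule test_functionE[OF f]) (rule that)
  obtain L where L: "compact L" "\<And>x. x \<notin> L \<Longrightarrow> ?g x = 0"
    using test_functionE[OF test_function_deriv[OF f, of b]] by metis
  have "bounded (?g ` L)"
    by (intro compact_imp_bounded compact_continuous_image test_function_continuous[OF test_function_deriv[OF f]] L)
  then obtain B where B: "\<forall>x\<in>L. norm (?g x) \<le> B" unfolding bounded_iff by blast
  have gB: "norm (?g x) \<le> \<bar>B\<bar>" for x using B L(2)[of x] by (cases "x \<in> L") fastforce+
  obtain r where r: "\<And>x. x \<in> K \<Longrightarrow> norm x \<le> r" using compact_imp_bounded[OF K(2)] unfolding bounded_iff by blast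
  have lin: "((\<lambda>h. f (x + h *\<^sub>R b)) has_vector_derivative ?g (x + h *\<^sub>R b)) (at h)" for x h
  proof -
    have "((\<lambda>h. f (x + h *\<^sub>R b)) has_derivative (\<lambda>k. frechet_derivative f (at (x + h *\<^sub>R b)) (k *\<^sub>R b))) (at h)"
      by (rule has_derivative_compose[OF _ test_function_has_derivative[OF f], unfolded o_def])
        (auto intro!: derivative_eq_intros)
    moreover have "frechet_derivative f (at y) (k *\<^sub>R b) = k *\<^sub>R ?g y" for y k
      using linear_scale[OF has_derivative_linear[OF test_function_has_derivative[OF f]]] by blast
    ultimately show ?thesis by (simp add: has_vector_derivative_def)
  qed
  define q where "q = (\<lambda>(n::nat) x. real (Suc n) *\<^sub>R (f (x + (1 / real (Suc n)) *\<^sub>R b) - f x))"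
  have trans: "(LINT x|lborel. f (x + c)) = (LINT x|lborel. f x)" for c
  proof -
    have "(LINT x|lborel. f x) = (LINT x|distr lborel borel ((+) c). f x)" by (simp add: lborel_distr_plus)
    also have "\<dots> = (LINT x|lborel. f (c + x))"
      by (rule integral_distr) (auto intro!: borel_measurable_continuous_onI test_function_continuous[OF f])
    finally show ?thesis by (simp add: add.commute)
  qed
  have int: "integrable lborel (\<lambda>x. f (x + c))" for c
  proof -
    have "integrable (distr lborel borel ((+) c)) f" using test_function_integrable[OF f] by (simp add: lborel_distr_plus)
    then have "integrable lborel (\<lambda>x. f (c + x))" by (rule integrable_distr[rotated]) auto
    then show ?thesis by (simp add: add.commute)
  qed
  have q0: "(LINT x|lborel. q n x) = 0" for n
    unfolding q_def using int[of 0] int[of "(1 / real (Suc n)) *\<^sub>R b"] trans by simp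
  have "(\<lambda>n. LINT x|lborel. q n x) \<longlonglongrightarrow> (LINT x|lborel. ?g x)"
  proof (rule integral_dominated_convergence)
    show "?g \<in> borel_measurable lborel"
      using borel_measurable_integrable[OF test_function_integrable[OF test_function_deriv[OF f]]] .
    show "q n \<in> borel_measurable lborel" for n
      unfolding q_def using borel_measurable_integrable[OF int] borel_measurable_integrable[OF int[of 0]] by simp
    \<comment> \<open>The quotients are bounded by \<open>|B|\<close>, and steps of length at most
      \<open>norm b\<close> keep their supports in this larger ball.\<close>
    show "integrable lborel (\<lambda>x. indicator (cball (0::'a) (r + norm b)) x * \<bar>B\<bar>)"
      using borel_integrable_compact[of "cball (0::'a) (r + norm b)" "\<lambda>_. \<bar>B\<bar>"] by simp
    show "AE x in lborel. (\<lambda>n. q n x) \<longlonglongrightarrow> ?g x"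
    proof (rule AE_I2)
      fix x
      have "((\<lambda>h. (f (x + h *\<^sub>R b) - f x) /\<^sub>R h) \<longlongrightarrow> ?g x) (at 0)"
      proof (rule LIM_zero_cancel, rule tendsto_norm_zero_cancel, rule Lim_transform_eventually)
        show "((\<lambda>h. norm (f (x + h *\<^sub>R b) - f x - h *\<^sub>R ?g x) / norm h) \<longlongrightarrow> 0) (at 0)"
          using lin[of x 0] by (simp add: has_vector_derivative_def has_derivative_at)
        have "norm (f (x + h *\<^sub>R b) - f x - h *\<^sub>R ?g x) / norm h = norm ((f (x + h *\<^sub>R b) - f x) /\<^sub>R h - ?g x)" if "h \<noteq> 0" for h
        proof -
          have "f (x + h *\<^sub>R b) - f x - h *\<^sub>R ?g x = h *\<^sub>R ((f (x + h *\<^sub>R b) - f x) /\<^sub>R h - ?g x)"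
            using that by (simp add: scaleR_right_diff_distrib)
          then show ?thesis using that by simp
        qed
        then show "\<forall>\<^sub>F h in at 0. norm (f (x + h *\<^sub>R b) - f x - h *\<^sub>R ?g x) / norm h = norm ((f (x + h *\<^sub>R b) - f x) /\<^sub>R h - ?g x)"
          by (auto simp: eventually_at_filter)
      qed
      moreover have "filterlim (\<lambda>n. 1 / real (Suc n)) (at 0) sequentially"
        using LIMSEQ_inverse_real_of_nat by (auto simp: filterlim_at inverse_eq_divide)
      ultimately have "(\<lambda>n. (f (x + (1 / real (Suc n)) *\<^sub>R b) - f x) /\<^sub>R (1 / real (Suc n))) \<longlonglongrightarrow> ?g x"
        by (rule filterlim_compose)
      then show "(\<lambda>n. q n x) \<longlonglongrightarrow> ?g x" by (simp add: q_def inverse_eq_divide)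
    qed
    fix n
    show "AE x in lborel. norm (q n x) \<le> indicator (cball 0 (r + norm b)) x * \<bar>B\<bar>"
    proof (rule AE_I2)
      fix x
      let ?h = "1 / real (Suc n)"
      have h: "0 < ?h" "?h \<le> 1" by auto
      show "norm (q n x) \<le> indicator (cball 0 (r + norm b)) x * \<bar>B\<bar>"
      proof (cases "norm x \<le> r + norm b")
        case True
        have "norm (f (x + ?h *\<^sub>R b) - f (x + 0 *\<^sub>R b)) \<le> \<bar>B\<bar> * norm (?h - 0)"
        proof (rule differentiable_bound[where S = UNIV and f' = "\<lambda>h k. k *\<^sub>R ?g (x + h *\<^sub>R b)"])
          show "((\<lambda>h. f (x + h *\<^sub>R b)) has_derivative (\<lambda>k. k *\<^sub>R ?g (x + h *\<^sub>R b))) (at h within UNIV)" for h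
            using lin by (simp add: has_vector_derivative_def)
          show "onorm (\<lambda>k. k *\<^sub>R ?g (x + h *\<^sub>R b)) \<le> \<bar>B\<bar>" for h :: real
            using gB[of "x + h *\<^sub>R b"] by (intro onorm_le) (auto simp: mult.commute[of "\<bar>B\<bar>"] intro: mult_left_mono)
        qed auto
        then have "norm (q n x) \<le> real (Suc n) * (\<bar>B\<bar> * ?h)"
          unfolding q_def norm_scaleR by (intro mult_mono) auto
        also have "\<dots> = \<bar>B\<bar>" by simp
        finally show ?thesis using True by simp
      next
        case False
        have "norm (?h *\<^sub>R b) \<le> norm b" using h mult_right_mono[of ?h 1 "norm b"] by simp
        then have "norm x - norm b \<le> norm (x + ?h *\<^sub>R b)" using norm_diff_ineq[of x "?h *\<^sub>R b"] by linarith
        then have "x + ?h *\<^sub>R b \<notin> K" "x \<notin> K" using r False norm_ge_zero[of b] by fastforce+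
        then show ?thesis by (simp add: q_def K(4))
      qed
    qed
  qed
  then show ?thesis unfolding q0 using LIMSEQ_const_iff by metis
qed

lemma test_function_L2_on:
  fixes f :: "'a::euclidean_space \<Rightarrow> complex"
  assumes "test_function V f" "U \<in> sets borel"
  shows "L2_on U f"
proof -
  obtain K where K: "compact K" "\<And>x. x \<notin> K \<Longrightarrow> f x = 0"
    using test_functionE[OF assms(1)] by metis
  have "integrable lborel (\<lambda>x. indicator K x *\<^sub>R (norm (f x))\<^sup>2)"
    by (intro borel_integrable_compact K continuous_intros test_function_continuous[OF assms(1)])
  moreover have "(\<lambda>x. indicator K x *\<^sub>R (norm (f x))\<^sup>2) = (\<lambda>x. (norm (f x))\<^sup>2)"
  proof
    fix x
    show "indicator K x *\<^sub>R (norm (f x))\<^sup>2 = (norm (f x))\<^sup>2" using K(2)[of x] by (cases "x \<in> K") auto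
  qed
  ultimately have "integrable lborel (\<lambda>x. (norm (f x))\<^sup>2)" by simp
  then have "set_integrable lborel U (\<lambda>x. (norm (f x))\<^sup>2)"
    unfolding set_integrable_def using assms(2) by (intro integrable_mult_indicator) auto
  moreover have "f \<in> borel_measurable borel"
    using test_function_continuous[OF assms(1)] by (rule borel_measurable_continuous_onI)
  then have "set_borel_measurable lborel U f"
    using assms(2) unfolding set_borel_measurable_def by simp
  ultimately show ?thesis by (simp add: L2_on_def)
qed

lemma integration_by_parts_test_function:
  fixes u :: "'a::euclidean_space \<Rightarrow> complex"
  assumes u: "test_function V u" and \<phi>: "test_function U (\<phi> :: 'a \<Rightarrow> real)"
  shows "(LINT x|lborel. frechet_derivative \<phi> (at x) b *\<^sub>R u x) = - (LINT x|lborel. \<phi> x *\<^sub>R frechet_derivative u (at x) b)"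
    and "integrable lborel (\<lambda>x. frechet_derivative \<phi> (at x) b *\<^sub>R u x)"
    and "integrable lborel (\<lambda>x. \<phi> x *\<^sub>R frechet_derivative u (at x) b)"
proof -
  have su: "smooth_on UNIV u" "smooth_on UNIV (\<lambda>x. frechet_derivative u (at x) b)"
    using u test_function_deriv[OF u, of b] unfolding test_function_def by auto
  show int: "integrable lborel (\<lambda>x. frechet_derivative \<phi> (at x) b *\<^sub>R u x)"
    "integrable lborel (\<lambda>x. \<phi> x *\<^sub>R frechet_derivative u (at x) b)"
    by (rule test_function_integrable[OF test_function_scaleR[OF test_function_deriv[OF \<phi>] su(1)]],
      rule test_function_integrable[OF test_function_scaleR[OF \<phi> su(2)]])
  have "frechet_derivative (\<lambda>x. \<phi> x *\<^sub>R u x) (at x) b = \<phi> x *\<^sub>R frechet_derivative u (at x) b + frechet_derivative \<phi> (at x) b *\<^sub>R u x" for x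
    by (rule fun_cong[OF frechet_derivative_at[OF has_derivative_scaleR[OF test_function_has_derivative[OF \<phi>]
      test_function_has_derivative[OF u]]], symmetric])
  then have "0 = (LINT x|lborel. \<phi> x *\<^sub>R frechet_derivative u (at x) b + frechet_derivative \<phi> (at x) b *\<^sub>R u x)"
    using integral_directional_derivative_eq_0[OF test_function_scaleR[OF \<phi> su(1)], of b] by simp
  also have "\<dots> = (LINT x|lborel. \<phi> x *\<^sub>R frechet_derivative u (at x) b) + (LINT x|lborel. frechet_derivative \<phi> (at x) b *\<^sub>R u x)"
    by (rule Bochner_Integration.integral_add[OF int(2,1)])
  finally show "(LINT x|lborel. frechet_derivative \<phi> (at x) b *\<^sub>R u x) = - (LINT x|lborel. \<phi> x *\<^sub>R frechet_derivative u (at x) b)"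
    by (simp add: eq_neg_iff_add_eq_0 add.commute)
qed

lemma weak_partial_test_function:
  fixes u :: "'a::euclidean_space \<Rightarrow> complex"
  assumes u: "test_function V u" and U: "open U"
  shows "weak_partial U b u (\<lambda>x. frechet_derivative u (at x) b)"
  unfolding weak_partial_def
proof (intro conjI allI impI)
  have "U \<in> sets borel" using U by simp
  then show "L2_on U u" "L2_on U (\<lambda>x. frechet_derivative u (at x) b)"
    using u test_function_deriv[OF u] by (auto intro: test_function_L2_on)
  fix \<phi> :: "'a \<Rightarrow> real" assume \<phi>: "test_function U \<phi>"
  have zero: "\<psi> x = 0" if "test_function U \<psi>" "x \<notin> U" for \<psi> :: "'a \<Rightarrow> real" and x
    using that unfolding test_function_def by blast
  have "(LINT x:U|lborel. frechet_derivative \<phi> (at x) b *\<^sub>R u x) = (LINT x|lborel. frechet_derivative \<phi> (at x) b *\<^sub>R u x)"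
    unfolding set_lebesgue_integral_def
    by (rule Bochner_Integration.integral_cong) (use zero[OF test_function_deriv[OF \<phi>]] in \<open>auto simp: indicator_def\<close>)
  moreover have "(LINT x:U|lborel. \<phi> x *\<^sub>R frechet_derivative u (at x) b) = (LINT x|lborel. \<phi> x *\<^sub>R frechet_derivative u (at x) b)"
    unfolding set_lebesgue_integral_def
    by (rule Bochner_Integration.integral_cong) (use zero[OF \<phi>] in \<open>auto simp: indicator_def\<close>)
  ultimately show "(LINT x:U|lborel. frechet_derivative \<phi> (at x) b *\<^sub>R u x) = - (LINT x:U|lborel. \<phi> x *\<^sub>R frechet_derivative u (at x) b)"
    using integration_by_parts_test_function(1)[OF u \<phi>] by simp
qed

lemma sobolev_test_function:
  fixes u :: "'a::euclidean_space \<Rightarrow> complex"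
  assumes "test_function V u" "open U"
  shows "sobolev k U u"
  using assms(1)
proof (induction k arbitrary: u)
  case (Suc k)
  then show ?case
    using weak_partial_test_function[OF Suc.prems assms(2)] test_function_deriv[OF Suc.prems]
      test_function_L2_on[OF Suc.prems] assms(2) by (auto intro!: exI)
qed (use assms(2) in \<open>auto intro: test_function_L2_on\<close>)

lemma L2_norm_on_zero: "L2_norm_on U (\<lambda>x. 0) = 0"
  by (simp add: L2_norm_on_def)

lemma norm_polar: "norm (polar R \<theta>) = \<bar>R\<bar>"
proof -
  have "(R * cos \<theta>)\<^sup>2 + (R * sin \<theta>)\<^sup>2 = R\<^sup>2"
    by (simp add: power_mult_distrib flip: distrib_left)
  then show ?thesis
    by (simp add: polar_def norm_vec_def L2_set_def sum_2 vector_2)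
qed

text \<open>The compact support lies in the open disk, so \<open>v\<close> vanishes on the circle
  and can serve as its own constant approximating sequence.\<close>

lemma has_trace_zero:
  assumes v: "test_function (ball 0 R) v" "open U"
  shows "has_trace R U v (\<lambda>_. 0)"
proof -
  have "v (polar R \<theta>) = 0" for \<theta>
  proof -
    have "polar R \<theta> \<notin> ball 0 R" by (simp add: norm_polar)
    then show ?thesis using v(1) unfolding test_function_def by blast
  qed
  moreover have "L2_on {0..2*pi} (\<lambda>_. 0)" by (simp add: L2_on_def set_integrable_def set_borel_measurable_def)
  moreover have "test_function UNIV v" using v(1) unfolding test_function_def by auto
  ultimately show ?thesis
    unfolding has_trace_def
    using weak_partial_test_function[OF v]
    by (intro conjI exI[of _ "\<lambda>_. v"]) (auto simp: L2_norm_on_zero intro!: exI[of _ "\<lambda>x. frechet_derivative v (at x) b" for b])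
qed

lemma H2p_test_function:
  assumes u: "test_function (ball 0 R) u"
  shows "H2p R n p u"
proof -
  have o: "open (ball (0::real^2) R)" "open (- cball (0::real^2) R)" by auto
  have tr: "has_normal_trace R U u (\<lambda>_. 0)" if "open U" for U
    unfolding has_normal_trace_def
    using weak_partial_test_function[OF u that] has_trace_zero[OF test_function_deriv[OF u] that]
    by (intro exI[of _ "\<lambda>b x. frechet_derivative u (at x) b"] exI[of _ "\<lambda>_ _. 0"]) auto
  show ?thesis
    unfolding H2p_def
    using sobolev_test_function[OF u o(1)] sobolev_test_function[OF u o(2)] test_function_L2_on[OF u, of UNIV]
      has_trace_zero[OF u o(1)] has_trace_zero[OF u o(2)] tr[OF o(1)] tr[OF o(2)]
    by (intro conjI exI[of _ "\<lambda>_. 0"]) auto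
qed

lemma weak_div_test_function:
  fixes F :: "'a::euclidean_space \<Rightarrow> 'a \<Rightarrow> complex"
  assumes F: "\<And>b. b \<in> Basis \<Longrightarrow> test_function UNIV (F b)"
  shows "weak_div F (\<lambda>x. \<Sum>b\<in>Basis. frechet_derivative (F b) (at x) b)"
  unfolding weak_div_def
proof (intro conjI ballI allI impI)
  show "L2_on UNIV (F b)" if "b \<in> Basis" for b using F[OF that] by (rule test_function_L2_on) auto
  have sum: "test_function UNIV (\<lambda>x. \<Sum>b\<in>A. frechet_derivative (F b) (at x) b)" if "finite A" "A \<subseteq> Basis" for A
    using that
  proof (induction A)
    case empty
    then show ?case by (auto simp: test_function_def intro!: exI[of _ "{}"])
  next
    case (insert b A)
    then obtain K L where "compact K" "compact L"
      "\<And>x. x \<notin> K \<Longrightarrow> (\<Sum>b\<in>A. frechet_derivative (F b) (at x) b) = 0"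
      "\<And>x. x \<notin> L \<Longrightarrow> frechet_derivative (F b) (at x) b = 0"
      "smooth_on UNIV (\<lambda>x. \<Sum>b\<in>A. frechet_derivative (F b) (at x) b)" "smooth_on UNIV (\<lambda>x. frechet_derivative (F b) (at x) b)"
      using test_function_deriv[OF F, of b b] unfolding test_function_def by auto
    note KL = this
    have "test_function UNIV (\<lambda>x. frechet_derivative (F b) (at x) b + (\<Sum>b\<in>A. frechet_derivative (F b) (at x) b))"
      unfolding test_function_def
    proof (intro conjI exI[of _ "K \<union> L"] smooth_on_add KL compact_Un allI impI)
      fix x assume "x \<notin> K \<union> L"
      then show "frechet_derivative (F b) (at x) b + (\<Sum>b\<in>A. frechet_derivative (F b) (at x) b) = 0"
        using KL(3)[of x] KL(4)[of x] by simp
    qed auto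
    then show ?case using insert.hyps by simp
  qed
  show "L2_on UNIV (\<lambda>x. \<Sum>b\<in>Basis. frechet_derivative (F b) (at x) b)"
    by (rule test_function_L2_on[OF sum]) auto
  fix \<phi> :: "'a \<Rightarrow> real" assume \<phi>: "test_function UNIV \<phi>"
  note ibp = integration_by_parts_test_function[OF F \<phi>]
  have "(LINT x|lborel. (\<Sum>b\<in>Basis. frechet_derivative \<phi> (at x) b *\<^sub>R F b x)) =
      (\<Sum>b\<in>Basis. (LINT x|lborel. frechet_derivative \<phi> (at x) b *\<^sub>R F b x))"
    by (rule Bochner_Integration.integral_sum) (rule ibp(2))
  also have "\<dots> = (\<Sum>b\<in>Basis. - (LINT x|lborel. \<phi> x *\<^sub>R frechet_derivative (F b) (at x) b))"
    by (rule sum.cong[OF refl]) (rule ibp(1))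
  also have "\<dots> = - (LINT x|lborel. (\<Sum>b\<in>Basis. \<phi> x *\<^sub>R frechet_derivative (F b) (at x) b))"
    unfolding sum_negf by (subst Bochner_Integration.integral_sum) (auto intro: ibp(3))
  finally show "(LINT x|lborel. (\<Sum>b\<in>Basis. frechet_derivative \<phi> (at x) b *\<^sub>R F b x)) =
      - (LINT x|lborel. \<phi> x *\<^sub>R (\<Sum>b\<in>Basis. frechet_derivative (F b) (at x) b))"
    by (simp add: scaleR_sum_right)
qed

section \<open>Angular modes\<close>

definition to_complex :: "real^2 \<Rightarrow> complex" where
  "to_complex x = of_real (x $ 1) + \<i> * of_real (x $ 2)"

text \<open>The power of \<open>to_complex x\<close> carries the angular factor, so a mode is a
  radial function times a polynomial and can be differentiated in Cartesian coordinates. Its radial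
  profile is \<open>h r * r ^ m\<close>.\<close>

definition mode :: "nat \<Rightarrow> (real \<Rightarrow> real) \<Rightarrow> real^2 \<Rightarrow> complex" where
  "mode m h x = of_real (h (norm x)) * to_complex x ^ m"

lemma bounded_linear_to_complex: "bounded_linear to_complex"
  by (rule linear_conv_bounded_linear[THEN iffD1])
    (auto intro!: linearI simp: to_complex_def complex_eq_iff)

lemma norm_to_complex: "norm (to_complex x) = norm x"
  by (simp add: to_complex_def cmod_def norm_vec_def L2_set_def sum_2)

lemma to_complex_polar: "to_complex (polar r \<theta>) = of_real r * exp (\<i> * of_real \<theta>)"
  by (simp add: to_complex_def polar_def vector_2 exp_Euler cos_of_real sin_of_real algebra_simps)

lemma mode_polar: "r > 0 \<Longrightarrow> mode m h (polar r \<theta>) = of_real (h r * r ^ m) * exp (\<i> * of_nat m * of_real \<theta>)"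
  by (simp add: mode_def norm_polar to_complex_polar power_mult_distrib exp_of_nat_mult[symmetric] mult_ac)

lemma norm_mode: "norm (mode m h x) = \<bar>h (norm x) * norm x ^ m\<bar>"
  by (simp add: mode_def norm_mult norm_power norm_to_complex abs_mult)

lemma compact_annulus: "compact {x :: real^2. r\<^sub>1 \<le> norm x \<and> norm x \<le> r\<^sub>2}"
proof -
  have "{x :: real^2. r\<^sub>1 \<le> norm x \<and> norm x \<le> r\<^sub>2} = cball 0 r\<^sub>2 \<inter> {x. r\<^sub>1 \<le> norm x}" by auto
  moreover have "closed {x :: real^2. r\<^sub>1 \<le> norm x}" by (intro closed_Collect_le continuous_intros)
  ultimately show ?thesis by (simp add: compact_Int_closed)
qed

lemma smooth_on_radial:
  assumes "smooth_on {0<..<R} (A :: real \<Rightarrow> real)"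
  shows "smooth_on {x :: real^2. 0 < norm x \<and> norm x < R} (\<lambda>x. A (norm x))"
  by (rule smooth_on_compose[OF assms smooth_on_subset[OF smooth_on_norm]]) auto

lemma smooth_on_to_complex_power: "smooth_on S (\<lambda>x. to_complex x ^ m)"
  by (intro smooth_on_power smooth_on_bounded_linear bounded_linear_to_complex)

lemma test_function_annulus:
  fixes f :: "real^2 \<Rightarrow> 'b::real_normed_vector"
  assumes "smooth_on {x. 0 < norm x \<and> norm x < R} f" "0 < r\<^sub>1" "r\<^sub>2 < R"
    and "\<And>x. \<not> (r\<^sub>1 \<le> norm x \<and> norm x \<le> r\<^sub>2) \<Longrightarrow> f x = 0"
  shows "test_function (ball 0 R) f"
proof -
  have "open {x :: real^2. 0 < norm x \<and> norm x < R}"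
    by (intro open_Collect_conj open_Collect_less continuous_intros)
  then have "smooth_on UNIV f"
    by (rule smooth_on_UNIV_if_supported[OF assms(1) _ compact_imp_closed[OF compact_annulus[of r\<^sub>1 r\<^sub>2]]])
      (use assms in auto)
  then show ?thesis
    unfolding test_function_def using assms(3,4)
    by (intro conjI exI[of _ "{x. r\<^sub>1 \<le> norm x \<and> norm x \<le> r\<^sub>2}"] compact_annulus) auto
qed

lemma radial_has_derivative:
  fixes x :: "'a::real_inner"
  assumes "x \<noteq> 0" "(q has_real_derivative q') (at (norm x))"
  shows "((\<lambda>x. q (norm x)) has_derivative (\<lambda>k. q' * (x \<bullet> k) / norm x)) (at x)"
proof -
  have "(norm has_derivative (\<lambda>k. k \<bullet> sgn x)) (at x)" by (rule has_derivative_norm[OF assms(1)])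
  from has_derivative_compose[OF this] assms(2)[unfolded has_field_derivative_def]
  have "((\<lambda>x. q (norm x)) has_derivative (\<lambda>k. q' * (k \<bullet> sgn x))) (at x)" by blast
  then show ?thesis by (simp add: sgn_div_norm inner_commute divide_inverse mult_ac)
qed

lemma to_complex_power_has_derivative:
  "((\<lambda>x. to_complex x ^ m) has_derivative (\<lambda>k. of_nat m * to_complex x ^ (m - 1) * to_complex k)) (at x)"
proof -
  have "((\<lambda>x. to_complex x ^ m) has_derivative (\<lambda>k. of_nat m * to_complex k * to_complex x ^ (m - 1))) (at x)"
    by (rule has_derivative_power[OF bounded_linear_imp_has_derivative[OF bounded_linear_to_complex]])
  then show ?thesis by (simp add: mult_ac)
qed

lemma Basis_real2: "(Basis :: (real^2) set) = {axis 1 1, axis 2 1}"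
  by (auto simp: Basis_vec_def) (metis exhaust_2)

lemma sum_Basis_real2: "(\<Sum>b\<in>(Basis :: (real^2) set). f b) = f (axis 1 1) + f (axis 2 1)"
proof -
  have "axis 1 (1::real) \<noteq> (axis 2 1 :: real^2)" by (simp add: axis_eq_axis)
  then show ?thesis by (simp add: Basis_real2)
qed

lemma to_complex_axis: "to_complex (axis 1 1) = 1" "to_complex (axis 2 1) = \<i>"
  by (simp_all add: to_complex_def axis_def)

lemma inner_axis_real2: "x \<bullet> axis 1 1 = x $ 1" "x \<bullet> axis 2 1 = x $ 2" for x :: "real^2"
  by (simp_all add: inner_axis)

lemma norm_sq_real2: "(norm x)\<^sup>2 = (x $ 1)\<^sup>2 + (x $ 2)\<^sup>2" for x :: "real^2"
  by (simp add: norm_vec_def L2_set_def sum_2)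

lemma mode_derivative:
  assumes "x \<noteq> 0" "(h has_real_derivative h') (at (norm x))"
  shows "frechet_derivative (mode m h) (at x) k =
    of_real (h' / norm x * (x \<bullet> k)) * to_complex x ^ m +
    of_real (real m * h (norm x)) * to_complex k * to_complex x ^ (m - 1)"
proof -
  have "(mode m h has_derivative (\<lambda>k. of_real (h (norm x)) * (of_nat m * to_complex x ^ (m - 1) * to_complex k) +
      of_real (h' * (x \<bullet> k) / norm x) * to_complex x ^ m)) (at x)"
    unfolding mode_def[abs_def]
    by (intro has_derivative_mult has_derivative_of_real radial_has_derivative assms to_complex_power_has_derivative)
  from fun_cong[OF frechet_derivative_at[OF this], of k] show ?thesis
    by (simp add: algebra_simps)
qed

text \<open>Both \<open>x\<close>-dependent factors collapse when summed over the basis: \<open>\<Sum> (x \<bullet> b) b = z\<close> and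
  \<open>\<Sum> b\<^sup>2 = 1 + \<i>\<^sup>2 = 0\<close>.\<close>

lemma radial_divergence:
  assumes x: "x \<noteq> 0" and m: "m \<ge> 1"
    and p: "(p has_real_derivative p') (at (norm x))" and q: "(q has_real_derivative q') (at (norm x))"
  defines "F \<equiv> \<lambda>b x. of_real (p (norm x) * (x \<bullet> b)) * to_complex x ^ m + of_real (q (norm x)) * to_complex b * to_complex x ^ (m - 1)"
  shows "(\<Sum>b\<in>Basis. frechet_derivative (F b) (at x) b) =
    of_real (p' * norm x + (2 + real m) * p (norm x) + q' / norm x) * to_complex x ^ m"
proof -
  let ?z = "to_complex x" and ?r = "norm x"
  have D: "frechet_derivative (F b) (at x) b =
      of_real (p ?r * (x \<bullet> b)) * (of_nat m * ?z ^ (m - 1) * to_complex b) +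
      of_real (p ?r * (b \<bullet> b) + p' * (x \<bullet> b) / ?r * (x \<bullet> b)) * ?z ^ m +
      (of_real (q ?r) * to_complex b * (of_nat (m - 1) * ?z ^ (m - 1 - 1) * to_complex b) +
       of_real (q' * (x \<bullet> b) / ?r) * to_complex b * ?z ^ (m - 1))" for b
  proof -
    have 1: "((\<lambda>x. p (norm x) * (x \<bullet> b)) has_derivative (\<lambda>k. p ?r * (k \<bullet> b) + p' * (x \<bullet> k) / ?r * (x \<bullet> b))) (at x)"
      by (intro has_derivative_mult radial_has_derivative x p) (auto intro!: derivative_eq_intros)
    have 2: "((\<lambda>x. of_real (q (norm x)) * to_complex b) has_derivative (\<lambda>k. of_real (q' * (x \<bullet> k) / ?r) * to_complex b)) (at x)"
      by (intro has_derivative_mult_left has_derivative_of_real radial_has_derivative x q)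
    have "(F b has_derivative (\<lambda>k.
      (of_real (p ?r * (x \<bullet> b)) * (of_nat m * ?z ^ (m - 1) * to_complex k) +
      of_real (p ?r * (k \<bullet> b) + p' * (x \<bullet> k) / ?r * (x \<bullet> b)) * ?z ^ m) +
      (of_real (q ?r) * to_complex b * (of_nat (m - 1) * ?z ^ (m - 1 - 1) * to_complex k) +
       of_real (q' * (x \<bullet> k) / ?r) * to_complex b * ?z ^ (m - 1)))) (at x)"
      unfolding F_def
      by (intro has_derivative_add has_derivative_mult[OF has_derivative_of_real[OF 1] to_complex_power_has_derivative]
          has_derivative_mult[OF 2 to_complex_power_has_derivative])
    from fun_cong[OF frechet_derivative_at[OF this], of b] show ?thesis by simp
  qed
  have r: "?r > 0" using x by simp
  have rr: "of_real (x $ 1) * of_real (x $ 1) + of_real (x $ 2) * of_real (x $ 2) = (of_real ?r * of_real ?r :: complex)"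
    using norm_sq_real2[of x] by (simp add: power2_eq_square flip: of_real_mult of_real_add)
  have zm: "?z ^ m = ?z ^ (m - 1) * ?z" using m by (cases m) auto
  have z: "?z = of_real (x $ 1) + \<i> * of_real (x $ 2)" by (simp add: to_complex_def)
  define w where "w = ?z ^ (m - 1)"
  have "(\<Sum>b\<in>Basis. frechet_derivative (F b) (at x) b) =
      of_real (p ?r) * of_nat m * w * ?z + (2 * of_real (p ?r) +
      of_real (p' / ?r) * (of_real (x $ 1) * of_real (x $ 1) + of_real (x $ 2) * of_real (x $ 2))) * ?z ^ m +
      of_real (q' / ?r) * w * ?z"
    unfolding sum_Basis_real2 D to_complex_axis inner_axis_real2 w_def[symmetric]
    by (simp add: z algebra_simps add_divide_distrib inner_axis_axis)
  also have "\<dots> = of_real (p' * norm x + (2 + real m) * p (norm x) + q' / norm x) * ?z ^ m"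
    unfolding rr zm w_def[symmetric] using r by (simp add: field_simps)
  finally show ?thesis .
qed

lemma mode_test_function:
  assumes "smooth_on UNIV h" "0 < r\<^sub>1" "r\<^sub>2 < R" "\<And>r. \<not> (r\<^sub>1 \<le> r \<and> r \<le> r\<^sub>2) \<Longrightarrow> h r = 0"
  shows "test_function (ball 0 R) (mode m h)"
proof (rule test_function_annulus[OF _ assms(2,3)])
  show "smooth_on {x. 0 < norm x \<and> norm x < R} (mode m h)"
    unfolding mode_def[abs_def]
    by (intro smooth_on_mult smooth_on_of_real smooth_on_radial smooth_on_to_complex_power smooth_on_subset[OF assms(1)]) auto
qed (simp add: mode_def assms(4))

text \<open>Support in an annulus inside the disk makes the flux \<open>n^(p-1) \<nabla>u\<close> a
  smooth compactly supported field, for which distributional and classical divergence agree.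
  \<open>A\<close> is \<open>n^(p-1)\<close> where the flux can be nonzero.\<close>

lemma has_residual_mode:
  assumes m: "m \<ge> 1" and h: "smooth_on UNIV h" "0 < r\<^sub>1" "r\<^sub>2 < R" "\<And>r. \<not> (r\<^sub>1 \<le> r \<and> r \<le> r\<^sub>2) \<Longrightarrow> h r = 0"
    and A: "smooth_on {0<..<R} A" "\<And>r. 0 < r \<Longrightarrow> r < R \<Longrightarrow> n r powi (p - 1) = A r"
    and A': "\<And>r. 0 < r \<Longrightarrow> r < R \<Longrightarrow> (A has_real_derivative A' r) (at r)"
    and h': "\<And>r. (h has_real_derivative h' r) (at r)" and h'': "\<And>r. (h' has_real_derivative h'' r) (at r)"
  obtains f where "has_residual n p k (mode m h) f"
    "\<And>x. r\<^sub>1 \<le> norm x \<Longrightarrow> norm x \<le> r\<^sub>2 \<Longrightarrow> f x = - mode m (\<lambda>r. A r * h'' r + A' r * h' r + (1 + 2 * real m) * A r * h' r / r +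
       real m * A' r * h r / r + k\<^sup>2 * n r powi (p + 1) * h r) x"
    "\<And>x. \<not> (r\<^sub>1 \<le> norm x \<and> norm x \<le> r\<^sub>2) \<Longrightarrow> f x = 0"
proof -
  let ?u = "mode m h"
  define F where "F = (\<lambda>b x. (n (norm x) powi (p - 1)) *\<^sub>R frechet_derivative ?u (at x) b)"
  have u: "test_function (ball 0 R) ?u" using h by (rule mode_test_function)
  have outside: "frechet_derivative ?u (at x) b = 0" if "\<not> (r\<^sub>1 \<le> norm x \<and> norm x \<le> r\<^sub>2)" for x b
  proof -
    have "(?u has_derivative (\<lambda>_. 0)) (at x)"
      by (rule has_derivative_transform_within_open[of "\<lambda>_. 0" _ _ _ "- {x. r\<^sub>1 \<le> norm x \<and> norm x \<le> r\<^sub>2}"])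
        (use that h(4) compact_imp_closed[OF compact_annulus] in \<open>auto simp: mode_def\<close>)
    then show ?thesis by (simp flip: frechet_derivative_at)
  qed
  have Ft: "test_function (ball 0 R) (F b)" for b
  proof (rule test_function_annulus[OF _ h(2,3)])
    have "smooth_on {x. 0 < norm x \<and> norm x < R} (\<lambda>x. A (norm x) *\<^sub>R frechet_derivative ?u (at x) b)"
      using test_function_deriv[OF u, of b] unfolding test_function_def
      by (intro smooth_on_scaleR smooth_on_radial A(1)) (auto intro: smooth_on_subset)
    then show "smooth_on {x. 0 < norm x \<and> norm x < R} (F b)"
      by (rule smooth_on_cong) (auto simp: F_def A(2))
  qed (simp add: F_def outside)
  define d where "d = (\<lambda>x. \<Sum>b\<in>Basis. frechet_derivative (F b) (at x) b)"
  define f where "f = (\<lambda>x. - d x - (k\<^sup>2 * n (norm x) powi (p + 1)) *\<^sub>R ?u x)"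
  have "has_residual n p k ?u f"
    unfolding has_residual_def
  proof (intro exI conjI ballI)
    show "weak_partial UNIV b ?u (\<lambda>x. frechet_derivative ?u (at x) b)" for b
      by (rule weak_partial_test_function[OF u]) auto
    have "test_function UNIV (F b)" for b using Ft[of b] unfolding test_function_def by auto
    then show "weak_div (\<lambda>b x. (n (norm x) powi (p - 1)) *\<^sub>R frechet_derivative ?u (at x) b) d"
      unfolding d_def F_def by (rule weak_div_test_function)
  qed (simp add: f_def)
  moreover have "f x = 0" if out: "\<not> (r\<^sub>1 \<le> norm x \<and> norm x \<le> r\<^sub>2)" for x
  proof -
    have "frechet_derivative (F b) (at x) b = 0" for b
    proof -
      have "(F b has_derivative (\<lambda>_. 0)) (at x)"
        by (rule has_derivative_transform_within_open[of "\<lambda>_. 0" _ _ _ "- {x. r\<^sub>1 \<le> norm x \<and> norm x \<le> r\<^sub>2}"])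
          (use out outside compact_imp_closed[OF compact_annulus] in \<open>auto simp: F_def\<close>)
      then show ?thesis by (simp flip: frechet_derivative_at)
    qed
    then show ?thesis using h(4)[OF out] by (simp add: f_def d_def mode_def)
  qed
  moreover have "f x = - mode m (\<lambda>r. A r * h'' r + A' r * h' r + (1 + 2 * real m) * A r * h' r / r +
       real m * A' r * h r / r + k\<^sup>2 * n r powi (p + 1) * h r) x" if x: "r\<^sub>1 \<le> norm x" "norm x \<le> r\<^sub>2" for x
  proof -
    let ?r = "norm x"
    have r: "0 < ?r" "?r < R" "x \<noteq> 0" using x h(2,3) by auto
    \<comment> \<open>The flux splits into \<open>P\<close> times the position vector and
      \<open>Q\<close> times a constant vector, with powers of \<open>to_complex\<close> as factors;
      this is the shape that \<open>radial_divergence\<close> handles.\<close>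
    define P where "P = (\<lambda>r. A r * (h' r / r))"
    define Q where "Q = (\<lambda>r. A r * (real m * h r))"
    define F0 where "F0 = (\<lambda>b y. of_real (P (norm y) * (y \<bullet> b)) * to_complex y ^ m +
       of_real (Q (norm y)) * to_complex b * to_complex y ^ (m - 1))"
    have FF: "F b y = F0 b y" if "0 < norm y" "norm y < R" for b y
    proof -
      have "F b y = A (norm y) *\<^sub>R (of_real (h' (norm y) / norm y * (y \<bullet> b)) * to_complex y ^ m +
          of_real (real m * h (norm y)) * to_complex b * to_complex y ^ (m - 1))"
      proof -
        have "y \<noteq> 0" using that by auto
        then show ?thesis by (simp add: F_def A(2)[OF that] mode_derivative[OF _ h'[of "norm y"]])
      qed
      then show ?thesis by (simp add: F0_def P_def Q_def scaleR_conv_of_real algebra_simps)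
    qed
    have "frechet_derivative (F b) (at x) = frechet_derivative (F0 b) (at x)" for b
    proof -
      have "(F b has_derivative frechet_derivative (F b) (at x)) (at x)"
        by (rule test_function_has_derivative[OF Ft])
      then have "(F0 b has_derivative frechet_derivative (F b) (at x)) (at x)"
      proof (rule has_derivative_transform_within_open)
        show "open {y :: real^2. 0 < norm y \<and> norm y < R}"
          by (intro open_Collect_conj open_Collect_less continuous_intros)
      qed (use r FF in auto)
      then show ?thesis by (rule frechet_derivative_at)
    qed
    then have "d x = (\<Sum>b\<in>Basis. frechet_derivative (F0 b) (at x) b)" by (simp add: d_def)
    also have "\<dots> = of_real ((A ?r * ((h'' ?r * ?r - h' ?r) / (?r * ?r)) + A' ?r * (h' ?r / ?r)) * ?r +
        (2 + real m) * P ?r + (A ?r * (real m * h' ?r) + A' ?r * (real m * h ?r)) / ?r) * to_complex x ^ m"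
      unfolding F0_def
    proof (rule radial_divergence[OF r(3) m])
      show "(P has_real_derivative A ?r * ((h'' ?r * ?r - h' ?r) / (?r * ?r)) + A' ?r * (h' ?r / ?r)) (at ?r)"
        unfolding P_def using r h'' A'[OF r(1,2)]
        by (auto intro!: derivative_eq_intros simp: field_simps)
      show "(Q has_real_derivative A ?r * (real m * h' ?r) + A' ?r * (real m * h ?r)) (at ?r)"
        unfolding Q_def using h' A'[OF r(1,2)] by (auto intro!: derivative_eq_intros)
    qed
    also have "(A ?r * ((h'' ?r * ?r - h' ?r) / (?r * ?r)) + A' ?r * (h' ?r / ?r)) * ?r +
        (2 + real m) * P ?r + (A ?r * (real m * h' ?r) + A' ?r * (real m * h ?r)) / ?r =
        A ?r * h'' ?r + A' ?r * h' ?r + (1 + 2 * real m) * A ?r * h' ?r / ?r + real m * A' ?r * h ?r / ?r"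
      unfolding P_def using r(1) by (simp add: field_simps)
    finally have d: "d x = of_real (A ?r * h'' ?r + A' ?r * h' ?r + (1 + 2 * real m) * A ?r * h' ?r / ?r +
        real m * A' ?r * h ?r / ?r) * to_complex x ^ m" .
    have split: "of_real (T + U * v) * z = of_real T * z + of_real U * (of_real v * z)" for T U v and z :: complex
      by (simp add: algebra_simps)
    show ?thesis
      unfolding f_def d by (simp only: mode_def scaleR_conv_of_real split) simp
  qed
  ultimately show ?thesis using that by blast
qed

section \<open>Integration in polar coordinates\<close>

text \<open>The disk of radius \<open>r\<close> has area \<open>\<pi> r^2\<close>, whose derivative
  is the density \<open>2 \<pi> r\<close>. The reflection is there because measures are compared on
  upper rays \<open>{a<..}\<close> of finite measure, and under \<open>- norm x\<close> such rays
  pull back to disks.\<close>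

lemma distr_norm_real2:
  "distr (lborel :: (real^2) measure) borel (\<lambda>x. - norm x) = density lborel (\<lambda>y. ennreal (2 * pi * (- y)) * indicator {..0} y)"
proof (rule measure_eqI_lessThan)
  fix a :: real
  have M: "emeasure (distr (lborel :: (real^2) measure) borel (\<lambda>x. - norm x)) {a<..} = ennreal (if a < 0 then pi * a\<^sup>2 else 0)"
  proof -
    have "emeasure (distr (lborel :: (real^2) measure) borel (\<lambda>x. - norm x)) {a<..} = emeasure lborel (ball (0 :: real^2) (- a))"
      by (subst emeasure_distr) (auto intro!: arg_cong[where f = "emeasure lborel"])
    then show ?thesis
      using emeasure_ball[of "- a" "0 :: real^2"] by (auto simp: unit_ball_vol_2 ball_empty)
  qed
  show "emeasure (distr (lborel :: (real^2) measure) borel (\<lambda>x. - norm x)) {a<..} < \<infinity>"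
    unfolding M by simp
  have "emeasure (density lborel (\<lambda>y. ennreal (2 * pi * (- y)) * indicator {..0} y)) {a<..} =
      (\<integral>\<^sup>+y. ennreal (2 * pi * (- y)) * indicator {..0} y * indicator {a<..} y \<partial>lborel)"
    by (rule emeasure_density) auto
  also have "\<dots> = (\<integral>\<^sup>+y. ennreal (2 * pi * (- y)) * indicator {a..0} y \<partial>lborel)"
    by (rule nn_integral_cong_AE, rule AE_mp[OF AE_lborel_singleton[of a]]) (auto simp: indicator_def intro!: AE_I2)
  also have "\<dots> = ennreal (if a < 0 then pi * a\<^sup>2 else 0)"
  proof (cases "a \<le> 0")
    case True
    have "(\<integral>\<^sup>+y. ennreal (2 * pi * (- y)) * indicator {a..0} y \<partial>lborel) = ennreal (- (pi * 0\<^sup>2) - (- (pi * a\<^sup>2)))"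
      by (rule nn_integral_FTC_Icc[OF _ _ _ True]) (auto intro!: derivative_eq_intros simp: mult_nonneg_nonpos has_real_derivative_iff_has_vector_derivative[symmetric])
    then show ?thesis using True by auto
  qed auto
  finally show "emeasure (distr (lborel :: (real^2) measure) borel (\<lambda>x. - norm x)) {a<..} =
      emeasure (density lborel (\<lambda>y. ennreal (2 * pi * (- y)) * indicator {..0} y)) {a<..}"
    unfolding M by simp
qed auto

lemma integral_radial:
  assumes "G \<in> borel_measurable borel"
  shows "(LINT x|(lborel :: (real^2) measure). G (norm x)) = (LINT r|lborel. indicator {0..} r * (2 * pi * r) * G r :: real)"
proof -
  have "(LINT x|(lborel :: (real^2) measure). G (norm x)) = (LINT y|distr (lborel :: (real^2) measure) borel (\<lambda>x. - norm x). G (- y))"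
    using assms by (subst integral_distr) auto
  also have "\<dots> = (LINT y|density lborel (\<lambda>y. ennreal (2 * pi * (- y) * indicator {..0} y)). G (- y))"
    unfolding distr_norm_real2 by (intro arg_cong2[where f = lebesgue_integral] arg_cong2[where f = density]) (auto simp: indicator_def)
  also have "\<dots> = (LINT y|lborel. (2 * pi * (- y) * indicator {..0} y) * G (- y))"
    using assms by (subst integral_density) (auto simp: indicator_def mult_nonpos_nonneg)
  also have "\<dots> = \<bar>-1\<bar> * (LINT r|lborel. (2 * pi * (- (0 + (-1) * r)) * indicator {..0} (0 + (-1) * r)) * G (- (0 + (-1) * r)))"
    using lborel_integral_real_affine[of "-1" "\<lambda>y. (2 * pi * (- y) * indicator {..0} y) * G (- y)" 0] by simp
  also have "\<dots> = (LINT r|lborel. indicator {0..} r * (2 * pi * r) * G r)"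
    by (auto simp: indicator_def intro!: Bochner_Integration.integral_cong)
  finally show ?thesis .
qed

text \<open>Under \<open>r = R\<^sub>0 * (1 + t * s)\<close> the polar weight contributes
  \<open>R\<^sub>0 * (1 + t * s)\<close> and \<open>dr\<close> contributes
  \<open>R\<^sub>0 * t\<close>.\<close>

lemma L2_norm_on_radial:
  fixes f :: "real^2 \<Rightarrow> complex"
  assumes f: "\<And>x. norm (f x) = \<bar>w (norm x)\<bar>" and w: "w \<in> borel_measurable borel" "\<And>r. r \<le> 0 \<Longrightarrow> w r = 0"
    and "R\<^sub>0 > 0" "t > 0"
  shows "L2_norm_on UNIV f = sqrt (2 * pi * R\<^sub>0\<^sup>2 * t * (LINT s|lborel. (w (R\<^sub>0 * (1 + t * s)))\<^sup>2 * (1 + t * s)))"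
proof -
  have "(LINT x|lborel. (norm (f x))\<^sup>2) = (LINT r|lborel. indicator {0..} r * (2 * pi * r) * (w r)\<^sup>2)"
    using integral_radial[of "\<lambda>r. (w r)\<^sup>2"] w(1) by (simp add: f)
  also have "\<dots> = (LINT r|lborel. 2 * pi * r * (w r)\<^sup>2)"
    by (rule Bochner_Integration.integral_cong) (auto simp: indicator_def w(2))
  also have "\<dots> = \<bar>R\<^sub>0 * t\<bar> * (LINT s|lborel. 2 * pi * (R\<^sub>0 + R\<^sub>0 * t * s) * (w (R\<^sub>0 + R\<^sub>0 * t * s))\<^sup>2)"
    using lborel_integral_real_affine[of "R\<^sub>0 * t" "\<lambda>r. 2 * pi * r * (w r)\<^sup>2" R\<^sub>0] assms by simp
  also have "\<dots> = (R\<^sub>0 * t) * (LINT s|lborel. (2 * pi * R\<^sub>0) * ((w (R\<^sub>0 * (1 + t * s)))\<^sup>2 * (1 + t * s)))"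
    using assms by (simp add: algebra_simps)
  also have "\<dots> = 2 * pi * R\<^sub>0\<^sup>2 * t * (LINT s|lborel. (w (R\<^sub>0 * (1 + t * s)))\<^sup>2 * (1 + t * s))"
    by (simp only: Bochner_Integration.integral_mult_right_zero) (simp add: power2_eq_square)
  finally show ?thesis
    by (simp add: L2_norm_on_def set_lebesgue_integral_def)
qed

section \<open>The operator near the bottom of the well\<close>

lemma smooth_on_open_deriv:
  assumes "smooth_on S (Y :: real \<Rightarrow> real)" "open S"
  shows "x \<in> S \<Longrightarrow> (Y has_real_derivative deriv Y x) (at x)" "smooth_on S (deriv Y)"
proof -
  obtain Y' where Y': "\<And>x. x \<in> S \<Longrightarrow> (Y has_real_derivative Y' x) (at x)" "smooth_on S Y'"
    using smooth_on_vector_derivative[OF assms(1)] assms(2)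
    by (metis at_within_open has_real_derivative_iff_has_vector_derivative)
  then have "deriv Y x = Y' x" if "x \<in> S" for x using that by (auto intro: DERIV_imp_deriv)
  with Y' show "x \<in> S \<Longrightarrow> (Y has_real_derivative deriv Y x) (at x)" "smooth_on S (deriv Y)"
    using smooth_on_cong by metis+
qed

text \<open>With \<open>x = r / R\<^sub>0 - 1\<close>, the well is \<open>a\<close> times
  \<open>(1 + x)^(-2) - (n r / n R\<^sub>0)^2\<close>. This difference vanishes at 0, criticality of
  \<open>R\<^sub>0\<close> removes its linear term, and \<open>mu_breve\<close> is half its second
  derivative. Multiplication by \<open>Z\<close> extends the coefficients to compactly supported
  functions on the line, as \<open>symbol_scaled\<close> wants, and changes nothing on the support
  of \<open>Y\<close>.\<close>

lemma optical_well_coefficients: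
  fixes R R\<^sub>0 :: real and n :: "real \<Rightarrow> real" and p :: int
  assumes n: "smooth_on {0<..<R} n" "\<And>r. 0 < r \<Longrightarrow> r < R \<Longrightarrow> n r > 0"
    and R0: "0 < R\<^sub>0" "R\<^sub>0 < R"
    and crit: "1 + R\<^sub>0 * deriv n R\<^sub>0 / n R\<^sub>0 = 0"
    and a_def: "a = (\<lambda>x. n (R\<^sub>0 * (1 + x)) powi (p - 1))"
    and b_def: "b = (\<lambda>x. n (R\<^sub>0 * (1 + x)) powi (p + 1) / (n R\<^sub>0)\<^sup>2)"
  obtains \<delta> :: real and a' Y Z c\<^sub>1 c\<^sub>2 c\<^sub>3 c\<^sub>4 :: "real \<Rightarrow> real" where
    "\<And>x. \<bar>x\<bar> \<le> 2 * \<delta> \<Longrightarrow> c\<^sub>1 x = a x \<and> c\<^sub>2 x = a' x + a x / (1 + x) \<and> c\<^sub>3 x = a x / (1 + x)\<^sup>2 - b x \<and> c\<^sub>4 x = b x"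
    "\<And>x. 0 \<le> Z x \<and> Z x \<le> 1" "\<And>x. \<bar>x\<bar> \<le> \<delta> \<Longrightarrow> Y x = 1"
    "0 < \<delta>" "4 * \<delta> < 1" "R\<^sub>0 * (1 + 4 * \<delta>) < R"
    "smooth_on UNIV Y" "\<And>x. \<bar>x\<bar> \<ge> 2 * \<delta> \<Longrightarrow> Y x = 0"
    "smooth_on UNIV Z" "\<And>x. \<bar>x\<bar> \<le> 2 * \<delta> \<Longrightarrow> Z x = 1" "\<And>x. \<bar>x\<bar> \<ge> 4 * \<delta> \<Longrightarrow> Z x = 0"
    "\<And>x. \<bar>x\<bar> \<le> 2 * \<delta> \<Longrightarrow> (a has_real_derivative a' x) (at x)"
    "smooth_on UNIV c\<^sub>1" "smooth_on UNIV c\<^sub>2" "smooth_on UNIV c\<^sub>3" "smooth_on UNIV c\<^sub>4"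
    "\<And>x. \<bar>x\<bar> \<ge> 4 * \<delta> \<Longrightarrow> c\<^sub>1 x = 0 \<and> c\<^sub>2 x = 0 \<and> c\<^sub>3 x = 0 \<and> c\<^sub>4 x = 0"
    "c\<^sub>1 0 > 0" "c\<^sub>4 0 = c\<^sub>1 0" "c\<^sub>3 0 = 0" "deriv c\<^sub>3 0 = 0" "deriv (deriv c\<^sub>3) 0 = 2 * (c\<^sub>1 0 * mu_breve R\<^sub>0 n)"
proof -
  define J where "J = {-1<..<R / R\<^sub>0 - 1}"
  have J: "open J" "0 \<in> J" using R0 by (auto simp: J_def field_simps)
  have Jr: "0 < R\<^sub>0 * (1 + x)" "R\<^sub>0 * (1 + x) < R" "0 < 1 + x" if "x \<in> J" for x
  proof -
    show x: "0 < 1 + x" using that by (auto simp: J_def)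
    then show "0 < R\<^sub>0 * (1 + x)" using R0 by simp
    show "R\<^sub>0 * (1 + x) < R" using that R0 by (auto simp: J_def field_simps)
  qed
  define L where "L = R / R\<^sub>0 - 1"
  have L: "L > 0" using R0 by (simp add: L_def field_simps)
  \<comment> \<open>The wider cut-off \<open>Z\<close> reaches out to \<open>4 * \<delta>\<close>,
    which has to stay inside \<open>J\<close>; the factor 8 leaves half of the room.\<close>
  define \<delta> where "\<delta> = min (1/8) (L / 8)"
  have "\<delta> \<le> 1/8" "\<delta> \<le> L / 8" unfolding \<delta>_def by (rule min.cobounded1, rule min.cobounded2)
  moreover have "0 < \<delta>" using L by (simp add: \<delta>_def)
  ultimately have "0 < \<delta>" "4 * \<delta> < 1" "4 * \<delta> < L" using L by linarith+
  then have \<delta>: "0 < \<delta>" "4 * \<delta> < 1" "4 * \<delta> < R / R\<^sub>0 - 1" by (simp_all add: L_def)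
  have \<delta>R: "R\<^sub>0 * (1 + 4 * \<delta>) < R" using \<delta>(3) R0 by (simp add: field_simps)
  have inJ: "x \<in> J" if "\<bar>x\<bar> \<le> 4 * \<delta>" for x using that \<delta> by (auto simp: J_def abs_le_iff)
  define \<nu> where "\<nu> = (\<lambda>x. n (R\<^sub>0 * (1 + x)))"
  have \<nu>_smooth: "smooth_on J \<nu>"
    unfolding \<nu>_def
    by (rule smooth_on_compose[OF n(1)]) (use Jr in \<open>auto intro!: smooth_on_mult smooth_on_add smooth_on_id\<close>)
  have \<nu>_pos: "\<nu> x > 0" if "x \<in> J" for x unfolding \<nu>_def using n(2) Jr[OF that] by blast
  have open_R: "open {0<..<R}" by simp
  have \<nu>_der: "(\<nu> has_real_derivative R\<^sub>0 * deriv n (R\<^sub>0 * (1 + x))) (at x)"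
    "((\<lambda>x. R\<^sub>0 * deriv n (R\<^sub>0 * (1 + x))) has_real_derivative R\<^sub>0 * (R\<^sub>0 * deriv (deriv n) (R\<^sub>0 * (1 + x)))) (at x)" if "x \<in> J" for x
  proof -
    have r: "R\<^sub>0 * (1 + x) \<in> {0<..<R}" using Jr[OF that] by simp
    have lin: "((\<lambda>x. R\<^sub>0 * (1 + x)) has_real_derivative R\<^sub>0) (at x)" by (auto intro!: derivative_eq_intros)
    from DERIV_chain2[OF smooth_on_open_deriv(1)[OF n(1) open_R r] lin]
    show "(\<nu> has_real_derivative R\<^sub>0 * deriv n (R\<^sub>0 * (1 + x))) (at x)" by (simp add: \<nu>_def mult.commute)
    from DERIV_chain2[OF smooth_on_open_deriv(1)[OF smooth_on_open_deriv(2)[OF n(1) open_R] open_R r] lin]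
    show "((\<lambda>x. R\<^sub>0 * deriv n (R\<^sub>0 * (1 + x))) has_real_derivative R\<^sub>0 * (R\<^sub>0 * deriv (deriv n) (R\<^sub>0 * (1 + x)))) (at x)"
      by (intro DERIV_cmult) (simp add: mult.commute)
  qed
  have n0: "n R\<^sub>0 > 0" using n(2) R0 by blast
  have n1: "R\<^sub>0 * deriv n R\<^sub>0 = - n R\<^sub>0" using crit n0 by (simp add: field_simps)
  have n2: "R\<^sub>0 * (R\<^sub>0 * deriv (deriv n) R\<^sub>0) = (2 - mu_breve R\<^sub>0 n) * n R\<^sub>0"
    using n0 by (simp add: mu_breve_def power2_eq_square field_simps)
  have a: "smooth_on J a" unfolding a_def using \<nu>_smooth \<nu>_pos by (intro smooth_on_powi) (auto simp: \<nu>_def)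
  have b: "smooth_on J b"
  proof -
    have "smooth_on J (\<lambda>x. inverse ((n R\<^sub>0)\<^sup>2) * n (R\<^sub>0 * (1 + x)) powi (p + 1))"
      using \<nu>_smooth \<nu>_pos by (intro smooth_on_mult smooth_on_const smooth_on_powi) (auto simp: \<nu>_def)
    then show ?thesis by (simp add: b_def divide_inverse mult.commute)
  qed
  define a' where "a' = deriv a"
  have a': "x \<in> J \<Longrightarrow> (a has_real_derivative a' x) (at x)" "smooth_on J a'" for x
    unfolding a'_def using smooth_on_open_deriv[OF a J(1)] by auto
  have a_pos: "a x > 0" if "x \<in> J" for x using \<nu>_pos[OF that] by (simp add: a_def \<nu>_def)
  define q where "q = (\<lambda>x. inverse ((1 + x)\<^sup>2) - (\<nu> x)\<^sup>2 / (n R\<^sub>0)\<^sup>2)"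
  define q1 where "q1 = (\<lambda>x. - 2 * inverse ((1 + x) ^ 3) - 2 * (\<nu> x * (R\<^sub>0 * deriv n (R\<^sub>0 * (1 + x)))) / (n R\<^sub>0)\<^sup>2)"
  have q_der: "(q has_real_derivative q1 x) (at x)" if "x \<in> J" for x
  proof -
    have inv_sq: "((\<lambda>y::real. inverse (y\<^sup>2)) has_real_derivative - 2 * inverse (y ^ 3)) (at y)" if "y \<noteq> 0" for y
      using that by (auto intro!: derivative_eq_intros simp: power2_eq_square power3_eq_cube field_simps)
    have "((\<lambda>x. inverse ((1 + x)\<^sup>2)) has_real_derivative - 2 * inverse ((1 + x) ^ 3) * 1) (at x)"
      by (rule DERIV_chain2[OF inv_sq]) (use Jr(3)[OF that] in \<open>auto intro!: derivative_eq_intros\<close>)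
    then have 1: "((\<lambda>x. inverse ((1 + x)\<^sup>2)) has_real_derivative - 2 * inverse ((1 + x) ^ 3)) (at x)" by simp
    have 2: "((\<lambda>x. (\<nu> x)\<^sup>2) has_real_derivative 2 * (\<nu> x * (R\<^sub>0 * deriv n (R\<^sub>0 * (1 + x))))) (at x)"
      using \<nu>_der(1)[OF that] by (auto intro!: derivative_eq_intros)
    show ?thesis unfolding q_def q1_def by (intro DERIV_diff DERIV_cdivide 1 2)
  qed
  have q1_der: "(q1 has_real_derivative 2 * mu_breve R\<^sub>0 n) (at 0)"
  proof -
    have "(q1 has_real_derivative - 2 * (- 3) - 2 * (\<nu> 0 * (R\<^sub>0 * (R\<^sub>0 * deriv (deriv n) (R\<^sub>0 * (1 + 0)))) +
        R\<^sub>0 * deriv n (R\<^sub>0 * (1 + 0)) * (R\<^sub>0 * deriv n (R\<^sub>0 * (1 + 0)))) / (n R\<^sub>0)\<^sup>2) (at 0)"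
    proof -
      have "((\<lambda>x::real. inverse ((1 + x) ^ 3)) has_real_derivative - 3) (at 0)"
        by (auto intro!: derivative_eq_intros)
      moreover have "((\<lambda>x. \<nu> x * (R\<^sub>0 * deriv n (R\<^sub>0 * (1 + x)))) has_real_derivative
        \<nu> 0 * (R\<^sub>0 * (R\<^sub>0 * deriv (deriv n) (R\<^sub>0 * (1 + 0)))) + R\<^sub>0 * deriv n (R\<^sub>0 * (1 + 0)) * (R\<^sub>0 * deriv n (R\<^sub>0 * (1 + 0)))) (at 0)"
        by (rule DERIV_mult'[OF \<nu>_der(1)[OF J(2)] \<nu>_der(2)[OF J(2)]])
      ultimately show ?thesis unfolding q1_def
        by (intro DERIV_diff DERIV_cmult DERIV_cdivide) auto
    qed
    moreover have "- 2 * (- 3) - 2 * (\<nu> 0 * (R\<^sub>0 * (R\<^sub>0 * deriv (deriv n) (R\<^sub>0 * (1 + 0)))) +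
        R\<^sub>0 * deriv n (R\<^sub>0 * (1 + 0)) * (R\<^sub>0 * deriv n (R\<^sub>0 * (1 + 0)))) / (n R\<^sub>0)\<^sup>2 = 2 * mu_breve R\<^sub>0 n"
      using n0 by (simp add: \<nu>_def n1 n2) (simp add: power2_eq_square field_simps)
    ultimately show ?thesis by simp
  qed
  have q0: "q 0 = 0" "q1 0 = 0"
    using n0 by (simp_all add: q_def q1_def \<nu>_def n1) (simp add: power2_eq_square)
  \<comment> \<open>Since \<open>n^(p+1) = n^(p-1) n^2\<close>, the factor \<open>a\<close> comes
    out, and the expansion of the well at 0 follows from that of \<open>q\<close>.\<close>
  define e where "e = (\<lambda>x. a x * q x)"
  have e_eq: "e x = a x / (1 + x)\<^sup>2 - b x" if "x \<in> J" for x
  proof -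
    have "\<nu> x powi (p + 1) = \<nu> x powi (p - 1) * (\<nu> x)\<^sup>2"
      using \<nu>_pos[OF that] power_int_add[of "\<nu> x" "p - 1" 2] by (simp add: add.commute)
    then show ?thesis by (simp add: e_def a_def b_def q_def \<nu>_def field_simps)
  qed
  obtain Y :: "real \<Rightarrow> real" where Y: "smooth_on UNIV Y" "\<And>x. 0 \<le> Y x" "\<And>x. Y x \<le> 1"
    "\<And>x. \<bar>x\<bar> \<le> \<delta> \<Longrightarrow> Y x = 1" "\<And>x. \<bar>x\<bar> \<ge> 2 * \<delta> \<Longrightarrow> Y x = 0"
    by (rule exists_plateau[OF \<delta>(1)]) (rule that)
  have "2 * \<delta> > 0" using \<delta> by simp
  obtain Z :: "real \<Rightarrow> real" where Z': "smooth_on UNIV Z" "\<And>x. 0 \<le> Z x" "\<And>x. Z x \<le> 1"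
    "\<And>x. \<bar>x\<bar> \<le> 2 * \<delta> \<Longrightarrow> Z x = 1" "\<And>x. \<bar>x\<bar> \<ge> 2 * (2 * \<delta>) \<Longrightarrow> Z x = 0"
    by (rule exists_plateau[OF \<open>2 * \<delta> > 0\<close>]) (rule that)
  then have Z: "smooth_on UNIV Z" "\<And>x. 0 \<le> Z x \<and> Z x \<le> 1"
    "\<And>x. \<bar>x\<bar> \<le> 2 * \<delta> \<Longrightarrow> Z x = 1" "\<And>x. \<bar>x\<bar> \<ge> 4 * \<delta> \<Longrightarrow> Z x = 0" by simp_all
  have ext: "smooth_on UNIV (\<lambda>x. Z x * c x)" if "smooth_on J c" for c
  proof (rule smooth_on_UNIV_if_supported[of J _ "{- (4 * \<delta>)..4 * \<delta>}"])
    show "smooth_on J (\<lambda>x. Z x * c x)" using smooth_on_subset[OF Z(1)] that by (intro smooth_on_mult) auto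
    show "Z x * c x = 0" if "x \<notin> {- (4 * \<delta>)..4 * \<delta>}" for x
    proof -
      have "\<bar>x\<bar> \<ge> 4 * \<delta>" using that by auto
      then show ?thesis by (simp add: Z(4))
    qed
  qed (use J inJ in \<open>auto simp: abs_le_iff\<close>)
  have inv: "smooth_on J (\<lambda>x. inverse (1 + x))"
    using Jr(3) by (intro smooth_on_inverse smooth_on_add smooth_on_const smooth_on_id) auto
  have inv2: "smooth_on J (\<lambda>x. inverse ((1 + x)\<^sup>2))"
    by (intro smooth_on_inverse smooth_on_power smooth_on_add smooth_on_const smooth_on_id zero_less_power Jr(3))
  have c2: "smooth_on J (\<lambda>x. a' x + a x / (1 + x))"
    unfolding divide_inverse by (intro smooth_on_add smooth_on_mult a a' inv)
  have e_smooth: "smooth_on J e"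
  proof (rule smooth_on_cong)
    show "smooth_on J (\<lambda>x. a x * inverse ((1 + x)\<^sup>2) - b x)" by (intro smooth_on_diff smooth_on_mult a b inv2)
  qed (simp add: e_eq divide_inverse)
  define c3 where "c3 = (\<lambda>x. Z x * e x)"
  have near: "(deriv ^^ k) c3 0 = (deriv ^^ k) e 0" for k
    by (rule deriv_funpow_local[of "ball 0 \<delta>"]) (use \<delta> Z in \<open>auto simp: c3_def\<close>)
  have e_der: "(e has_real_derivative a x * q1 x + a' x * q x) (at x)" if "x \<in> J" for x
    unfolding e_def using a'(1)[OF that] q_der[OF that] by (rule DERIV_mult')
  have de: "deriv e x = a x * q1 x + a' x * q x" if "x \<in> J" for x
    using e_der[OF that] by (rule DERIV_imp_deriv)
  have dde: "(deriv e has_real_derivative 2 * (a 0 * mu_breve R\<^sub>0 n)) (at 0)"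
  proof -
    have "((\<lambda>x. a x * q1 x + a' x * q x) has_real_derivative
      (a 0 * (2 * mu_breve R\<^sub>0 n) + a' 0 * q1 0) + (a' 0 * q1 0 + deriv a' 0 * q 0)) (at 0)"
      using smooth_on_open_deriv(1)[OF a'(2) J]
      by (intro DERIV_add DERIV_mult' a'(1) q1_der q_der J)
    then have "((\<lambda>x. a x * q1 x + a' x * q x) has_real_derivative 2 * (a 0 * mu_breve R\<^sub>0 n)) (at 0)"
      by (simp add: q0 mult_ac)
    then show ?thesis
      by (rule has_field_derivative_transform_within_open[OF _ J]) (simp add: de)
  qed
  show ?thesis
  proof (rule that[where \<delta> = \<delta> and Y = Y and Z = Z and a' = a' and c\<^sub>1 = "\<lambda>x. Z x * a x" and
      c\<^sub>2 = "\<lambda>x. Z x * (a' x + a x / (1 + x))" and c\<^sub>3 = c3 and c\<^sub>4 = "\<lambda>x. Z x * b x"])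
    show "smooth_on UNIV (\<lambda>x. Z x * a x)" "smooth_on UNIV (\<lambda>x. Z x * (a' x + a x / (1 + x)))" "smooth_on UNIV c3" "smooth_on UNIV (\<lambda>x. Z x * b x)"
      unfolding c3_def by (intro ext a c2 e_smooth b)+
    show "(a has_real_derivative a' x) (at x)" if "\<bar>x\<bar> \<le> 2 * \<delta>" for x
      using a'(1)[OF inJ] that \<delta>(1) by auto
    show "Z x * a x = 0 \<and> Z x * (a' x + a x / (1 + x)) = 0 \<and> c3 x = 0 \<and> Z x * b x = 0" if "\<bar>x\<bar> \<ge> 4 * \<delta>" for x
      using Z(4)[OF that] by (simp add: c3_def)
    show "Z x * a x = a x \<and> Z x * (a' x + a x / (1 + x)) = a' x + a x / (1 + x) \<and> c3 x = a x / (1 + x)\<^sup>2 - b x \<and> Z x * b x = b x"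
      if "\<bar>x\<bar> \<le> 2 * \<delta>" for x
    proof -
      have "x \<in> J" using that \<delta>(1) by (intro inJ) linarith
      then show ?thesis using Z(3)[OF that] e_eq by (simp add: c3_def)
    qed
    have Z0: "Z 0 = 1" using Z(3)[of 0] \<delta> by simp
    then show "Z 0 * a 0 > 0" using a_pos[OF J(2)] by simp
    have "n R\<^sub>0 powi (p + 1) = n R\<^sub>0 powi (p - 1) * (n R\<^sub>0)\<^sup>2"
      using n0 power_int_add[of "n R\<^sub>0" "p - 1" 2] by (simp add: add.commute)
    then show "Z 0 * b 0 = Z 0 * a 0" using n0 by (simp add: a_def b_def)
    show "c3 0 = 0" by (simp add: c3_def e_def q0)
    show "deriv c3 0 = 0" using near[of 1] de[OF J(2)] by (simp add: q0)
    show "deriv (deriv c3) 0 = 2 * (Z 0 * a 0 * mu_breve R\<^sub>0 n)"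
      using near[of 2] DERIV_imp_deriv[OF dde] Z0 by (simp add: numeral_2_eq_2)
  qed (use \<delta> \<delta>R Y Z in auto)
qed

text \<open>The operator \<open>- div (n^(p-1) \<nabla>) - k^2 n^(p+1)\<close> on a mode of profile
  \<open>Q\<close> times Gaussian, written in \<open>s\<close> with \<open>m = t^(-2)\<close>, freed
  from the Gaussian and multiplied by \<open>R\<^sub>0^2 t^4\<close>. Here \<open>c\<^sub>3\<close>
  joins the centrifugal term with the leading part of \<open>k^2 n^(p+1)\<close>, and
  \<open>e\<close> is the relative correction of \<open>k^2\<close> at order
  \<open>t^2\<close>.\<close>

definition residual_symbol ::
    "real \<Rightarrow> (real \<Rightarrow> real) \<Rightarrow> (real \<Rightarrow> real) \<Rightarrow> (real \<Rightarrow> real) \<Rightarrow> (real \<Rightarrow> real) \<Rightarrow> (real \<Rightarrow> real) \<Rightarrow>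
      (real \<Rightarrow> real \<Rightarrow> real) \<Rightarrow> real \<Rightarrow> real \<Rightarrow> real" where
  "residual_symbol \<alpha> c\<^sub>1 c\<^sub>2 c\<^sub>3 c\<^sub>4 e Q t s =
     c\<^sub>3 (t * s) * Q t s - t\<^sup>2 * (c\<^sub>4 (t * s) * (e t * Q t s)) -
     t\<^sup>2 * (c\<^sub>1 (t * s) * gauss_deriv \<alpha> (gauss_deriv \<alpha> Q) t s) - t ^ 3 * (c\<^sub>2 (t * s) * gauss_deriv \<alpha> Q t s)"

text \<open>\<open>Y\<close> is 1 near the origin, so \<open>Y (t * s)\<close> has Taylor series 1
  and the formal solution survives the cut-off. Since \<open>c\<^sub>3\<close> starts at order two,
  the residual series is divisible by \<open>t^2\<close>; the quotient is the equation of
  \<open>formal_quasi_mode\<close>, with the tails of the coefficient series as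
  perturbation.\<close>

lemma quasi_mode_symbols:
  assumes \<alpha>: "\<alpha> > 0" and \<delta>: "\<delta> > 0"
    and Y: "smooth_on UNIV Y" "\<And>x. \<bar>x\<bar> \<le> \<delta> \<Longrightarrow> Y x = 1" "\<And>x. \<bar>x\<bar> \<ge> 2 * \<delta> \<Longrightarrow> Y x = 0"
    and c: "smooth_on UNIV c\<^sub>1" "smooth_on UNIV c\<^sub>2" "smooth_on UNIV c\<^sub>3" "smooth_on UNIV c\<^sub>4"
    and c_0: "\<And>x. \<bar>x\<bar> \<ge> 4 * \<delta> \<Longrightarrow> c\<^sub>1 x = 0 \<and> c\<^sub>2 x = 0 \<and> c\<^sub>3 x = 0 \<and> c\<^sub>4 x = 0"
    and at_0: "c\<^sub>1 0 > 0" "c\<^sub>4 0 = c\<^sub>1 0" "c\<^sub>3 0 = 0" "deriv c\<^sub>3 0 = 0" "deriv (deriv c\<^sub>3) 0 = 2 * (c\<^sub>1 0 * \<alpha>\<^sup>2)"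
  obtains F e \<epsilon> where "symbol F" "has_taylor (\<lambda>t s. e t) (Abs_fps (\<lambda>k. [:\<epsilon> k:]))" "\<epsilon> 0 = (2 * real j + 1) * \<alpha>"
    "\<And>t. t \<in> {0..1} \<Longrightarrow> e t > 0" "\<exists>s. \<bar>s\<bar> \<le> \<delta> \<and> (\<forall>t\<in>{0..1}. F t s \<noteq> 0)"
    "has_taylor (residual_symbol \<alpha> c\<^sub>1 c\<^sub>2 c\<^sub>3 c\<^sub>4 e (\<lambda>t s. Y (t * s) * F t s)) 0"
proof -
  define ser where "ser = (\<lambda>c :: real \<Rightarrow> real. Abs_fps (\<lambda>k. monom ((deriv ^^ k) c 0 / fact k) k))"
  define G where "G = fps_gauss_deriv \<alpha>"
  let ?a = "c\<^sub>1 0"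
  have ser_c: "has_taylor (\<lambda>t s. c (t * s)) (ser c)" if "smooth_on UNIV c" "\<And>x. \<bar>x\<bar> \<ge> 4 * \<delta> \<Longrightarrow> c x = 0" for c
    unfolding ser_def
    by (rule has_taylor_scaled[OF that(1), of "{- (4 * \<delta>)..4 * \<delta>}"]) (auto intro!: that(2))
  have ser_Y: "has_taylor (\<lambda>t s. Y (t * s)) 1"
  proof -
    have "(deriv ^^ k) Y 0 = (if k = 0 then 1 else 0)" for k
    proof -
      have "(deriv ^^ k) Y 0 = (deriv ^^ k) (poly 1) 0"
        by (rule deriv_funpow_local[of "ball 0 \<delta>"]) (use \<delta> Y in auto)
      then show ?thesis
        by (simp add: deriv_funpow_poly higher_pderiv_eq_0)
    qed
    then have "ser Y = 1" by (auto simp: ser_def fps_eq_iff one_pCons monom_0)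
    then show ?thesis using ser_c[of Y] Y(1,3) \<delta> by simp
  qed
  have s1: "ser c\<^sub>1 = fps_const [:?a:] + fps_X * fps_shift 1 (ser c\<^sub>1)"
    by (auto simp: fps_eq_iff ser_def monom_0)
  have s4: "ser c\<^sub>4 = fps_const [:?a:] + fps_X * fps_shift 1 (ser c\<^sub>4)"
    by (auto simp: fps_eq_iff ser_def monom_0 at_0(2))
  have s3: "ser c\<^sub>3 = fps_X\<^sup>2 * (fps_const [:?a:] * fps_const [:0, 0, \<alpha>\<^sup>2:]) + fps_X ^ 3 * fps_shift 3 (ser c\<^sub>3)"
  proof (rule fps_ext)
    fix k :: nat
    consider "k = 0" | "k = 1" | "k = 2" | "k \<ge> 3" by linarith
    then show "fps_nth (ser c\<^sub>3) k = fps_nth (fps_X\<^sup>2 * (fps_const [:?a:] * fps_const [:0, 0, \<alpha>\<^sup>2:]) + fps_X ^ 3 * fps_shift 3 (ser c\<^sub>3)) k"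
    proof cases
      case 3
      then show ?thesis
        by (simp add: ser_def fps_X_power_mult_nth at_0(5) numeral_2_eq_2 monom_Suc monom_0)
    qed (simp_all add: ser_def fps_X_power_mult_nth at_0(3,4))
  qed
  obtain f \<epsilon> where f: "fps_nth f 0 \<noteq> 0" "\<epsilon> 0 = (2 * real j + 1) * \<alpha>"
    "fps_const [:?a:] * (- G (G f) + fps_const [:0, 0, \<alpha>\<^sup>2:] * f - Abs_fps (\<lambda>k. [:\<epsilon> k:]) * f) +
     fps_X * (- (fps_shift 1 (ser c\<^sub>1) * G (G f)) - ser c\<^sub>2 * G f + fps_shift 3 (ser c\<^sub>3) * f -
       fps_shift 1 (ser c\<^sub>4) * (Abs_fps (\<lambda>k. [:\<epsilon> k:]) * f)) = 0"
    by (rule formal_quasi_mode[OF \<alpha>, where a = ?a and j = j and A\<^sub>1 = "fps_shift 1 (ser c\<^sub>1)" and A\<^sub>2 = "ser c\<^sub>2" and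
        A\<^sub>3 = "fps_shift 3 (ser c\<^sub>3)" and A\<^sub>4 = "fps_shift 1 (ser c\<^sub>4)", folded G_def]) (use at_0(1) in simp, rule that)
  let ?E = "Abs_fps (\<lambda>k. [:\<epsilon> k:])"
  have formal: "ser c\<^sub>3 * f - fps_X\<^sup>2 * (ser c\<^sub>4 * (?E * f)) - fps_X\<^sup>2 * (ser c\<^sub>1 * G (G f)) - fps_X ^ 3 * (ser c\<^sub>2 * G f) = 0"
  proof -
    have "ser c\<^sub>3 * f - fps_X\<^sup>2 * (ser c\<^sub>4 * (?E * f)) - fps_X\<^sup>2 * (ser c\<^sub>1 * G (G f)) - fps_X ^ 3 * (ser c\<^sub>2 * G f) =
      fps_X\<^sup>2 * (fps_const [:?a:] * (- G (G f) + fps_const [:0, 0, \<alpha>\<^sup>2:] * f - ?E * f) +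
     fps_X * (- (fps_shift 1 (ser c\<^sub>1) * G (G f)) - ser c\<^sub>2 * G f + fps_shift 3 (ser c\<^sub>3) * f -
       fps_shift 1 (ser c\<^sub>4) * (?E * f)))"
    proof -
      have "(x * x * (A * B) + x * x * x * C3) * f - x * x * ((A + x * C4) * (E * f)) - x * x * ((A + x * C1) * g2) - x * x * x * (C2 * g1) =
         x * x * (A * (- g2 + B * f - E * f) + x * (- (C1 * g2) - C2 * g1 + C3 * f - C4 * (E * f)))"
        for x A B C1 C2 C3 C4 E f g1 g2 :: "real poly fps"
        by (simp add: algebra_simps)
      then show ?thesis
        by (subst s1, subst s3, subst s4) (simp only: power2_eq_square power3_eq_cube)
    qed
    also have "\<dots> = 0" unfolding f(3) by simp
    finally show ?thesis .
  qed
  \<comment> \<open>A nonzero polynomial has finitely many roots. The restriction to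
    \<open>|s| \<le> \<delta>\<close> keeps \<open>t * s\<close> where \<open>Y\<close> is 1, for
    every \<open>t\<close> in \<open>[0, 1]\<close>.\<close>
  obtain s where s: "\<bar>s\<bar> \<le> \<delta>" "poly (fps_nth f 0) s \<noteq> 0"
  proof -
    have "infinite {- \<delta>..\<delta>}" using \<delta> by simp
    then have "\<not> {- \<delta>..\<delta>} \<subseteq> {x. poly (fps_nth f 0) x = 0}"
      using poly_roots_finite[OF f(1)] finite_subset by blast
    then obtain x where "x \<in> {- \<delta>..\<delta>}" "poly (fps_nth f 0) x \<noteq> 0" by blast
    then show ?thesis by (intro that[of x]) auto
  qed
  \<comment> \<open>This tolerance amounts, at the point \<open>s\<close>, to half of the leading
    value, so \<open>F t s\<close> cannot vanish for any \<open>t\<close>.\<close>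
  have "\<bar>poly (fps_nth f 0) s\<bar> / (2 * exp (s\<^sup>2)) > 0" using s(2) by simp
  then obtain F where F: "has_taylor F f"
    "\<And>t u. t \<in> {0..1} \<Longrightarrow> \<bar>F t u - poly (fps_nth f 0) u\<bar> \<le> \<bar>poly (fps_nth f 0) s\<bar> / (2 * exp (s\<^sup>2)) * exp (u\<^sup>2)"
    using borel_summation[of _ "fps_nth f"] by (metis fps_nth_inverse)
  have e0: "\<epsilon> 0 > 0" using \<alpha> by (simp add: f(2))
  then obtain E where E: "has_taylor E ?E" "\<And>t u. t \<in> {0..1} \<Longrightarrow> \<bar>E t u - poly [:\<epsilon> 0:] u\<bar> \<le> \<epsilon> 0 / 2 * exp (u\<^sup>2)"
    using borel_summation[of "\<epsilon> 0 / 2" "\<lambda>k. [:\<epsilon> k:]"] by (metis half_gt_zero)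
  \<comment> \<open>At \<open>s = 0\<close> the weight \<open>exp (s^2)\<close> is 1, so the
    tolerance \<open>\<epsilon> 0 / 2\<close> gives
    \<open>e t \<ge> \<epsilon> 0 / 2\<close>.\<close>
  define e where "e = (\<lambda>t. E t 0)"
  have e: "has_taylor (\<lambda>t s. e t) ?E"
    using has_taylor_frozen[OF E(1), of 0] by (simp add: e_def)
  have e_pos: "e t > 0" if "t \<in> {0..1}" for t
    using E(2)[OF that, of 0] e0 by (simp add: e_def abs_if split: if_splits)
  have nz: "F t s \<noteq> 0" if "t \<in> {0..1}" for t
    using F(2)[OF that, of s] s(2) by auto
  define Q where "Q = (\<lambda>t s. Y (t * s) * F t s)"
  have Q: "has_taylor Q f" unfolding Q_def using has_taylor_mult[OF ser_Y F(1)] by simp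
  have "has_taylor (residual_symbol \<alpha> c\<^sub>1 c\<^sub>2 c\<^sub>3 c\<^sub>4 e Q)
    (ser c\<^sub>3 * f - fps_X\<^sup>2 * (ser c\<^sub>4 * (?E * f)) - fps_X\<^sup>2 * (ser c\<^sub>1 * G (G f)) - fps_X ^ 3 * (ser c\<^sub>2 * G f))"
    unfolding residual_symbol_def[abs_def] G_def
    by (intro has_taylor_diff has_taylor_mult has_taylor_power has_taylor_t has_taylor_gauss_deriv Q e ser_c c)
      (simp_all add: c_0)
  then have "has_taylor (residual_symbol \<alpha> c\<^sub>1 c\<^sub>2 c\<^sub>3 c\<^sub>4 e (\<lambda>t s. Y (t * s) * F t s)) 0"
    unfolding formal Q_def .
  then show ?thesis
    using that[of F e \<epsilon>] has_taylor_symbol[OF F(1)] e f(2) e_pos s(1) nz by blast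
qed

section \<open>Quasi-modes\<close>

lemma inverse_power_has_derivative:
  assumes "r > (0::real)"
  shows "((\<lambda>r. inverse (r ^ m)) has_real_derivative - (real m / r) * inverse (r ^ m)) (at r)"
proof (cases m)
  case (Suc k)
  have "((\<lambda>r. r ^ m) has_real_derivative real m * r ^ k) (at r)"
    using DERIV_pow[of m r] by (simp add: Suc)
  from DERIV_inverse_fun[OF this] assms
  have "((\<lambda>r. inverse (r ^ m)) has_real_derivative - (real m * r ^ k * inverse ((r ^ m)\<^sup>2))) (at r)"
    by (simp add: numeral_2_eq_2)
  then show ?thesis by (rule DERIV_cong) (use assms in \<open>simp add: Suc field_simps power2_eq_square\<close>)
qed auto

text \<open>Dividing the profile by \<open>r ^ m\<close> cancels the power hidden in
  \<open>mode\<close> and restores the usual radial operator with its centrifugal term;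
  \<open>W\<close> vanishes near the origin, so the quotient is smooth. The angular phase has
  modulus one, whence a statement about \<open>norm (f x)\<close> suffices for norms.\<close>

lemma has_residual_mode_radial:
  assumes m: "m \<ge> 1" and W: "smooth_on UNIV W" "0 < r\<^sub>1" "r\<^sub>2 < R" "\<And>r. \<not> (r\<^sub>1 \<le> r \<and> r \<le> r\<^sub>2) \<Longrightarrow> W r = 0"
    and A: "smooth_on {0<..<R} A" "\<And>r. 0 < r \<Longrightarrow> r < R \<Longrightarrow> n r powi (p - 1) = A r"
    and A': "\<And>r. 0 < r \<Longrightarrow> r < R \<Longrightarrow> (A has_real_derivative A' r) (at r)"
    and W': "\<And>r. (W has_real_derivative W' r) (at r)" and W'': "\<And>r. (W' has_real_derivative W'' r) (at r)"
  obtains f where "has_residual n p k (mode m (\<lambda>r. W r * inverse (r ^ m))) f"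
    "\<And>x. r\<^sub>1 \<le> norm x \<Longrightarrow> norm x \<le> r\<^sub>2 \<Longrightarrow> norm (f x) = \<bar>A (norm x) * W'' (norm x) + (A' (norm x) + A (norm x) / norm x) * W' (norm x) -
       (real m)\<^sup>2 * A (norm x) * W (norm x) / (norm x)\<^sup>2 + k\<^sup>2 * n (norm x) powi (p + 1) * W (norm x)\<bar>"
    "\<And>x. \<not> (r\<^sub>1 \<le> norm x \<and> norm x \<le> r\<^sub>2) \<Longrightarrow> f x = 0"
proof -
  define h where "h = (\<lambda>r. W r * inverse (r ^ m))"
  have h_smooth: "smooth_on UNIV h"
  proof (rule smooth_on_UNIV_if_supported[of "{0<..}" _ "{r\<^sub>1..r\<^sub>2}"])
    have "smooth_on {0<..} (\<lambda>r::real. inverse (r ^ m))"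
      by (intro smooth_on_inverse smooth_on_power smooth_on_id) auto
    then show "smooth_on {0<..} h"
      unfolding h_def using smooth_on_subset[OF W(1)] by (intro smooth_on_mult) auto
  qed (use W in \<open>auto simp: h_def\<close>)
  have h_out: "h r = 0" if "\<not> (r\<^sub>1 \<le> r \<and> r \<le> r\<^sub>2)" for r using W(4)[OF that] by (simp add: h_def)
  define h1 where "h1 = (\<lambda>r. (W' r - real m * (W r / r)) * inverse (r ^ m))"
  define h2 where "h2 = (\<lambda>r. (W'' r - real m * ((W' r * r - W r) / (r * r)) - real m / r * (W' r - real m * (W r / r))) * inverse (r ^ m))"
  have h1: "(h has_real_derivative h1 r) (at r)" if "r > 0" for r
    unfolding h_def using DERIV_mult'[OF W'[of r] inverse_power_has_derivative[OF that, of m]]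
    by (rule DERIV_cong) (simp add: h1_def algebra_simps)
  have h2: "(h1 has_real_derivative h2 r) (at r)" if "r > 0" for r
  proof -
    have "((\<lambda>r. W' r - real m * (W r / r)) has_real_derivative W'' r - real m * ((W' r * r - W r * 1) / (r * r))) (at r)"
      by (intro DERIV_diff DERIV_cmult DERIV_divide W' W'' DERIV_ident) (use that in auto)
    from DERIV_mult'[OF this inverse_power_has_derivative[OF that, of m]]
    show ?thesis unfolding h1_def by (rule DERIV_cong) (simp add: h2_def algebra_simps)
  qed
  have d1: "deriv h r = h1 r" if "r > 0" for r using h1[OF that] by (rule DERIV_imp_deriv)
  have d2: "deriv (deriv h) r = h2 r" if "r > 0" for r
  proof -
    have "(deriv h has_real_derivative h2 r) (at r)"
      by (rule has_field_derivative_transform_within_open[OF h2[OF that], of "{0<..}"]) (use that d1 in auto)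
    then show ?thesis by (rule DERIV_imp_deriv)
  qed
  obtain f where f: "has_residual n p k (mode m h) f"
    "\<And>x. r\<^sub>1 \<le> norm x \<Longrightarrow> norm x \<le> r\<^sub>2 \<Longrightarrow> f x = - mode m (\<lambda>r. A r * deriv (deriv h) r + A' r * deriv h r + (1 + 2 * real m) * A r * deriv h r / r +
       real m * A' r * h r / r + k\<^sup>2 * n r powi (p + 1) * h r) x"
    "\<And>x. \<not> (r\<^sub>1 \<le> norm x \<and> norm x \<le> r\<^sub>2) \<Longrightarrow> f x = 0"
    by (rule has_residual_mode[OF m h_smooth W(2,3) h_out A A' smooth_on_UNIV_deriv(1)[OF h_smooth]
        smooth_on_UNIV_deriv(1)[OF smooth_on_UNIV_deriv(2)[OF h_smooth]], of k]) (assumption | rule that)+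
  show ?thesis
  proof (rule that)
    show "has_residual n p k (mode m (\<lambda>r. W r * inverse (r ^ m))) f" using f(1) by (simp add: h_def)
    show "f x = 0" if "\<not> (r\<^sub>1 \<le> norm x \<and> norm x \<le> r\<^sub>2)" for x by (rule f(3)[OF that])
    fix x :: "real^2" assume x: "r\<^sub>1 \<le> norm x" "norm x \<le> r\<^sub>2"
    define r where "r = norm x"
    have r: "r > 0" using x W(2) unfolding r_def by linarith
    have "(A r * h2 r + A' r * h1 r + (1 + 2 * real m) * A r * h1 r / r + real m * A' r * h r / r + k\<^sup>2 * n r powi (p + 1) * h r) * r ^ m =
      A r * W'' r + (A' r + A r / r) * W' r - (real m)\<^sup>2 * A r * W r / r\<^sup>2 + k\<^sup>2 * n r powi (p + 1) * W r"
    proof -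
      have inv: "v * inverse (r ^ m) * r ^ m = v" for v using r by simp
      have "(a * (v2 * i) + a' * (v1 * i) + c * a * (v1 * i) / r + M * a' * (v * i) / r + K * (v * i)) * P =
        a * (v2 * i * P) + a' * (v1 * i * P) + c * a * (v1 * i * P) / r + M * a' * (v * i * P) / r + K * (v * i * P)"
        for a a' c M K v v1 v2 i P :: real by (simp add: algebra_simps add_divide_distrib)
      then have "(A r * h2 r + A' r * h1 r + (1 + 2 * real m) * A r * h1 r / r + real m * A' r * h r / r + k\<^sup>2 * n r powi (p + 1) * h r) * r ^ m =
        A r * (W'' r - real m * ((W' r * r - W r) / (r * r)) - real m / r * (W' r - real m * (W r / r))) + A' r * (W' r - real m * (W r / r)) +
        (1 + 2 * real m) * A r * (W' r - real m * (W r / r)) / r + real m * A' r * W r / r + k\<^sup>2 * n r powi (p + 1) * W r"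
        unfolding h_def h1_def h2_def by (simp only: inv)
      also have "\<dots> = A r * W'' r + (A' r + A r / r) * W' r - (real m)\<^sup>2 * A r * W r / r\<^sup>2 + k\<^sup>2 * n r powi (p + 1) * W r"
        using r by (simp add: field_simps power2_eq_square)
      finally show ?thesis .
    qed
    then show "norm (f x) = \<bar>A (norm x) * W'' (norm x) + (A' (norm x) + A (norm x) / norm x) * W' (norm x) -
       (real m)\<^sup>2 * A (norm x) * W (norm x) / (norm x)\<^sup>2 + k\<^sup>2 * n (norm x) powi (p + 1) * W (norm x)\<bar>"
      unfolding f(2)[OF x] norm_minus_cancel norm_mode r_def[symmetric] d1[OF r] d2[OF r] by simp
  qed
qed

lemma symbol_smooth_in_s:
  assumes "symbol F" "t \<in> {0..1}"
  shows "smooth_on UNIV (F t)"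
proof (rule smooth_on_coinduct_vector[where P = "\<lambda>u. \<exists>F. symbol F \<and> u = F t"])
  fix u assume "\<exists>F. symbol F \<and> u = F t"
  then obtain F where F: "symbol F" "u = F t" by blast
  then show "\<exists>g'. (\<forall>x\<in>UNIV. (u has_vector_derivative g' x) (at x)) \<and> (\<exists>F. symbol F \<and> g' = F t)"
    using symbol_has_derivative(2)[OF F(1) assms(2)] symbol_Ds[OF F(1)]
    unfolding has_real_derivative_iff_has_vector_derivative by (intro exI[of _ "Ds F t"]) auto
qed (use assms in blast)

lemma smooth_on_gaussian: "smooth_on S (gaussian \<alpha>)"
proof -
  have "smooth_on S (\<lambda>s. exp ((- (\<alpha> / 2)) * (s * s)))"
    by (intro smooth_on_exp smooth_on_mult smooth_on_const smooth_on_id)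
  then show ?thesis by (simp add: gaussian_def[abs_def] power2_eq_square)
qed

text \<open>A vanishing integral would make \<open>f\<close> zero almost everywhere, but continuity
  makes it positive on an interval.\<close>

lemma integral_pos_of_continuous:
  fixes f :: "real \<Rightarrow> real"
  assumes "integrable lborel f" "\<And>s. f s \<ge> 0" "isCont f s\<^sub>1" "f s\<^sub>1 > 0"
  shows "(LINT s|lborel. f s) > 0"
proof (rule ccontr)
  assume "\<not> (LINT s|lborel. f s) > 0"
  moreover have "(LINT s|lborel. f s) \<ge> 0" using assms(2) by simp
  ultimately have "(LINT s|lborel. f s) = 0" by linarith
  then have "AE s in lborel. f s = 0"
    using integral_nonneg_eq_0_iff_AE[OF assms(1)] assms(2) by simp
  then obtain N where N: "N \<in> null_sets lborel" "{s \<in> space lborel. f s \<noteq> 0} \<subseteq> N"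
    unfolding eventually_ae_filter by blast
  have "\<forall>\<^sub>F s in nhds s\<^sub>1. f s > 0"
    using assms(3,4) order_tendstoD(1)[of f "f s\<^sub>1" "nhds s\<^sub>1" 0] by (simp add: isCont_def tendsto_at_iff_tendsto_nhds)
  then obtain d where d: "d > 0" "\<And>s. dist s s\<^sub>1 < d \<Longrightarrow> f s > 0" unfolding eventually_nhds_metric by blast
  have "{s\<^sub>1 - d<..<s\<^sub>1 + d} \<subseteq> N" 
  proof
    fix s assume "s \<in> {s\<^sub>1 - d<..<s\<^sub>1 + d}"
    then have "dist s s\<^sub>1 < d" by (auto simp: dist_real_def)
    then show "s \<in> N" using d(2)[of s] N(2) by auto
  qed
  then have "{s\<^sub>1 - d<..<s\<^sub>1 + d} \<in> null_sets lborel" using N(1) by (rule null_sets_subset[rotated 2]) auto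
  then show False using d(1) by (simp add: null_sets_def)
qed

text \<open>Coefficients are compared in \<open>K^2 = c^2 (1 + t^2 e)\<close>, so the root is never
  differentiated: order one gives \<open>2 c d 1 = 0\<close>, order two gives
  \<open>2 c d 2 + (d 1)^2 = c^2 \<epsilon> 0\<close>.\<close>

lemma quasi_eigenvalue_expansion:
  assumes c: "c > 0" and e: "has_taylor (\<lambda>t s. e t) (Abs_fps (\<lambda>k. [:\<epsilon> k:]))" and e_pos: "\<And>t. t \<in> {0..1} \<Longrightarrow> e t > 0"
    and K_def: "K = (\<lambda>t. c * (1 + t\<^sup>2 * e t) powr (1/2))"
  obtains d C where "smooth_on {0..1} K" "\<And>N t. t \<in> {0..1} \<Longrightarrow> \<bar>K t - (\<Sum>l<N. d l * t ^ l)\<bar> \<le> C N * t ^ N"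
    "d 0 = c" "d 1 = 0" "d 2 = c * \<epsilon> 0 / 2"
proof -
  have pos: "1 + t\<^sup>2 * e t > 0" if "t \<in> {0..1}" for t
    using e_pos[OF that] by (intro add_pos_nonneg) auto
  have e_smooth: "smooth_on {0..1} e" using symbol_smooth_in_t[OF has_taylor_symbol[OF e]] .
  have K: "smooth_on {0..1} K"
    unfolding K_def
    by (intro smooth_on_mult smooth_on_const smooth_on_powr smooth_on_add smooth_on_power smooth_on_id e_smooth pos)
  obtain d where d: "has_taylor (\<lambda>t s. K t) (Abs_fps (\<lambda>k. [:d k:]))"
    by (rule exists_taylor_fun_of_t[OF K]) (rule that)
  have "\<exists>C. \<forall>t\<in>{0..1}. \<bar>K t - (\<Sum>l<N. d l * t ^ l)\<bar> \<le> C * t ^ N" for N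
  proof -
    obtain C where "\<And>t s. t \<in> {0..1} \<Longrightarrow> \<bar>K t - (\<Sum>k<N. poly (fps_nth (Abs_fps (\<lambda>k. [:d k:])) k) s * t ^ k)\<bar> \<le> C * t ^ N * exp (1 * s\<^sup>2)"
      by (rule has_taylor_remainder[OF d zero_less_one, of N]) (rule that)
    from this[of _ 0] show ?thesis by (intro exI[of _ C]) simp
  qed
  then obtain C where C: "\<And>N t. t \<in> {0..1} \<Longrightarrow> \<bar>K t - (\<Sum>l<N. d l * t ^ l)\<bar> \<le> C N * t ^ N" by metis
  have "has_taylor (\<lambda>t s. K t * K t) (fps_const [:c\<^sup>2:] * (fps_const [:1:] + fps_X\<^sup>2 * Abs_fps (\<lambda>k. [:\<epsilon> k:])))"
  proof (rule has_taylor_cong)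
    show "has_taylor (\<lambda>t s. c\<^sup>2 * (1 + t\<^sup>2 * e t)) (fps_const [:c\<^sup>2:] * (fps_const [:1:] + fps_X\<^sup>2 * Abs_fps (\<lambda>k. [:\<epsilon> k:])))"
      by (intro has_taylor_mult has_taylor_add has_taylor_power has_taylor_t has_taylor_const e)
    fix t s :: real assume "t \<in> {0..1}"
    then have "(1 + t\<^sup>2 * e t) powr (1/2) * (1 + t\<^sup>2 * e t) powr (1/2) = 1 + t\<^sup>2 * e t"
      using pos[of t] by (simp flip: powr_add)
    then show "c\<^sup>2 * (1 + t\<^sup>2 * e t) = K t * K t" by (simp add: K_def power2_eq_square mult_ac)
  qed
  then have eq: "fps_const [:c\<^sup>2:] * (fps_const [:1:] + fps_X\<^sup>2 * Abs_fps (\<lambda>k. [:\<epsilon> k:])) = Abs_fps (\<lambda>k. [:d k:]) * Abs_fps (\<lambda>k. [:d k:])"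
    using has_taylor_mult[OF d d] by (rule has_taylor_unique)
  have d0: "d 0 = c"
    using has_taylor_at_0[OF d, of 0] by (simp add: K_def)
  have d1: "d 1 = 0"
    using arg_cong[OF eq, of "\<lambda>f. poly (fps_nth f 1) 0"] c d0
    by (simp add: fps_mult_nth[of "Abs_fps (\<lambda>k. [:d k:])"] fps_X_power_mult_nth)
  have "2 * (d 0 * d 2) + d 1 * d 1 = c\<^sup>2 * \<epsilon> 0"
  proof -
    have "fps_nth (fps_X\<^sup>2 * Abs_fps (\<lambda>k. [:\<epsilon> k:])) 2 = [:\<epsilon> 0:]" by (simp add: fps_X_power_mult_nth)
    moreover have "fps_nth (Abs_fps (\<lambda>k. [:d k:]) * Abs_fps (\<lambda>k. [:d k:])) 2 = [:2 * (d 0 * d 2) + d 1 * d 1:]"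
      by (simp add: fps_mult_nth numeral_2_eq_2)
    ultimately show ?thesis
      using arg_cong[OF eq, of "\<lambda>f. poly (fps_nth f 2) 0"] by (simp add: mult.commute)
  qed
  then have "d 2 = c * \<epsilon> 0 / 2" using c d0 d1 by (simp add: power2_eq_square field_simps)
  with K C d0 d1 show ?thesis using that by blast
qed

text \<open>Stated apart so that the choice of families indexed by \<open>j\<close> meets an opaque
  predicate instead of a long conjunction.\<close>

lemma choice3:
  assumes "\<forall>j. \<exists>x y z. P j x y z"
  obtains f g h where "\<And>j. P j (f j) (g j) (h j)"
  using assms by metis

text \<open>The construction for one \<open>j\<close>. All packets are supported in an annulus
  inside the disk, which is why the index is read on \<open>{0<..<R}\<close>.\<close>

lemma quasi_pairs_in_well:
  fixes R R\<^sub>0 :: real and n :: "real \<Rightarrow> real" and p :: int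
  assumes smooth: "smooth_on {0<..<R} n" and pos: "\<forall>r\<in>{0<..<R}. n r > 0"
    and R0: "0 < R\<^sub>0" "R\<^sub>0 < R"
    and crit: "1 + R\<^sub>0 * deriv n R\<^sub>0 / n R\<^sub>0 = 0"
    and mu: "mu_breve R\<^sub>0 n > 0"
  shows "\<exists>(k :: nat \<Rightarrow> real) (u :: nat \<Rightarrow> real^2 \<Rightarrow> complex) (K :: nat \<Rightarrow> real).
    resonance_quasi_pairs R n p k u \<and>
    regular_expansion (1/2) k \<and>
    (\<exists>C :: nat \<Rightarrow> real. \<forall>N. \<forall>m\<ge>1.
       \<bar>k m / real m - (\<Sum>l<N. K l * real m powr (- real l / 2))\<bar>
         \<le> C N * real m powr (- real N / 2)) \<and>
    K 0 = 1 / (R\<^sub>0 * n R\<^sub>0) \<and>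
    K 1 = 0 \<and>
    K 2 = 1 / (R\<^sub>0 * n R\<^sub>0) * (real j + 1/2) * sqrt (mu_breve R\<^sub>0 n) \<and>
    (\<exists>w :: nat \<Rightarrow> real \<Rightarrow> complex.
       (\<forall>m\<ge>1. \<forall>r>0. \<forall>\<theta>. u m (polar r \<theta>) = w m r * exp (\<i> * of_nat m * of_real \<theta>)) \<and>
       (\<forall>m\<ge>1. smooth_on {- sqrt (real m)<..} (\<lambda>\<sigma>. w m (R\<^sub>0 * (1 + \<sigma> / sqrt (real m))))) \<and>
       (\<exists>(\<Phi> :: real \<Rightarrow> real \<Rightarrow> complex) (X :: real \<Rightarrow> real).
          smooth_schwartz_valued {0..1} \<Phi> \<and>
          test_function {0<..} X \<and> (\<forall>\<^sub>F r in nhds R\<^sub>0. X r = 1) \<and>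
          (\<forall>m\<ge>1. \<forall>r>0. w m r =
             of_real (real m powr (1/4)) * of_real (X r) *
             \<Phi> (real m powr (-1/2)) (real m powr (1/2) * (r / R\<^sub>0 - 1)))))"
proof -
  have n: "smooth_on {0<..<R} n" "\<And>r. 0 < r \<Longrightarrow> r < R \<Longrightarrow> n r > 0" using smooth pos by auto

  \<comment> \<open>The well, the amplitude and the eigenvalue correction\<close>
  define \<alpha> where "\<alpha> = sqrt (mu_breve R\<^sub>0 n)"
  have \<alpha>: "\<alpha> > 0" "\<alpha>\<^sup>2 = mu_breve R\<^sub>0 n" using mu by (auto simp: \<alpha>_def)
  have n0: "n R\<^sub>0 > 0" using n(2) R0 by blast
  define A where "A = (\<lambda>r. n r powi (p - 1))"
  define a where "a = (\<lambda>x. n (R\<^sub>0 * (1 + x)) powi (p - 1))"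
  define b where "b = (\<lambda>x. n (R\<^sub>0 * (1 + x)) powi (p + 1) / (n R\<^sub>0)\<^sup>2)"
  obtain \<delta> and a' Y Z c\<^sub>1 c\<^sub>2 c\<^sub>3 c\<^sub>4 :: "real \<Rightarrow> real" where
    c_eq: "\<And>x. \<bar>x\<bar> \<le> 2 * \<delta> \<Longrightarrow> c\<^sub>1 x = a x \<and> c\<^sub>2 x = a' x + a x / (1 + x) \<and> c\<^sub>3 x = a x / (1 + x)\<^sup>2 - b x \<and> c\<^sub>4 x = b x" and
    Z_range: "\<And>x. 0 \<le> Z x \<and> Z x \<le> 1" and Y_1: "\<And>x. \<bar>x\<bar> \<le> \<delta> \<Longrightarrow> Y x = 1" and
    \<delta>: "0 < \<delta>" "4 * \<delta> < 1" "R\<^sub>0 * (1 + 4 * \<delta>) < R" and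
    Y: "smooth_on UNIV Y" "\<And>x. \<bar>x\<bar> \<ge> 2 * \<delta> \<Longrightarrow> Y x = 0" and
    Z: "smooth_on UNIV Z" "\<And>x. \<bar>x\<bar> \<le> 2 * \<delta> \<Longrightarrow> Z x = 1" "\<And>x. \<bar>x\<bar> \<ge> 4 * \<delta> \<Longrightarrow> Z x = 0" and
    a': "\<And>x. \<bar>x\<bar> \<le> 2 * \<delta> \<Longrightarrow> (a has_real_derivative a' x) (at x)" and
    c: "smooth_on UNIV c\<^sub>1" "smooth_on UNIV c\<^sub>2" "smooth_on UNIV c\<^sub>3" "smooth_on UNIV c\<^sub>4" and
    c_0: "\<And>x. \<bar>x\<bar> \<ge> 4 * \<delta> \<Longrightarrow> c\<^sub>1 x = 0 \<and> c\<^sub>2 x = 0 \<and> c\<^sub>3 x = 0 \<and> c\<^sub>4 x = 0" and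
    at_0: "c\<^sub>1 0 > 0" "c\<^sub>4 0 = c\<^sub>1 0" "c\<^sub>3 0 = 0" "deriv c\<^sub>3 0 = 0" "deriv (deriv c\<^sub>3) 0 = 2 * (c\<^sub>1 0 * mu_breve R\<^sub>0 n)"
    by (rule optical_well_coefficients[OF n R0 crit a_def b_def]; (assumption | rule that))
  have at_5: "deriv (deriv c\<^sub>3) 0 = 2 * (c\<^sub>1 0 * \<alpha>\<^sup>2)" using at_0(5) by (simp add: \<alpha>(2))
  obtain F e \<epsilon> where F: "symbol F" and e: "has_taylor (\<lambda>t s. e t) (Abs_fps (\<lambda>k. [:\<epsilon> k:]))" and \<epsilon>: "\<epsilon> 0 = (2 * real j + 1) * \<alpha>" and
    e_pos: "\<And>t. t \<in> {0..1} \<Longrightarrow> e t > 0" and F_nz: "\<exists>s. \<bar>s\<bar> \<le> \<delta> \<and> (\<forall>t\<in>{0..1}. F t s \<noteq> 0)" and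
    res: "has_taylor (residual_symbol \<alpha> c\<^sub>1 c\<^sub>2 c\<^sub>3 c\<^sub>4 e (\<lambda>t s. Y (t * s) * F t s)) 0"
    by (rule quasi_mode_symbols[OF \<alpha>(1) \<delta>(1) Y(1) Y_1 Y(2) c c_0 at_0(1-4) at_5, of j]; (assumption | rule that))
  define Q where "Q = (\<lambda>t s. Y (t * s) * F t s)"
  define Res where "Res = residual_symbol \<alpha> c\<^sub>1 c\<^sub>2 c\<^sub>3 c\<^sub>4 e Q"
  have res: "has_taylor Res 0" using res by (simp add: Res_def Q_def)
  have Y_symbol: "symbol (\<lambda>t s. Y (t * s))"
    by (rule symbol_scaled[OF Y(1), of "{- (2 * \<delta>)..2 * \<delta>}"]) (auto intro!: Y(2))
  have Q: "symbol Q" unfolding Q_def by (rule symbol_mult[OF Y_symbol F])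

  \<comment> \<open>Normalization as a smooth function of t\<close>
  define N where "N = (\<lambda>t. LINT s|lborel. ((Q t s)\<^sup>2 * (1 + t * s)) * exp (- (\<alpha> * s\<^sup>2)))"
  have G: "symbol (\<lambda>t s. (Q t s)\<^sup>2 * (1 + t * s))"
    by (intro symbol_mult symbol_add symbol_power symbol_const symbol_t symbol_s Q)
  have N_smooth: "smooth_on {0..1} N" unfolding N_def by (rule smooth_on_gaussian_integral[OF \<alpha>(1) G])
  have weight: "(Q t s)\<^sup>2 * (1 + t * s) \<ge> 0" for t s
  proof (cases "\<bar>t * s\<bar> \<ge> 2 * \<delta>")
    case False
    then have "1 + t * s \<ge> 0" using \<delta> by (auto simp: abs_if split: if_splits)
    then show ?thesis by simp
  qed (simp add: Q_def Y(2))
  have N_pos: "N t > 0" if t: "t \<in> {0..1}" for t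
    unfolding N_def
  proof -
    obtain s where s: "\<bar>s\<bar> \<le> \<delta>" "F t s \<noteq> 0" using F_nz t by blast
    have ts: "\<bar>t * s\<bar> \<le> \<delta>" using t s(1) mult_mono[of t 1 "\<bar>s\<bar>" \<delta>] by (simp add: abs_mult)
    show "0 < (LINT s|lborel. ((Q t s)\<^sup>2 * (1 + t * s)) * exp (- (\<alpha> * s\<^sup>2)))"
    proof (rule integral_pos_of_continuous[of _ s])
      show "integrable lborel (\<lambda>s. ((Q t s)\<^sup>2 * (1 + t * s)) * exp (- (\<alpha> * s\<^sup>2)))"
        by (rule symbol_gaussian_integrable[OF \<alpha>(1) G t])
      show "0 \<le> ((Q t s)\<^sup>2 * (1 + t * s)) * exp (- (\<alpha> * s\<^sup>2))" for s by (rule mult_nonneg_nonneg[OF weight]) simp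
      show "isCont (\<lambda>s. ((Q t s)\<^sup>2 * (1 + t * s)) * exp (- (\<alpha> * s\<^sup>2))) s"
        by (intro continuous_intros DERIV_isCont[OF symbol_has_derivative(2)[OF Q t]])
      have "1 + t * s > 0" using ts \<delta> by (auto simp: abs_if split: if_splits)
      moreover have "Q t s \<noteq> 0" using Y_1[OF ts] s(2) by (simp add: Q_def)
      ultimately show "0 < ((Q t s)\<^sup>2 * (1 + t * s)) * exp (- (\<alpha> * s\<^sup>2))" by simp
    qed
  qed
  \<comment> \<open>The squared norm of \<open>Q\<close> times the Gaussian over the plane is
    \<open>2 \<pi> R\<^sub>0^2 t N(t)\<close>. The factor \<open>t\<close> is cancelled by the
    square of \<open>m^(1/4)\<close>, and \<open>C\<close> takes care of the rest, smoothly down to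
    \<open>t = 0\<close>.\<close>
  define C where "C = (\<lambda>t. (2 * pi * R\<^sub>0\<^sup>2 * N t) powr (- (1/2)))"
  have N2_pos: "2 * pi * R\<^sub>0\<^sup>2 * N t > 0" if "t \<in> {0..1}" for t using N_pos[OF that] R0 by simp
  have C_smooth: "smooth_on {0..1} C"
    unfolding C_def by (intro smooth_on_powr smooth_on_mult smooth_on_const N_smooth N2_pos)
  have C_sq: "(C t)\<^sup>2 = 1 / (2 * pi * R\<^sub>0\<^sup>2 * N t)" if "t \<in> {0..1}" for t
    using N2_pos[OF that] by (simp add: C_def power2_eq_square powr_minus_divide flip: powr_add)
  obtain C\<^sub>0 where C0: "\<And>t. t \<in> {0..1} \<Longrightarrow> \<bar>C t\<bar> \<le> C\<^sub>0"
  proof -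
    have "bounded (C ` {0..1})"
      using smooth_on_continuous_on[OF C_smooth] by (intro compact_imp_bounded compact_continuous_image) auto
    then obtain B where "\<forall>t\<in>{0..1}. \<bar>C t\<bar> \<le> B" unfolding bounded_iff by auto
    then show ?thesis by (intro that[of B]) auto
  qed

  \<comment> \<open>Quasi-resonances and the substitution of t by a power of m\<close>
  define \<kappa> where "\<kappa> = 1 / (R\<^sub>0 * n R\<^sub>0)"
  have \<kappa>: "\<kappa> > 0" using R0 n0 by (simp add: \<kappa>_def)
  define KK where "KK = (\<lambda>t. \<kappa> * (1 + t\<^sup>2 * e t) powr (1/2))"
  obtain d D where KK: "smooth_on {0..1} KK" "\<And>N t. t \<in> {0..1} \<Longrightarrow> \<bar>KK t - (\<Sum>l<N. d l * t ^ l)\<bar> \<le> D N * t ^ N"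
    and d: "d 0 = \<kappa>" "d 1 = 0" "d 2 = \<kappa> * \<epsilon> 0 / 2"
    by (rule quasi_eigenvalue_expansion[OF \<kappa> e e_pos KK_def]; (assumption | rule that))

  define \<tau> where "\<tau> = (\<lambda>m::nat. real m powr (-1/2))"
  have \<tau>: "0 < \<tau> m" "\<tau> m \<le> 1" "\<tau> m \<in> {0..1}" "real m powr (1/2) = 1 / \<tau> m" "(real m powr (1/4))\<^sup>2 = 1 / \<tau> m"
      "real m = 1 / (\<tau> m)\<^sup>2" "real m powr (- real l / 2) = \<tau> m ^ l" if "m \<ge> 1" for m l
  proof -
    have m: "real m > 0" "real m \<ge> 1" using that by auto
    show 1: "0 < \<tau> m" using m by (simp add: \<tau>_def)
    show 2: "\<tau> m \<le> 1" using powr_mono[of "-1/2" 0 "real m"] m by (simp add: \<tau>_def)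
    show "\<tau> m \<in> {0..1}" using 1 2 by simp
    show 3: "real m powr (1/2) = 1 / \<tau> m" using m by (simp add: \<tau>_def powr_minus_divide)
    show "(real m powr (1/4))\<^sup>2 = 1 / \<tau> m" using m 3 by (simp add: power2_eq_square flip: powr_add)
    show "real m = 1 / (\<tau> m)\<^sup>2" using m by (simp add: \<tau>_def power2_eq_square powr_minus_divide flip: powr_add)
    show "real m powr (- real l / 2) = \<tau> m ^ l"
      using m by (simp add: \<tau>_def powr_powr mult.commute flip: powr_realpow)
  qed

  \<comment> \<open>The quasi-modes, their support and regularity\<close>
  define k where "k = (\<lambda>m. real m * KK (\<tau> m))"
  define \<Phi> where "\<Phi> = (\<lambda>t s. complex_of_real (C t * F t s * gaussian \<alpha> s))"
  define X where "X = (\<lambda>r. Y (r / R\<^sub>0 - 1))"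
  define W where "W = (\<lambda>m r. real m powr (1/4) * X r * (C (\<tau> m) * F (\<tau> m) (real m powr (1/2) * (r / R\<^sub>0 - 1)) *
      gaussian \<alpha> (real m powr (1/2) * (r / R\<^sub>0 - 1))))"
  define u where "u = (\<lambda>m. mode m (\<lambda>r. W m r * inverse (r ^ m)))"
  define r\<^sub>1 where "r\<^sub>1 = R\<^sub>0 * (1 - 2 * \<delta>)"
  define r\<^sub>2 where "r\<^sub>2 = R\<^sub>0 * (1 + 2 * \<delta>)"
  have r12: "0 < r\<^sub>1" "r\<^sub>2 < R"
  proof -
    show "0 < r\<^sub>1" using \<delta> R0 by (simp add: r\<^sub>1_def)
    have "r\<^sub>2 \<le> R\<^sub>0 * (1 + 4 * \<delta>)" unfolding r\<^sub>2_def using R0 \<delta> by (intro mult_left_mono) auto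
    then show "r\<^sub>2 < R" using \<delta>(3) by linarith
  qed
  have annulus: "r\<^sub>1 \<le> r \<and> r \<le> r\<^sub>2 \<longleftrightarrow> \<bar>r / R\<^sub>0 - 1\<bar> \<le> 2 * \<delta>" for r
    using R0 by (auto simp: r\<^sub>1_def r\<^sub>2_def abs_le_iff field_simps)
  have affine: "smooth_on UNIV (\<lambda>r::real. r / R\<^sub>0 - 1)"
    unfolding divide_inverse by (intro smooth_on_diff smooth_on_mult smooth_on_const smooth_on_id)
  have X: "smooth_on UNIV X" "\<And>r. \<not> (r\<^sub>1 \<le> r \<and> r \<le> r\<^sub>2) \<Longrightarrow> X r = 0"
    unfolding X_def annulus using smooth_on_compose[OF Y(1) affine] Y(2) by auto
  have W_out: "W m r = 0" if "\<not> (r\<^sub>1 \<le> r \<and> r \<le> r\<^sub>2)" for m r using X(2)[OF that] by (simp add: W_def)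
  have W_smooth: "smooth_on UNIV (W m)" if m: "m \<ge> 1" for m
    unfolding W_def
    by (intro smooth_on_mult smooth_on_const X smooth_on_compose[OF symbol_smooth_in_s[OF F \<tau>(3)[OF m]]]
      smooth_on_compose[OF smooth_on_gaussian[of UNIV]] affine) auto
  \<comment> \<open>In the scaled variable \<open>X r\<close> is \<open>Y (t * s)\<close>, so the
    truncated packet is the symbol \<open>Q\<close> times the Gaussian and symbol calculus applies
    to it.\<close>
  have W_packet: "W m r = real m powr (1/4) * C (\<tau> m) * (Q (\<tau> m) ((r / R\<^sub>0 - 1) / \<tau> m) * gaussian \<alpha> ((r / R\<^sub>0 - 1) / \<tau> m))"
    if m: "m \<ge> 1" for m r
    using \<tau>(1)[OF m] by (simp add: W_def Q_def X_def \<tau>(4)[OF m])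
  have u_test: "test_function (ball 0 R) (u m)" if m: "m \<ge> 1" for m
    unfolding u_def
  proof (rule mode_test_function[OF _ r12])
    show "smooth_on UNIV (\<lambda>r. W m r * inverse (r ^ m))"
    proof (rule smooth_on_UNIV_if_supported[of "{0<..}" _ "{r\<^sub>1..r\<^sub>2}"])
      have "smooth_on {0<..} (\<lambda>r::real. inverse (r ^ m))"
        by (intro smooth_on_inverse smooth_on_power smooth_on_id) auto
      then show "smooth_on {0<..} (\<lambda>r. W m r * inverse (r ^ m))"
        using smooth_on_subset[OF W_smooth[OF m]] by (intro smooth_on_mult) auto
    qed (use r12 W_out in auto)
  qed (simp add: W_out)
  have norm_u: "norm (u m x) = \<bar>W m (norm x)\<bar>" if m: "m \<ge> 1" for m x
  proof (cases "x = 0")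
    case True
    then show ?thesis using W_out[of 0 m] r12 m by (simp add: u_def norm_mode)
  qed (simp add: u_def norm_mode mult.assoc)
  have W_meas: "W m \<in> borel_measurable borel" if "m \<ge> 1" for m
    using smooth_on_continuous_on[OF W_smooth[OF that]] by (rule borel_measurable_continuous_onI)

  \<comment> \<open>Unit norm\<close>
  have L2_u: "L2_norm_on UNIV (u m) = 1" if m: "m \<ge> 1" for m
  proof -
    let ?t = "\<tau> m"
    note t = \<tau>(1,3)[OF m]
    have "(W m (R\<^sub>0 * (1 + ?t * s)))\<^sup>2 * (1 + ?t * s) = (C ?t)\<^sup>2 / ?t * ((Q ?t s)\<^sup>2 * (1 + ?t * s) * exp (- (\<alpha> * s\<^sup>2)))" for s
    proof -
      have "(gaussian \<alpha> s)\<^sup>2 = exp (- (\<alpha> * s\<^sup>2))" by (simp add: gaussian_def power2_eq_square flip: exp_add)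
      moreover have "(R\<^sub>0 * (1 + ?t * s) / R\<^sub>0 - 1) / ?t = s" using t R0 by simp
      ultimately show ?thesis
        unfolding W_packet[OF m] by (simp add: power_mult_distrib \<tau>(5)[OF m])
    qed
    then have "L2_norm_on UNIV (u m) = sqrt (2 * pi * R\<^sub>0\<^sup>2 * ?t * ((C ?t)\<^sup>2 / ?t * N ?t))"
      using L2_norm_on_radial[OF norm_u[OF m] W_meas[OF m] _ R0(1) t(1)] W_out[of _ m] r12 by (simp add: N_def)
    also have "2 * pi * R\<^sub>0\<^sup>2 * ?t * ((C ?t)\<^sup>2 / ?t * N ?t) = 1"
      unfolding C_sq[OF t(2)] using t N2_pos[OF t(2)] N_pos[OF t(2)] R0 by simp
    finally show ?thesis by simp
  qed

  \<comment> \<open>The residual in scaled variables\<close>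
  have A_smooth: "smooth_on {0<..<R} A" unfolding A_def using n(2) by (intro smooth_on_powi n(1)) auto
  have A_der: "(A has_real_derivative deriv A r) (at r)" if "0 < r" "r < R" for r
    using smooth_on_open_deriv(1)[OF A_smooth] that by simp
  \<comment> \<open>The implication sits under the quantifier so that one residual can be chosen for
    every \<open>m\<close>. The indicator records that the residual vanishes off the
    annulus.\<close>
  have "\<exists>f. m \<ge> 1 \<longrightarrow> has_residual n p (k m) (u m) f \<and> (\<forall>x. norm (f x) =
     \<bar>indicator {r\<^sub>1..r\<^sub>2} (norm x) * (real m powr (1/4) * C (\<tau> m) / (R\<^sub>0\<^sup>2 * \<tau> m ^ 4) *
       (Res (\<tau> m) ((norm x / R\<^sub>0 - 1) / \<tau> m) * gaussian \<alpha> ((norm x / R\<^sub>0 - 1) / \<tau> m)))\<bar>)" for m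
  proof (cases "m \<ge> 1")
    case m: True
    define t where "t = \<tau> m"
    have t: "0 < t" "t \<in> {0..1}" "real m = 1 / t\<^sup>2" using \<tau>[OF m] by (simp_all add: t_def)
    define q where "q = real m powr (1/4) * C t"
    define \<sigma> where "\<sigma> = (\<lambda>r. (r / R\<^sub>0 - 1) / t)"
    define W1 where "W1 = (\<lambda>r. q * (gauss_deriv \<alpha> Q t (\<sigma> r) * gaussian \<alpha> (\<sigma> r) * (1 / (R\<^sub>0 * t))))"
    define W2 where "W2 = (\<lambda>r. q * (gauss_deriv \<alpha> (gauss_deriv \<alpha> Q) t (\<sigma> r) * gaussian \<alpha> (\<sigma> r) * (1 / (R\<^sub>0 * t)) * (1 / (R\<^sub>0 * t))))"
    have W_eq: "W m = (\<lambda>r. q * (Q t (\<sigma> r) * gaussian \<alpha> (\<sigma> r)))"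
      by (rule ext) (simp add: W_packet[OF m] q_def \<sigma>_def t_def)
    have \<sigma>_der: "(\<sigma> has_real_derivative 1 / (R\<^sub>0 * t)) (at r)" for r
      unfolding \<sigma>_def using R0 t by (auto intro!: derivative_eq_intros simp: field_simps)
    have W1: "(W m has_real_derivative W1 r) (at r)" for r
      unfolding W_eq W1_def by (intro DERIV_cmult DERIV_chain2[OF gaussian_times_has_derivative[OF Q t(2)] \<sigma>_der])
    have W2: "(W1 has_real_derivative W2 r) (at r)" for r
      unfolding W1_def W2_def
      by (intro DERIV_cmult DERIV_cmult_right DERIV_chain2[OF gaussian_times_has_derivative[OF symbol_gauss_deriv[OF Q] t(2)] \<sigma>_der])
    have u_eq: "u m = mode m (\<lambda>r. W m r * inverse (r ^ m))" by (simp add: u_def)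
    have A_eq: "n r powi (p - 1) = A r" for r by (simp add: A_def)
    obtain f where f: "has_residual n p (k m) (u m) f"
      "\<And>x. r\<^sub>1 \<le> norm x \<Longrightarrow> norm x \<le> r\<^sub>2 \<Longrightarrow> norm (f x) = \<bar>A (norm x) * W2 (norm x) + (deriv A (norm x) + A (norm x) / norm x) * W1 (norm x) -
       (real m)\<^sup>2 * A (norm x) * W m (norm x) / (norm x)\<^sup>2 + (k m)\<^sup>2 * n (norm x) powi (p + 1) * W m (norm x)\<bar>"
      "\<And>x. \<not> (r\<^sub>1 \<le> norm x \<and> norm x \<le> r\<^sub>2) \<Longrightarrow> f x = 0"
      by (rule has_residual_mode_radial[OF m W_smooth[OF m] r12 W_out A_smooth A_eq A_der W1 W2, of "k m", folded u_eq];
        (assumption | rule that))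
    have "norm (f x) = \<bar>indicator {r\<^sub>1..r\<^sub>2} (norm x) * (q / (R\<^sub>0\<^sup>2 * t ^ 4) * (Res t (\<sigma> (norm x)) * gaussian \<alpha> (\<sigma> (norm x))))\<bar>" for x
    proof (cases "r\<^sub>1 \<le> norm x \<and> norm x \<le> r\<^sub>2")
      case True
      define y where "y = norm x / R\<^sub>0 - 1"
      have y: "\<bar>y\<bar> \<le> 2 * \<delta>" using True by (simp add: y_def annulus)
      have y1: "1 + y > 0" using y \<delta> by (auto simp: abs_if split: if_splits)
      have r: "norm x = R\<^sub>0 * (1 + y)" using R0 by (simp add: y_def field_simps)
      have ts: "t * \<sigma> (norm x) = y" using t by (simp add: \<sigma>_def y_def)
      have a_eq: "A (norm x) = a y" by (simp add: A_def a_def r)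
      have a'_eq: "deriv A (norm x) = a' y / R\<^sub>0"
      proof -
        have "0 < norm x" "norm x < R" using True r12 by auto
        then have "(A has_real_derivative deriv A (R\<^sub>0 * (1 + y))) (at (R\<^sub>0 * (1 + y)))" using A_der r by metis
        then have "((\<lambda>x. A (R\<^sub>0 * (1 + x))) has_real_derivative deriv A (R\<^sub>0 * (1 + y)) * R\<^sub>0) (at y)"
          by (rule DERIV_chain2) (auto intro!: derivative_eq_intros)
        then have "deriv A (R\<^sub>0 * (1 + y)) * R\<^sub>0 = a' y"
          using DERIV_unique[OF _ a'[OF y]] by (simp add: A_def a_def)
        then show ?thesis using R0 by (simp add: r field_simps)
      qed
      \<comment> \<open>\<open>m^2 = t^(-4)\<close> supplies the powers of \<open>t\<close>, and
        \<open>\<kappa>^2\<close> cancels the normalization of \<open>b\<close> by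
        \<open>(n R\<^sub>0)^2\<close> up to \<open>R\<^sub>0^(-2)\<close>.\<close>
      have k_eq: "(k m)\<^sup>2 * n (norm x) powi (p + 1) = (1 + t\<^sup>2 * e t) * b y / (R\<^sub>0\<^sup>2 * t ^ 4)"
      proof -
        have "1 + t\<^sup>2 * e t > 0" using e_pos[OF t(2)] by (intro add_pos_nonneg) auto
        then have "((1 + t\<^sup>2 * e t) powr (1/2))\<^sup>2 = 1 + t\<^sup>2 * e t" by (simp add: power2_eq_square flip: powr_add)
        then have "(k m)\<^sup>2 = (1 / t\<^sup>2)\<^sup>2 * (\<kappa>\<^sup>2 * (1 + t\<^sup>2 * e t))"
          by (simp add: k_def KK_def t_def[symmetric] t(3) power_mult_distrib power_divide)
        moreover have "n (norm x) powi (p + 1) = b y * (n R\<^sub>0)\<^sup>2" using n0 by (simp add: b_def r)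
        ultimately show ?thesis using n0 R0 t by (simp add: \<kappa>_def power2_eq_square power4_eq_xxxx field_simps)
      qed
      define D0 where "D0 = Q t (\<sigma> (norm x))"
      define D1 where "D1 = gauss_deriv \<alpha> Q t (\<sigma> (norm x))"
      define D2 where "D2 = gauss_deriv \<alpha> (gauss_deriv \<alpha> Q) t (\<sigma> (norm x))"
      define g where "g = gaussian \<alpha> (\<sigma> (norm x))"
      have Res: "Res t (\<sigma> (norm x)) = (a y / (1 + y)\<^sup>2 - b y) * D0 - t\<^sup>2 * (b y * (e t * D0)) - t\<^sup>2 * (a y * D2) - t ^ 3 * ((a' y + a y / (1 + y)) * D1)"
        using c_eq[OF y] by (simp add: Res_def residual_symbol_def ts D0_def D1_def D2_def)
      have "A (norm x) * W2 (norm x) + (deriv A (norm x) + A (norm x) / norm x) * W1 (norm x) -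
         (real m)\<^sup>2 * A (norm x) * W m (norm x) / (norm x)\<^sup>2 + (k m)\<^sup>2 * n (norm x) powi (p + 1) * W m (norm x) =
         a y * (q * (D2 * g * (1 / (R\<^sub>0 * t)) * (1 / (R\<^sub>0 * t)))) + (a' y / R\<^sub>0 + a y / (R\<^sub>0 * (1 + y))) * (q * (D1 * g * (1 / (R\<^sub>0 * t)))) -
         (1 / t\<^sup>2)\<^sup>2 * a y * (q * (D0 * g)) / (R\<^sub>0 * (1 + y))\<^sup>2 + (1 + t\<^sup>2 * e t) * b y / (R\<^sub>0\<^sup>2 * t ^ 4) * (q * (D0 * g))"
        by (simp only: k_eq a_eq a'_eq t(3) W_eq W1_def W2_def D0_def D1_def D2_def g_def) (simp only: r)
      also have "\<dots> = - (q / (R\<^sub>0\<^sup>2 * t ^ 4) * (Res t (\<sigma> (norm x)) * g))"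
        unfolding Res using R0 t y1 by (simp add: divide_simps) (simp add: power2_eq_square power3_eq_cube power4_eq_xxxx algebra_simps)
      finally show ?thesis
        using f(2)[of x] True by (simp add: g_def)
    qed (simp add: f(3))
    then show ?thesis using f(1) unfolding q_def \<sigma>_def t_def by blast
  qed auto
  then obtain f where f: "\<And>m. m \<ge> 1 \<Longrightarrow> has_residual n p (k m) (u m) (f m)" "\<And>m x. m \<ge> 1 \<Longrightarrow> norm (f m x) =
     \<bar>indicator {r\<^sub>1..r\<^sub>2} (norm x) * (real m powr (1/4) * C (\<tau> m) / (R\<^sub>0\<^sup>2 * \<tau> m ^ 4) *
       (Res (\<tau> m) ((norm x / R\<^sub>0 - 1) / \<tau> m) * gaussian \<alpha> ((norm x / R\<^sub>0 - 1) / \<tau> m)))\<bar>" by metis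

  \<comment> \<open>Decay of the residual faster than every power of m\<close>
  have decay: "\<exists>B. \<forall>m\<ge>1. L2_norm_on UNIV (f m) \<le> B * \<tau> m ^ (2 * M)" for M
  proof -
    have "\<alpha> / 4 > 0" using \<alpha> by simp
    \<comment> \<open>Four powers of \<open>t\<close> pay for the prefactor \<open>t^(-4)\<close>,
      and the remaining \<open>2 * M\<close> amount to \<open>m^(-M)\<close>. Squaring doubles the
      rate \<open>\<alpha> / 4\<close>, which still uses only half of the squared Gaussian.\<close>
    obtain B where B: "B \<ge> 0" "\<And>t s. t \<in> {0..1} \<Longrightarrow> \<bar>Res t s\<bar> \<le> B * t ^ (2 * M + 4) * exp (\<alpha> / 4 * s\<^sup>2)"
      by (rule has_taylor_vanishing_order[OF res _ \<open>\<alpha> / 4 > 0\<close>, of "2 * M + 4"]) (simp, rule that)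
    define I where "I = (LINT s|lborel. exp (- (\<alpha> / 2 * s\<^sup>2)))"
    have "L2_norm_on UNIV (f m) \<le> sqrt (4 * pi / R\<^sub>0\<^sup>2 * C\<^sub>0\<^sup>2 * B\<^sup>2 * I) * \<tau> m ^ (2 * M)" if m: "m \<ge> 1" for m
    proof -
      define t where "t = \<tau> m"
      have t: "0 < t" "t \<in> {0..1}" and q: "(real m powr (1/4))\<^sup>2 = 1 / t" using \<tau>[OF m] by (simp_all add: t_def)
      define w where "w = (\<lambda>r. indicator {r\<^sub>1..r\<^sub>2} r * (real m powr (1/4) * C t / (R\<^sub>0\<^sup>2 * t ^ 4) *
        (Res t ((r / R\<^sub>0 - 1) / t) * gaussian \<alpha> ((r / R\<^sub>0 - 1) / t))))"
      have nf: "norm (f m x) = \<bar>w (norm x)\<bar>" for x using f(2)[OF m] by (simp add: w_def t_def)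
      have w_meas: "w \<in> borel_measurable borel"
      proof -
        have [measurable]: "Res t \<in> borel_measurable borel" by (rule symbol_measurable[OF has_taylor_symbol[OF res] t(2)])
        show ?thesis unfolding w_def gaussian_def by measurable
      qed
      have w_0: "w r = 0" if "r \<le> 0" for r using that r12 by (simp add: w_def)
      have bound: "(w (R\<^sub>0 * (1 + t * s)))\<^sup>2 * (1 + t * s) \<le> 2 * C\<^sub>0\<^sup>2 * B\<^sup>2 / (R\<^sub>0 ^ 4 * t) * (t ^ (2 * M))\<^sup>2 * exp (- (\<alpha> / 2 * s\<^sup>2))" for s
      proof (cases "R\<^sub>0 * (1 + t * s) \<in> {r\<^sub>1..r\<^sub>2}")
        case True
        then have ts: "\<bar>t * s\<bar> \<le> 2 * \<delta>" using annulus[of "R\<^sub>0 * (1 + t * s)"] R0 by simp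
        have "(w (R\<^sub>0 * (1 + t * s)))\<^sup>2 = (C t)\<^sup>2 / (R\<^sub>0 ^ 4 * t ^ 9) * ((Res t s)\<^sup>2 * exp (- (\<alpha> * s\<^sup>2)))"
        proof -
          have "(gaussian \<alpha> s)\<^sup>2 = exp (- (\<alpha> * s\<^sup>2))" by (simp add: gaussian_def power2_eq_square flip: exp_add)
          moreover have "(R\<^sub>0 * (1 + t * s) / R\<^sub>0 - 1) / t = s" using t R0 by simp
          ultimately show ?thesis
            using True q by (simp add: w_def power_mult_distrib power_divide) (simp add: power_mult[symmetric] eval_nat_numeral field_simps)
        qed
        also have "\<dots> \<le> C\<^sub>0\<^sup>2 / (R\<^sub>0 ^ 4 * t ^ 9) * (B\<^sup>2 * (t ^ (2 * M))\<^sup>2 * t ^ 8 * exp (\<alpha> / 2 * s\<^sup>2) * exp (- (\<alpha> * s\<^sup>2)))"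
        proof (rule mult_mono)
          have "(C t)\<^sup>2 \<le> C\<^sub>0\<^sup>2" using power_mono[OF C0[OF t(2)] abs_ge_zero, of 2] by simp
          then show "(C t)\<^sup>2 / (R\<^sub>0 ^ 4 * t ^ 9) \<le> C\<^sub>0\<^sup>2 / (R\<^sub>0 ^ 4 * t ^ 9)"
            using t by (intro divide_right_mono) auto
          have "(Res t s)\<^sup>2 \<le> (B * t ^ (2 * M + 4) * exp (\<alpha> / 4 * s\<^sup>2))\<^sup>2"
            using power_mono[OF B(2)[OF t(2), of s] abs_ge_zero, of 2] by simp
          also have "\<dots> = B\<^sup>2 * (t ^ (2 * M))\<^sup>2 * t ^ 8 * (exp (\<alpha> / 4 * s\<^sup>2))\<^sup>2"
            by (simp add: power_mult_distrib power_add flip: power_mult)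
          also have "(exp (\<alpha> / 4 * s\<^sup>2))\<^sup>2 = exp (\<alpha> / 2 * s\<^sup>2)" by (simp add: power2_eq_square flip: exp_add)
          finally show "(Res t s)\<^sup>2 * exp (- (\<alpha> * s\<^sup>2)) \<le> B\<^sup>2 * (t ^ (2 * M))\<^sup>2 * t ^ 8 * exp (\<alpha> / 2 * s\<^sup>2) * exp (- (\<alpha> * s\<^sup>2))"
            by (intro mult_right_mono) auto
        qed (use t in auto)
        also have "\<dots> = C\<^sub>0\<^sup>2 * B\<^sup>2 / (R\<^sub>0 ^ 4 * t) * (t ^ (2 * M))\<^sup>2 * (exp (\<alpha> / 2 * s\<^sup>2) * exp (- (\<alpha> * s\<^sup>2)))"
          using t R0 by (simp add: divide_simps) (simp add: eval_nat_numeral mult_ac)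
        also have "exp (\<alpha> / 2 * s\<^sup>2) * exp (- (\<alpha> * s\<^sup>2)) = exp (- (\<alpha> / 2 * s\<^sup>2))" by (simp flip: exp_add)
        finally have "(w (R\<^sub>0 * (1 + t * s)))\<^sup>2 \<le> C\<^sub>0\<^sup>2 * B\<^sup>2 / (R\<^sub>0 ^ 4 * t) * (t ^ (2 * M))\<^sup>2 * exp (- (\<alpha> / 2 * s\<^sup>2))" .
        moreover have "0 \<le> 1 + t * s" "1 + t * s \<le> 2" using ts \<delta> by (auto simp: abs_if split: if_splits)
        ultimately have "(w (R\<^sub>0 * (1 + t * s)))\<^sup>2 * (1 + t * s) \<le> (C\<^sub>0\<^sup>2 * B\<^sup>2 / (R\<^sub>0 ^ 4 * t) * (t ^ (2 * M))\<^sup>2 * exp (- (\<alpha> / 2 * s\<^sup>2))) * 2"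
          using t by (intro mult_mono) auto
        then show ?thesis by (simp add: mult_ac)
      next
        case False
        then show ?thesis using t R0 by (simp add: w_def)
      qed
      have "(LINT s|lborel. (w (R\<^sub>0 * (1 + t * s)))\<^sup>2 * (1 + t * s)) \<le>
          (LINT s|lborel. 2 * C\<^sub>0\<^sup>2 * B\<^sup>2 / (R\<^sub>0 ^ 4 * t) * (t ^ (2 * M))\<^sup>2 * exp (- (\<alpha> / 2 * s\<^sup>2)))"
        using bound t R0 \<alpha> by (intro integral_mono' integrable_mult_right integrable_gaussian) auto
      also have "\<dots> = 2 * C\<^sub>0\<^sup>2 * B\<^sup>2 / (R\<^sub>0 ^ 4 * t) * (t ^ (2 * M))\<^sup>2 * I" by (simp add: I_def)
      finally have "2 * pi * R\<^sub>0\<^sup>2 * t * (LINT s|lborel. (w (R\<^sub>0 * (1 + t * s)))\<^sup>2 * (1 + t * s)) \<le>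
          2 * pi * R\<^sub>0\<^sup>2 * t * (2 * C\<^sub>0\<^sup>2 * B\<^sup>2 / (R\<^sub>0 ^ 4 * t) * (t ^ (2 * M))\<^sup>2 * I)"
        using t by (intro mult_left_mono) auto
      also have "\<dots> = 4 * pi / R\<^sub>0\<^sup>2 * C\<^sub>0\<^sup>2 * B\<^sup>2 * I * (t ^ (2 * M))\<^sup>2"
        using t R0 by (simp add: field_simps eval_nat_numeral)
      finally have le: "2 * pi * R\<^sub>0\<^sup>2 * t * (LINT s|lborel. (w (R\<^sub>0 * (1 + t * s)))\<^sup>2 * (1 + t * s)) \<le>
          4 * pi / R\<^sub>0\<^sup>2 * C\<^sub>0\<^sup>2 * B\<^sup>2 * I * (t ^ (2 * M))\<^sup>2" .
      have "L2_norm_on UNIV (f m) = sqrt (2 * pi * R\<^sub>0\<^sup>2 * t * (LINT s|lborel. (w (R\<^sub>0 * (1 + t * s)))\<^sup>2 * (1 + t * s)))"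
        by (rule L2_norm_on_radial[OF nf w_meas _ R0(1) t(1)]) (rule w_0)
      also have "\<dots> \<le> sqrt (4 * pi / R\<^sub>0\<^sup>2 * C\<^sub>0\<^sup>2 * B\<^sup>2 * I * (t ^ (2 * M))\<^sup>2)"
        using le by (rule real_sqrt_le_mono)
      also have "\<dots> = sqrt (4 * pi / R\<^sub>0\<^sup>2 * C\<^sub>0\<^sup>2 * B\<^sup>2 * I) * t ^ (2 * M)"
        unfolding real_sqrt_mult[of _ "(t ^ (2 * M))\<^sup>2"] using t by simp
      finally show ?thesis by (simp only: t_def)
    qed
    then show ?thesis by blast
  qed
  have rapid: "rapidly_decaying_residual n p k u"
    unfolding rapidly_decaying_residual_def
  proof (intro exI[of _ f] conjI allI impI f(1))
    fix M
    obtain B where B: "\<And>m. m \<ge> 1 \<Longrightarrow> L2_norm_on UNIV (f m) \<le> B * \<tau> m ^ (2 * M)" using decay[of M] by blast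
    show "(\<lambda>m. L2_norm_on UNIV (f m)) \<in> O(\<lambda>m. real m powr (- real M))"
    proof (rule bigoI[of _ "\<bar>B\<bar>"])
      show "\<forall>\<^sub>F m in sequentially. norm (L2_norm_on UNIV (f m)) \<le> \<bar>B\<bar> * norm (real m powr (- real M))"
        using eventually_ge_at_top[of 1]
      proof eventually_elim
        case (elim m)
        have pw: "real m powr (- real M) = \<tau> m ^ (2 * M)" using \<tau>(7)[OF elim, of "2 * M"] by simp
        have "L2_norm_on UNIV (f m) \<ge> 0"
          by (simp add: L2_norm_on_def set_lebesgue_integral_def)
        moreover have "B * \<tau> m ^ (2 * M) \<le> \<bar>B\<bar> * \<tau> m ^ (2 * M)" using \<tau>(1)[OF elim] by (intro mult_right_mono) auto
        ultimately have "\<bar>L2_norm_on UNIV (f m)\<bar> \<le> \<bar>B\<bar> * real m powr (- real M)"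
          unfolding pw using B[OF elim] by linarith
        then show ?case by simp
      qed
    qed
  qed

  \<comment> \<open>Localization and assembly of the quasi-pair\<close>
  define \<X> where "\<X> = (\<lambda>x :: real^2. Z (norm x / R\<^sub>0 - 1))"
  have \<X>_u: "\<X> x *\<^sub>R u m x = u m x" for x m
  proof (cases "r\<^sub>1 \<le> norm x \<and> norm x \<le> r\<^sub>2")
    case True
    then show ?thesis using Z(2) by (simp add: \<X>_def annulus)
  next
    case False
    then show ?thesis using W_out[OF False] by (simp add: u_def mode_def)
  qed
  \<comment> \<open>\<open>4 * \<delta> < 1\<close> makes the cut-off vanish near the origin, the
    only point where \<open>norm\<close> fails to be smooth.\<close>
  have \<X>_test: "test_function (ball 0 R) \<X>"
  proof (rule test_function_annulus)
    show "smooth_on {x. 0 < norm x \<and> norm x < R} \<X>"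
      unfolding \<X>_def
      by (rule smooth_on_radial[of R "\<lambda>r. Z (r / R\<^sub>0 - 1)"], rule smooth_on_subset[OF smooth_on_compose[OF Z(1) affine]]) auto
    show "0 < R\<^sub>0 * (1 - 4 * \<delta>)" using R0 \<delta> by simp
    show "R\<^sub>0 * (1 + 4 * \<delta>) < R" by (rule \<delta>(3))
    show "\<X> x = 0" if "\<not> (R\<^sub>0 * (1 - 4 * \<delta>) \<le> norm x \<and> norm x \<le> R\<^sub>0 * (1 + 4 * \<delta>))" for x
    proof -
      have "\<bar>norm x / R\<^sub>0 - 1\<bar> \<ge> 4 * \<delta>" using that R0 by (auto simp: field_simps abs_if)
      then show ?thesis by (simp add: \<X>_def Z(3))
    qed
  qed
  have reg: "regular_expansion (1/2) k"
    unfolding regular_expansion_def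
    by (intro exI[of _ KK] conjI KK(1) allI impI) (simp add: k_def \<tau>_def)
  have quasi: "resonance_quasi_pairs R n p k u"
    unfolding resonance_quasi_pairs_def
  proof (intro conjI allI impI rapid exI[of _ \<X>] exI[of _ "1/2 :: real"] reg)
    show "L2_norm_on UNIV (u m) = 1" "H2p R n p (u m)" if "m \<ge> 1" for m
      using L2_u[OF that] H2p_test_function[OF u_test[OF that]] by auto
    show "test_function UNIV \<X>" using \<X>_test unfolding test_function_def by auto
    show "0 \<le> \<X> x" "\<X> x \<le> 1" for x using Z_range by (auto simp: \<X>_def)
    show "1/2 \<le> L2_norm_on UNIV (\<lambda>x. \<X> x *\<^sub>R u m x)" if "m \<ge> 1" for m using L2_u[OF that] by (simp add: \<X>_u)
    show "rapidly_decaying_residual n p k (\<lambda>m x. \<X> x *\<^sub>R u m x)" using rapid by (simp add: \<X>_u)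
  qed simp

  \<comment> \<open>Asymptotic expansion and the form in polar coordinates\<close>
  have expansion: "\<bar>k m / real m - (\<Sum>l<N. d l * real m powr (- real l / 2))\<bar> \<le> D N * real m powr (- real N / 2)" if m: "m \<ge> 1" for m N
    using KK(2)[OF \<tau>(3)[OF m], of N] m by (simp only: \<tau>(7)[OF m]) (simp add: k_def)
  have K2: "d 2 = 1 / (R\<^sub>0 * n R\<^sub>0) * (real j + 1/2) * sqrt (mu_breve R\<^sub>0 n)"
    by (simp add: d(3) \<epsilon> \<kappa>_def \<alpha>_def field_simps)

  define w where "w = (\<lambda>m r. complex_of_real (W m r))"
  have polar_form: "u m (polar r \<theta>) = w m r * exp (\<i> * of_nat m * of_real \<theta>)" if "r > 0" for m r \<theta>
    using that by (simp add: u_def mode_polar w_def)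
  have w_smooth: "smooth_on {- sqrt (real m)<..} (\<lambda>\<sigma>. w m (R\<^sub>0 * (1 + \<sigma> / sqrt (real m))))" if m: "m \<ge> 1" for m
  proof -
    have "smooth_on {- sqrt (real m)<..} (\<lambda>\<sigma>. R\<^sub>0 * (1 + \<sigma> * inverse (sqrt (real m))))"
      by (intro smooth_on_mult smooth_on_add smooth_on_const smooth_on_id)
    from smooth_on_compose[OF W_smooth[OF m] this] show ?thesis
      unfolding w_def by (intro smooth_on_of_real) (auto simp: divide_inverse)
  qed
  have Phi: "smooth_schwartz_valued {0..1} \<Phi>"
    unfolding \<Phi>_def
    by (rule smooth_schwartz_valued_gaussian[OF \<alpha>(1) symbol_mult[OF symbol_fun_of_t[OF C_smooth] F]])
  have X_test: "test_function {0<..} X"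
    unfolding test_function_def using X r12 by (intro conjI exI[of _ "{r\<^sub>1..r\<^sub>2}"]) auto
  have X_near: "\<forall>\<^sub>F r in nhds R\<^sub>0. X r = 1"
    unfolding eventually_nhds_metric
  proof (intro exI[of _ "R\<^sub>0 * \<delta>"] conjI allI impI)
    fix r assume "dist r R\<^sub>0 < R\<^sub>0 * \<delta>"
    then have "\<bar>r / R\<^sub>0 - 1\<bar> \<le> \<delta>" using R0 by (auto simp: dist_real_def abs_if field_simps split: if_splits)
    then show "X r = 1" by (simp add: X_def Y_1)
  qed (use R0 \<delta> in simp)
  have w_form: "w m r = of_real (real m powr (1/4)) * of_real (X r) * \<Phi> (real m powr (-1/2)) (real m powr (1/2) * (r / R\<^sub>0 - 1))" for m r
    by (simp add: w_def W_def \<Phi>_def \<tau>_def)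
  show ?thesis
    using quasi reg expansion d(1)[unfolded \<kappa>_def] d(2) K2 polar_form w_smooth Phi X_test X_near w_form
    by (intro exI[of _ k] exI[of _ u] exI[of _ d] conjI exI[of _ D] exI[of _ w] exI[of _ \<Phi>] exI[of _ X] allI impI) blast+
qed

theorem theorem6:
  fixes R R\<^sub>0 :: real and n :: "real \<Rightarrow> real" and p :: int
  assumes "R > 0"
    and "\<And>r. r > R \<Longrightarrow> n r = 1"
    and "smooth_on {0..R} n"
    and "\<And>r. 0 \<le> r \<Longrightarrow> r \<le> R \<Longrightarrow> n r > 1"
    and "p \<in> {1, -1}"
    and "kappa_breve R n < 0"
    and "0 < R\<^sub>0" and "R\<^sub>0 < R"
    and "1 + R\<^sub>0 * deriv n R\<^sub>0 / n R\<^sub>0 = 0"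
    and "mu_breve R\<^sub>0 n > 0"
  shows "\<exists>(k :: nat \<Rightarrow> nat \<Rightarrow> real) (u :: nat \<Rightarrow> nat \<Rightarrow> real^2 \<Rightarrow> complex) (K :: nat \<Rightarrow> nat \<Rightarrow> real).
    (\<forall>j. resonance_quasi_pairs R n p (k j) (u j) \<and>
      regular_expansion (1/2) (k j) \<and>
      (\<exists>C :: nat \<Rightarrow> real. \<forall>N. \<forall>m\<ge>1.
         \<bar>k j m / real m - (\<Sum>l<N. K j l * real m powr (- real l / 2))\<bar>
           \<le> C N * real m powr (- real N / 2)) \<and>
      K j 0 = 1 / (R\<^sub>0 * n R\<^sub>0) \<and>
      K j 1 = 0 \<and>
      K j 2 = 1 / (R\<^sub>0 * n R\<^sub>0) * (real j + 1/2) * sqrt (mu_breve R\<^sub>0 n) \<and>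
      \<comment> \<open>the factor \<open>m\<^bsup>1/4\<^esup>\<close> is forced by the \<open>L\<^sup>2\<close> normalization of \<open>u j m\<close>\<close>
      (\<exists>w :: nat \<Rightarrow> real \<Rightarrow> complex.
         (\<forall>m\<ge>1. \<forall>r>0. \<forall>\<theta>. u j m (polar r \<theta>) = w m r * exp (\<i> * of_nat m * of_real \<theta>)) \<and>
         (\<forall>m\<ge>1. smooth_on {- sqrt (real m)<..} (\<lambda>\<sigma>. w m (R\<^sub>0 * (1 + \<sigma> / sqrt (real m))))) \<and>
         (\<exists>(\<Phi> :: real \<Rightarrow> real \<Rightarrow> complex) (X :: real \<Rightarrow> real).
            smooth_schwartz_valued {0..1} \<Phi> \<and>
            test_function {0<..} X \<and> (\<forall>\<^sub>F r in nhds R\<^sub>0. X r = 1) \<and>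
            (\<forall>m\<ge>1. \<forall>r>0. w m r =
               of_real (real m powr (1/4)) * of_real (X r) *
               \<Phi> (real m powr (-1/2)) (real m powr (1/2) * (r / R\<^sub>0 - 1)))))) \<and>
    inj (\<lambda>j. K j 2)"
proof -
  have n: "smooth_on {0<..<R} n"
    by (rule smooth_on_subset[OF assms(3)]) auto
  have n_pos: "\<forall>r\<in>{0<..<R}. n r > 0"
  proof
    fix r assume "r \<in> {0<..<R}"
    then show "n r > 0" using assms(4)[of r] by simp
  qed
  note pairs = quasi_pairs_in_well[OF n n_pos assms(7-10), of p]
  obtain k u K where kuK: "\<And>j. resonance_quasi_pairs R n p (k j) (u j) \<and>
      regular_expansion (1/2) (k j) \<and>
      (\<exists>C :: nat \<Rightarrow> real. \<forall>N. \<forall>m\<ge>1.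
         \<bar>k j m / real m - (\<Sum>l<N. K j l * real m powr (- real l / 2))\<bar>
           \<le> C N * real m powr (- real N / 2)) \<and>
      K j 0 = 1 / (R\<^sub>0 * n R\<^sub>0) \<and>
      K j 1 = 0 \<and>
      K j 2 = 1 / (R\<^sub>0 * n R\<^sub>0) * (real j + 1/2) * sqrt (mu_breve R\<^sub>0 n) \<and>
      (\<exists>w :: nat \<Rightarrow> real \<Rightarrow> complex.
         (\<forall>m\<ge>1. \<forall>r>0. \<forall>\<theta>. u j m (polar r \<theta>) = w m r * exp (\<i> * of_nat m * of_real \<theta>)) \<and>
         (\<forall>m\<ge>1. smooth_on {- sqrt (real m)<..} (\<lambda>\<sigma>. w m (R\<^sub>0 * (1 + \<sigma> / sqrt (real m))))) \<and>
         (\<exists>(\<Phi> :: real \<Rightarrow> real \<Rightarrow> complex) (X :: real \<Rightarrow> real).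
            smooth_schwartz_valued {0..1} \<Phi> \<and>
            test_function {0<..} X \<and> (\<forall>\<^sub>F r in nhds R\<^sub>0. X r = 1) \<and>
            (\<forall>m\<ge>1. \<forall>r>0. w m r =
               of_real (real m powr (1/4)) * of_real (X r) *
               \<Phi> (real m powr (-1/2)) (real m powr (1/2) * (r / R\<^sub>0 - 1)))))"
    by (rule choice3[OF allI[OF pairs]]) (rule that)
  have "inj (\<lambda>j. K j 2)"
  proof (rule injI)
    fix i j assume "K i 2 = K j 2"
    moreover have "n R\<^sub>0 > 0" using n_pos assms(7,8) by simp
    ultimately show "i = j" using kuK[of i] kuK[of j] assms(7,10) by simp
  qed
  with kuK show ?thesis by blast
qed

end
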